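(* Let $\mu$ be a finitely supported probability measure on $\mathbb{R}$ with mean zero, let $W_t$ be a standard Wiener process with corresponding filtration $\mathcal{F}_t$, and let $T$ be the Azéma–Yor stopping time embedding $\mu$ in $W$. Let $$\mu_t(E):=\mathbb{P}(W_T\in E\mid\mathcal{F}_t)\qquad(E\subset\mathbb{R}\text{ measurable},\ t\ge 0).$$ For a finitely supported probability measure $\nu$ on $\mathbb{R}$ with at least two atoms, let $l(\nu)=\min\mathrm{Supp}(\nu)$ and let $K[\nu]$ be the unique function on $\mathrm{Supp}(\nu)$ such that (i) $K[\nu]$ is constant on $\mathrm{Supp}(\nu)\setminus\{l(\nu)\}$, (ii) $\int K[\nu](x)\,\nu(dx)=0$, (iii) $\int x\,K[\nu](x)\,\nu(dx)=1$; and let $K[\nu]=0$ if $\nu$ is a Dirac measure. Then, almost surely, for all measurable $E\subset\mathbb{R}$ and all $t>0$, $$\mu_t(E)=\mu(E)+\int_0^t\left(\int_E K[\mu_s](x)\,\mu_s(dx)\right)dW_s.$$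
   Context: The Azéma–Yor stopping time for a centered probability measure $\mu$ is $$T=\inf\{t\ge 0:\ S_t\ge\Psi_\mu(W_t)\},\qquad S_t=\sup_{0\le s\le t}W_s,$$ where $\Psi_\mu(x)=\frac{1}{\mu([x,\infty))}\int_{[x,\infty)}y\,\mu(dy)$ if $\mu([x,\infty))>0$ and $\Psi_\mu(x)=x$ otherwise. It satisfies $W_T\sim\mu$. $\mathrm{Supp}(\nu)$ denotes the (finite) set of atoms of $\nu$. *)

theory Defs
  imports "HOL-Probability.Probability"
begin

section \<open>Finitely supported measures, the kernel K and the barycentre function\<close>

definition Supp :: "real measure \<Rightarrow> real set" where
  "Supp \<nu> = {x. measure \<nu> {x} > 0}"

definition finitely_supported :: "real measure \<Rightarrow> bool" where
  "finitely_supported \<nu> \<longleftrightarrow>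
     prob_space \<nu> \<and> sets \<nu> = sets borel \<and> finite (Supp \<nu>) \<and> measure \<nu> (Supp \<nu>) = 1"

text \<open>The library's \<^const>\<open>extensional\<close> fixes the values outside the support, so that
  a function on \<open>Supp \<nu>\<close> is a unique HOL function.  A finitely supported probability measure
  has at least one atom, hence the second branch is the Dirac case; the value for measures
  without finite support is a dummy.\<close>

definition K_fun :: "real measure \<Rightarrow> real \<Rightarrow> real" where
  "K_fun \<nu> =
     (if finitely_supported \<nu> \<and> card (Supp \<nu>) \<ge> 2
      then (THE k. k \<in> extensional (Supp \<nu>)
              \<and> (\<exists>c. \<forall>x \<in> Supp \<nu> - {Min (Supp \<nu>)}. k x = c)
              \<and> (\<integral>x. k x \<partial>\<nu>) = 0
              \<and> (\<integral>x. x * k x \<partial>\<nu>) = 1)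
      else (\<lambda>x. 0))"

definition barycentre :: "real measure \<Rightarrow> real \<Rightarrow> real" where
  "barycentre \<mu> x =
     (if measure \<mu> {x..} > 0 then (LINT y:{x..}|\<mu>. y) / measure \<mu> {x..} else x)"


section \<open>Wiener process and Azema-Yor time\<close>

text \<open>Processes are indexed by \<^typ>\<open>real\<close>; only times \<open>t \<ge> 0\<close> are meaningful.\<close>

definition natural_filtration ::
  "'a measure \<Rightarrow> (real \<Rightarrow> 'a \<Rightarrow> real) \<Rightarrow> real \<Rightarrow> 'a measure" where
  "natural_filtration M W t =
     sigma (space M) (\<Union>s\<in>{0..t}. {W s -` A \<inter> space M | A. A \<in> sets borel})"

definition wiener_process :: "'a measure \<Rightarrow> (real \<Rightarrow> 'a \<Rightarrow> real) \<Rightarrow> bool" where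
  "wiener_process M W \<longleftrightarrow>
     prob_space M
     \<and> (\<forall>t\<ge>0. W t \<in> borel_measurable M)
     \<and> (AE \<omega> in M. W 0 \<omega> = 0)
     \<and> (\<forall>\<omega>\<in>space M. continuous_on {0..} (\<lambda>t. W t \<omega>))
     \<and> (\<forall>s t. 0 \<le> s \<and> s < t \<longrightarrow>
          distributed M lborel (\<lambda>\<omega>. W t \<omega> - W s \<omega>) (normal_density 0 (sqrt (t - s)))
          \<and> prob_space.indep_set M (sets (natural_filtration M W s))
              {(\<lambda>\<omega>. W t \<omega> - W s \<omega>) -` A \<inter> space M | A. A \<in> sets borel})"

definition running_max :: "(real \<Rightarrow> 'a \<Rightarrow> real) \<Rightarrow> real \<Rightarrow> 'a \<Rightarrow> real" where
  "running_max W t \<omega> = (SUP s\<in>{0..t}. W s \<omega>)"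

definition azema_yor_time ::
  "real measure \<Rightarrow> (real \<Rightarrow> 'a \<Rightarrow> real) \<Rightarrow> 'a \<Rightarrow> ennreal" where
  "azema_yor_time \<mu> W \<omega> =
     Inf {ennreal t | t. t \<ge> 0 \<and> running_max W t \<omega> \<ge> barycentre \<mu> (W t \<omega>)}"

text \<open>On the null event where the time is infinite this has the dummy value \<open>W 0\<close>.\<close>

definition stopped_value ::
  "(real \<Rightarrow> 'a \<Rightarrow> real) \<Rightarrow> ('a \<Rightarrow> ennreal) \<Rightarrow> 'a \<Rightarrow> real" where
  "stopped_value W T \<omega> = W (enn2real (T \<omega>)) \<omega>"


section \<open>The measure-valued process of conditional laws\<close>

text \<open>For each single \<open>t\<close> the conditional law of \<open>X\<close> given \<open>F t\<close> is determined only up to a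
  null set.  As usual for statements about all times simultaneously, we use versions that are
  probability kernels and almost surely right-continuous in time; any two of them
  are indistinguishable.\<close>

definition conditional_law_process ::
  "'a measure \<Rightarrow> (real \<Rightarrow> 'a measure) \<Rightarrow> ('a \<Rightarrow> real) \<Rightarrow> (real \<Rightarrow> 'a \<Rightarrow> real measure) \<Rightarrow> bool" where
  "conditional_law_process M F X Mu \<longleftrightarrow>
     (\<forall>t\<ge>0. Mu t \<in> F t \<rightarrow>\<^sub>M prob_algebra borel)
     \<and> (\<forall>t\<ge>0. \<forall>E\<in>sets borel. AE \<omega> in M.
          measure (Mu t \<omega>) E = real_cond_exp M (F t) (\<lambda>\<omega>'. indicat_real E (X \<omega>')) \<omega>)
     \<and> (AE \<omega> in M. \<forall>E\<in>sets borel. \<forall>t\<ge>0. continuous (at_right t) (\<lambda>s. measure (Mu s \<omega>) E))"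


section \<open>The Ito integral with respect to a Wiener process\<close>

text \<open>A simple process is \<open>\<Sum>i<n. \<xi> i * indicator {p i<..p (i+1)}\<close> with bounded
  \<open>F (p i)\<close>-measurable coefficients \<open>\<xi> i\<close>.\<close>

definition simple_data ::
  "'a measure \<Rightarrow> (real \<Rightarrow> 'a measure) \<Rightarrow> nat \<Rightarrow> (nat \<Rightarrow> real) \<Rightarrow> (nat \<Rightarrow> 'a \<Rightarrow> real) \<Rightarrow> bool" where
  "simple_data M F n p \<xi> \<longleftrightarrow>
     0 \<le> p 0 \<and> (\<forall>i<n. p i \<le> p (Suc i))
     \<and> (\<forall>i<n. \<xi> i \<in> borel_measurable (F (p i)) \<and> (\<exists>C. \<forall>\<omega>\<in>space M. \<bar>\<xi> i \<omega>\<bar> \<le> C))"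

definition simple_process ::
  "nat \<Rightarrow> (nat \<Rightarrow> real) \<Rightarrow> (nat \<Rightarrow> 'a \<Rightarrow> real) \<Rightarrow> real \<Rightarrow> 'a \<Rightarrow> real" where
  "simple_process n p \<xi> s \<omega> = (\<Sum>i<n. \<xi> i \<omega> * indicat_real {p i<..p (Suc i)} s)"

definition simple_integral ::
  "(real \<Rightarrow> 'a \<Rightarrow> real) \<Rightarrow> nat \<Rightarrow> (nat \<Rightarrow> real) \<Rightarrow> (nat \<Rightarrow> 'a \<Rightarrow> real) \<Rightarrow> real \<Rightarrow> 'a \<Rightarrow> real" where
  "simple_integral W n p \<xi> t \<omega> =
     (\<Sum>i<n. \<xi> i \<omega> * (W (min t (p (Suc i))) \<omega> - W (min t (p i)) \<omega>))"

definition progressively_measurable ::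
  "(real \<Rightarrow> 'a measure) \<Rightarrow> (real \<Rightarrow> 'a \<Rightarrow> real) \<Rightarrow> bool" where
  "progressively_measurable F H \<longleftrightarrow>
     (\<forall>t\<ge>0. (\<lambda>(s, \<omega>). H s \<omega>) \<in> borel_measurable (restrict_space borel {0..t} \<Otimes>\<^sub>M F t))"

text \<open>\<open>is_ito_integral M F W H I\<close>: \<open>I\<close> is (a version with almost surely continuous paths of) the
  process \<open>t \<mapsto> \<integral>\<^sub>0\<^sup>t H dW\<close>.  The integrand may be any process indistinguishable from a
  progressively measurable \<open>H'\<close> with almost surely locally square-integrable paths; the latter
  condition is equivalent to the existence of the approximating simple processes.
  The filtration is not assumed to be complete, so \<open>I t\<close> is only
  required to be a random variable; being a limit in probability it is automatically
  \<open>F t\<close>-measurable up to a null set.\<close>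

definition is_ito_integral ::
  "'a measure \<Rightarrow> (real \<Rightarrow> 'a measure) \<Rightarrow> (real \<Rightarrow> 'a \<Rightarrow> real) \<Rightarrow>
   (real \<Rightarrow> 'a \<Rightarrow> real) \<Rightarrow> (real \<Rightarrow> 'a \<Rightarrow> real) \<Rightarrow> bool" where
  "is_ito_integral M F W H I \<longleftrightarrow>
     (\<forall>t\<ge>0. I t \<in> borel_measurable M)
     \<and> (AE \<omega> in M. continuous_on {0..} (\<lambda>t. I t \<omega>))
     \<and> (\<exists>H'. progressively_measurable F H'
          \<and> (AE \<omega> in M. \<forall>s\<ge>0. H s \<omega> = H' s \<omega>)
          \<and> (\<exists>n p \<xi>. (\<forall>k::nat. simple_data M F (n k) (p k) (\<xi> k))
               \<and> (\<forall>t\<ge>0. \<forall>\<epsilon>>0.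
                    (\<lambda>k. measure M {\<omega> \<in> space M.
                       (\<integral>\<^sup>+s\<in>{0..t}. ennreal ((simple_process (n k) (p k) (\<xi> k) s \<omega> - H' s \<omega>)\<^sup>2) \<partial>lborel)
                         > ennreal \<epsilon>}) \<longlonglongrightarrow> 0
                  \<and> (\<lambda>k. measure M {\<omega> \<in> space M.
                       \<bar>simple_integral W (n k) (p k) (\<xi> k) t \<omega> - I t \<omega>\<bar> > \<epsilon>}) \<longlonglongrightarrow> 0)))"

end

(* Let x 0 < ... < x n be the atoms of mu, b i the barycentre of mu restricted to [x i, oo), and
   rho i = mu conditioned on [x i, oo).  The Azema-Yor rule runs in stages: after W has reached its new
   maximum b i, it waits until W leaves (x i, b (i+1)), and it stops if the exit is at x i.  Let sigma i
   be the minimum of T and the first time at which b i is reached.  As long as the rule is in stage i, the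
   conditional law of W_T is the convex combination of delta_{x i} and rho (i+1) with barycentre W_t, which
   is affine in W_t with slope (rho (i+1) - delta_{x i}) / (b (i+1) - x i); this slope is K[mu_t] mu_t.
   Hence mu_t(E) - mu(E) is a finite sum of terms const * W_{min t (sigma i)}, the integrand is a finite
   sum of indicators of {s < sigma i}, and its Riemann sums over a grid converge along every path.  The same
   Riemann sums, whose second moments are bounded, show that mu_t(E) is a bounded martingale with limit
   1_E(W_T), so that it is the conditional probability.  Right continuity identifies any other version. *)

theory Submission
  imports Defs "HOL-Real_Asymp.Real_Asymp"
begin

section \<open>Hitting times of continuous functions\<close>

text \<open>Two obstacles shape the development. The barycentre function jumps at the atoms, so T is
  not visibly a hitting time of a continuous process. Moreover the stage times may be infinite on a
  null set while the filtration is not completed, so measurability has to hold on every path. Both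
  are met by describing stages through hitting times of level 0 by continuous functions, using only
  \<open>before_hit\<close> and \<open>stop_at\<close>, which depend on the path up to t alone. The
  candidate masses are linear combinations of stopped values of W on every path; only their
  identification as probability vectors is restricted to a set of full measure. The integrand is
  constant within a stage although mu_t moves: if q is the mass at the lowest atom, the masses above
  it are proportional to 1 - q, while the constant value of K is proportional to 1 / (1 - q). A
  single null set serves all E and all t because there are finitely many atoms: masses at atoms and
  rational times determine everything.\<close>

definition hit_time :: "(real \<Rightarrow> real) \<Rightarrow> real" where
  "hit_time g = Inf {s. 0 \<le> s \<and> 0 \<le> g s}"

text \<open>Stated on \<open>{0..t}\<close> rather than as \<open>t < hit_time g\<close>: if
  \<open>g\<close> stays negative, \<open>hit_time g\<close> is the infimum of the empty set and
  carries no information, and this form shows that only the path up to \<open>t\<close>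
  matters.\<close>

definition before_hit :: "(real \<Rightarrow> real) \<Rightarrow> real \<Rightarrow> bool" where
  "before_hit g t \<longleftrightarrow> (\<forall>s\<in>{0..t}. g s < 0)"

definition stop_at :: "(real \<Rightarrow> real) \<Rightarrow> real \<Rightarrow> real" where
  "stop_at g t = (if before_hit g t then t else hit_time g)"

lemma hit_time_attained:
  assumes "continuous_on {0..} g" "0 \<le> s" "0 \<le> g s"
  shows "0 \<le> hit_time g" "0 \<le> g (hit_time g)" "hit_time g \<le> s"
proof -
  let ?A = "{s. 0 \<le> s \<and> 0 \<le> g s}"
  have "?A = {0..} \<inter> g -` {0..}" by auto
  moreover have "closed ({0..} \<inter> g -` {0..})"
    using assms(1) by (intro continuous_closed_preimage) auto
  ultimately have "closed ?A" by simp
  moreover have "bdd_below ?A" by (rule bdd_belowI[of _ 0]) auto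
  moreover have "?A \<noteq> {}" using assms by auto
  ultimately have "Inf ?A \<in> ?A" by (metis closed_contains_Inf)
  then show "0 \<le> hit_time g" "0 \<le> g (hit_time g)" by (auto simp: hit_time_def)
  show "hit_time g \<le> s" unfolding hit_time_def
    using assms \<open>bdd_below ?A\<close> by (intro cInf_lower) auto
qed

lemma before_hit_time:
  assumes "0 \<le> s" "s < hit_time g"
  shows "g s < 0"
proof (rule ccontr)
  assume "\<not> ?thesis"
  then have "hit_time g \<le> s" unfolding hit_time_def
    using assms by (intro cInf_lower bdd_belowI[of _ 0]) auto
  then show False using assms by simp
qed

lemma before_hit_iff:
  assumes "continuous_on {0..} g" "0 \<le> s" "0 \<le> g s" "0 \<le> t"
  shows "before_hit g t \<longleftrightarrow> t < hit_time g"
proof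
  assume "before_hit g t"
  then show "t < hit_time g"
    using hit_time_attained[OF assms(1-3)] unfolding before_hit_def by force
next
  assume "t < hit_time g"
  then show "before_hit g t"
    unfolding before_hit_def using before_hit_time[of _ g] by auto
qed

lemma stop_at_eq:
  assumes "continuous_on {0..} g" "0 \<le> s" "0 \<le> g s" "0 \<le> t"
  shows "stop_at g t = min t (hit_time g)"
  using before_hit_iff[OF assms] by (auto simp: stop_at_def)

lemma before_hit_antimono: "before_hit g t \<Longrightarrow> s \<le> t \<Longrightarrow> before_hit g s"
  by (auto simp: before_hit_def)

text \<open>Removes the case of an infinite hitting time: up to a finite horizon it is
  indistinguishable from any \<sigma> beyond that horizon, here \<open>t + 1\<close>.\<close>

lemma stop_at_local:
  assumes "continuous_on {0..} g" "0 \<le> t"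
  shows "\<exists>\<sigma>\<ge>0. \<forall>r\<in>{0..t}. (before_hit g r \<longleftrightarrow> r < \<sigma>) \<and> stop_at g r = min r \<sigma>"
proof (cases "before_hit g t")
  case True
  then show ?thesis
    using assms before_hit_antimono[OF True] by (intro exI[of _ "t + 1"]) (auto simp: stop_at_def)
next
  case False
  then obtain s where "0 \<le> s" "s \<le> t" "0 \<le> g s" by (auto simp: before_hit_def not_less)
  then show ?thesis
    using before_hit_iff[OF assms(1)] stop_at_eq[OF assms(1)] hit_time_attained[OF assms(1)]
    by (intro exI[of _ "hit_time g"]) auto
qed

lemma stop_at_bounds:
  assumes "continuous_on {0..} g" "0 \<le> t"
  shows "0 \<le> stop_at g t" "stop_at g t \<le> t"
  using stop_at_local[OF assms] assms(2) by auto

lemma continuous_on_stop_at: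
  assumes "continuous_on {0..} g"
  shows "continuous_on {0..} (stop_at g)"
proof (cases "\<exists>s\<ge>0. 0 \<le> g s")
  case True
  then obtain s where s: "0 \<le> s" "0 \<le> g s" by auto
  have "continuous_on {0..} (\<lambda>t. min t (hit_time g))" by (intro continuous_intros)
  then show ?thesis
    by (rule continuous_on_eq) (use stop_at_eq[OF assms s] in auto)
next
  case False
  then have "before_hit g t" for t unfolding before_hit_def by (meson atLeastAtMost_iff not_le)
  then have "stop_at g = (\<lambda>t. t)" by (auto simp: stop_at_def)
  then show ?thesis by (simp add: continuous_on_id)
qed

lemma continuous_on_stopped:
  assumes "continuous_on {0..} g" "continuous_on {0..} (w :: real \<Rightarrow> real)"
  shows "continuous_on {0..} (\<lambda>t. w (stop_at g t))"
  by (rule continuous_on_compose2[OF assms(2) continuous_on_stop_at[OF assms(1)]])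
    (use stop_at_bounds[OF assms(1)] in auto)

subsection \<open>Running suprema\<close>

definition runsup :: "(real \<Rightarrow> real) \<Rightarrow> real \<Rightarrow> real" where
  "runsup w t = (SUP s\<in>{0..t}. w s)"

lemma runsup_bdd:
  fixes w :: "real \<Rightarrow> real"
  assumes "continuous_on {0..} w"
  shows "bdd_above (w ` {0..t})"
proof -
  have "compact (w ` {0..t})"
    by (intro compact_continuous_image continuous_on_subset[OF assms]) auto
  then show ?thesis by (intro bounded_imp_bdd_above compact_imp_bounded)
qed

lemma runsup_le_iff:
  assumes "continuous_on {0..} w" "0 \<le> t"
  shows "runsup w t \<le> c \<longleftrightarrow> (\<forall>s\<in>{0..t}. w s \<le> c)"
  unfolding runsup_def using assms(2) runsup_bdd[OF assms(1)] by (subst cSUP_le_iff) auto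

lemma runsup_ge:
  assumes "continuous_on {0..} w" "0 \<le> s" "s \<le> t"
  shows "w s \<le> runsup w t"
  using runsup_le_iff[OF assms(1), of t "runsup w t"] assms by auto

lemma runsup_attained:
  assumes "continuous_on {0..} w" "0 \<le> t"
  shows "\<exists>s\<in>{0..t}. runsup w t = w s"
proof -
  obtain s where s: "s \<in> {0..t}" "\<forall>r\<in>{0..t}. w r \<le> w s"
    using continuous_attains_sup[of "{0..t}" w] assms continuous_on_subset[OF assms(1), of "{0..t}"]
    by auto
  then show ?thesis
    using runsup_le_iff[OF assms, of "w s"] runsup_ge[OF assms(1), of s t] by (intro bexI[of _ s] antisym) auto
qed

lemma runsup_mono:
  assumes "continuous_on {0..} w" "0 \<le> s" "s \<le> t"
  shows "runsup w s \<le> runsup w t"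
  using runsup_le_iff[OF assms(1,2)] runsup_ge[OF assms(1)] assms by auto

text \<open>Lengthening the interval by less than \<open>d\<close> raises the supremum by at most
  the oscillation of \<open>w\<close>. This one-sided estimate together with monotonicity covers
  both sides of \<open>t\<close>; capping \<open>d\<close> by 1 keeps all times in
  \<open>{0..t+1}\<close>, where \<open>w\<close> is uniformly continuous.\<close>

lemma continuous_on_runsup:
  assumes "continuous_on {0..} w"
  shows "continuous_on {0..} (runsup w)"
  unfolding continuous_on_iff
proof (intro ballI allI impI)
  fix t e :: real assume t: "t \<in> {0..}" and e: "0 < e"
  have "uniformly_continuous_on {0..t+1} w"
    by (intro compact_uniformly_continuous continuous_on_subset[OF assms]) auto
  then obtain d where d: "d > 0" "\<And>r r'. r \<in> {0..t+1} \<Longrightarrow> r' \<in> {0..t+1} \<Longrightarrow> dist r' r < d \<Longrightarrow> dist (w r') (w r) < e/2"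
    unfolding uniformly_continuous_on_def using e by (metis half_gt_zero)
  have *: "runsup w v \<le> runsup w u + e/2" if "0 \<le> u" "u \<le> v" "v \<le> t + 1" "v - u < d" for u v
  proof -
    have "w s \<le> runsup w u + e/2" if s: "s \<in> {0..v}" for s
    proof (cases "s \<le> u")
      case True
      then show ?thesis using runsup_ge[OF assms, of s u] s e by auto
    next
      case False
      then have "dist (w s) (w u) < e/2" using that \<open>0 \<le> u\<close> \<open>v \<le> t+1\<close> \<open>v - u < d\<close> \<open>u \<le> v\<close>
        by (intro d(2)) (auto simp: dist_real_def)
      then show ?thesis using runsup_ge[OF assms, of u u] \<open>0 \<le> u\<close> unfolding dist_real_def by linarith
    qed
    then show ?thesis using runsup_le_iff[OF assms, of v] that by auto
  qed
  show "\<exists>d>0. \<forall>x'\<in>{0..}. dist x' t < d \<longrightarrow> dist (runsup w x') (runsup w t) < e"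
  proof (intro exI[of _ "min d 1"] conjI ballI impI)
    fix x' assume x': "x' \<in> {0..}" "dist x' t < min d 1"
    show "dist (runsup w x') (runsup w t) < e"
    proof (cases "x' \<le> t")
      case True
      then show ?thesis using *[of x' t] runsup_mono[OF assms, of x' t] x' e
        by (auto simp: dist_real_def)
    next
      case False
      then show ?thesis using *[of t x'] runsup_mono[OF assms, of t x'] x' e t
        by (auto simp: dist_real_def)
    qed
  qed (use d in auto)
qed

text \<open>The maximum over a compact interval is attained, so the strict inequality survives the
  supremum. This turns an uncountable intersection of events into a condition on one random
  variable.\<close>

lemma before_hit_iff_runsup:
  assumes "continuous_on {0..} g" "0 \<le> t"
  shows "before_hit g t \<longleftrightarrow> runsup g t < 0"
  using runsup_attained[OF assms] runsup_ge[OF assms(1), of _ t]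
  unfolding before_hit_def by force

subsection \<open>Riemann sums of stopped indicators\<close>

text \<open>The indicators \<open>p j < \<sigma>\<close> decrease in \<open>j\<close>, so the sum
  telescopes up to \<open>q\<close>, the first grid point not below \<sigma> (or the last one),
  which overshoots by at most one mesh. The \<open>max\<close> covers \<sigma> below
  \<open>p 0\<close>, where the sum is 0; the clause for \<open>p N < \<sigma>\<close> carries the
  induction.\<close>

lemma telescope_until:
  fixes p :: "nat \<Rightarrow> real" and u :: "real \<Rightarrow> real"
  assumes "\<And>j. p j \<le> p (Suc j)" "\<And>j. p (Suc j) \<le> p j + h" "0 \<le> h"
  shows "\<exists>q. (\<Sum>j<N. of_bool (p j < \<sigma>) * (u (p (Suc j)) - u (p j))) = u q - u (p 0)
      \<and> \<bar>q - max (p 0) (min (p N) \<sigma>)\<bar> \<le> h \<and> (p N < \<sigma> \<longrightarrow> q = p N) \<and> p 0 \<le> q"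
proof (induction N)
  case 0
  then show ?case using assms by (intro exI[of _ "p 0"]) auto
next
  case (Suc N)
  have mono: "p 0 \<le> p N" for N
    by (induction N) (use assms(1) order_trans in \<open>blast+\<close>)
  from Suc obtain q where q: "(\<Sum>j<N. of_bool (p j < \<sigma>) * (u (p (Suc j)) - u (p j))) = u q - u (p 0)"
    "\<bar>q - max (p 0) (min (p N) \<sigma>)\<bar> \<le> h" "p N < \<sigma> \<longrightarrow> q = p N" "p 0 \<le> q" by blast
  show ?case
  proof (cases "p N < \<sigma>")
    case True
    then show ?thesis using q mono[of N] assms(1)[of N] assms(2)[of N] assms(3) mono[of "Suc N"]
      by (intro exI[of _ "p (Suc N)"]) auto
  next
    case False
    then show ?thesis using q mono[of N] assms(1)[of N] assms(2)[of N]
      by (intro exI[of _ q]) auto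
  qed
qed

text \<open>The left-endpoint sum of the indicator of times before \<sigma> telescopes to a
  difference of two values of \<open>w\<close>, so continuity of the single path gives the
  limit.\<close>

lemma grid_sum_tendsto:
  fixes w :: "real \<Rightarrow> real"
  assumes w: "continuous_on {0..} w" and "0 \<le> a" "a \<le> t" "0 \<le> \<sigma>"
    and h: "\<And>k. 0 \<le> h k" "h \<longlonglongrightarrow> 0" and N: "\<forall>\<^sub>F k in sequentially. t \<le> a + real (N k) * h k"
  shows "(\<lambda>k. \<Sum>j<N k. of_bool (a + real j * h k < \<sigma>)
           * (w (min t (a + real (Suc j) * h k)) - w (min t (a + real j * h k))))
         \<longlonglongrightarrow> w (min t \<sigma>) - w (min a \<sigma>)"
proof -
  define p where "p k j = a + real j * h k" for k j
  have "\<exists>q. (\<Sum>j<N k. of_bool (p k j < \<sigma>) * (w (min t (p k (Suc j))) - w (min t (p k j)))) = w (min t q) - w (min t (p k 0))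
      \<and> \<bar>q - max (p k 0) (min (p k (N k)) \<sigma>)\<bar> \<le> h k \<and> p k 0 \<le> q" for k
    using telescope_until[of "p k" "h k" \<sigma> "\<lambda>r. w (min t r)" "N k"] h(1)[of k]
    unfolding p_def by (fastforce simp: algebra_simps)
  then obtain q where q: "\<And>k. (\<Sum>j<N k. of_bool (p k j < \<sigma>) * (w (min t (p k (Suc j))) - w (min t (p k j)))) = w (min t (q k)) - w (min t (p k 0))"
      "\<And>k. \<bar>q k - max (p k 0) (min (p k (N k)) \<sigma>)\<bar> \<le> h k" "\<And>k. p k 0 \<le> q k" by metis
  have lim: "(\<lambda>k. min t (q k)) \<longlonglongrightarrow> max a (min t \<sigma>)"
  proof (rule LIM_zero_cancel, rule Lim_null_comparison[OF _ h(2)])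
    show "\<forall>\<^sub>F k in sequentially. norm (min t (q k) - max a (min t \<sigma>)) \<le> h k"
      using N
    proof eventually_elim
      case (elim k)
      \<comment> \<open>Once the grid covers \<open>t\<close>, cutting \<sigma> at the last grid
        point is invisible after the cut at \<open>t\<close>; the distance bound for
        \<open>q\<close> then passes through \<open>min t\<close>, which does not expand
        distances.\<close>
      then have "max a (min t \<sigma>) = min t (max a (min (p k (N k)) \<sigma>))"
        using \<open>a \<le> t\<close> by (auto simp: p_def min_def max_def)
      then show ?case using q(2)[of k] by (auto simp: p_def min_def)
    qed
  qed
  have "(\<lambda>k. w (min t (q k))) \<longlonglongrightarrow> w (max a (min t \<sigma>))"
    by (rule continuous_on_tendsto_compose[OF w lim])
      (use assms q(3) in \<open>auto simp: p_def intro!: always_eventually intro: order_trans\<close>)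
  then have "(\<lambda>k. w (min t (q k)) - w a) \<longlonglongrightarrow> w (max a (min t \<sigma>)) - w a"
    by (intro tendsto_intros)
  moreover have "w (max a (min t \<sigma>)) - w a = w (min t \<sigma>) - w (min a \<sigma>)"
    using \<open>a \<le> t\<close> by (auto simp: min_def max_def)
  moreover have "min t (p k 0) = a" for k using \<open>a \<le> t\<close> by (simp add: p_def)
  ultimately show ?thesis using q(1) by (simp add: p_def)
qed

text \<open>Here \<open>p\<close> is the left end of the cell containing \<open>s\<close>. The
  indicators disagree only if \<open>p < \<sigma>\<close> and \<open>\<sigma> \<le> s\<close>, which
  places \<open>s\<close> within \<open>h\<close> after \<sigma>.\<close>

lemma step_difference_bound:
  fixes p h s \<sigma> :: real
  assumes "p < s" "s \<le> p + h"
  shows "\<bar>of_bool (p < \<sigma>) - of_bool (s < \<sigma>)\<bar> \<le> (indicat_real {\<sigma>..\<sigma>+h} s)"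
  using assms by (auto simp: indicator_def)

section \<open>The Azema--Yor rule along a path\<close>

locale atom_seq =
  fixes n :: nat and x m :: "nat \<Rightarrow> real"
  assumes x_less: "\<And>i j. i < j \<Longrightarrow> j \<le> n \<Longrightarrow> x i < x j"
    and m_pos: "\<And>i. i \<le> n \<Longrightarrow> 0 < m i"
    and m_sum: "(\<Sum>i\<le>n. m i) = 1"
    and m_mean: "(\<Sum>i\<le>n. m i * x i) = 0"
begin

section \<open>Tail masses, barycentres and conditional weights\<close>

definition "tail i = (\<Sum>j=i..n. m j)"
definition "bary i = (\<Sum>j=i..n. m j * x j) / tail i"
text \<open>The masses of the law called \<open>rho i\<close> in the overview.\<close>

definition "cond_weight i j = (if i \<le> j then m j / tail i else 0)"
text \<open>The mass at \<open>x j\<close> of the signed measure K[mu_t] mu_t while the rule is in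
  stage \<open>i\<close>.\<close>

definition "slope i j = (cond_weight (Suc i) j - of_bool (i = j)) / (bary (Suc i) - x i)"

lemma tail_pos: "i \<le> n \<Longrightarrow> 0 < tail i"
  unfolding tail_def by (intro sum_pos) (auto simp: m_pos)

lemma tail_step: "i \<le> n \<Longrightarrow> tail i = m i + tail (Suc i)"
  unfolding tail_def by (simp add: sum.atLeast_Suc_atMost)

lemma less_bary: "i \<le> n \<Longrightarrow> (\<And>j. i \<le> j \<Longrightarrow> j \<le> n \<Longrightarrow> c < x j) \<Longrightarrow> c < bary i"
proof -
  assume i: "i \<le> n" and c: "\<And>j. i \<le> j \<Longrightarrow> j \<le> n \<Longrightarrow> c < x j"
  have "(\<Sum>j=i..n. m j * c) < (\<Sum>j=i..n. m j * x j)"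
    by (intro sum_strict_mono) (use i c m_pos in auto)
  then have "c * tail i < (\<Sum>j=i..n. m j * x j)"
    unfolding tail_def by (simp add: sum_distrib_left mult.commute)
  then show ?thesis using tail_pos[OF i] by (simp add: bary_def pos_less_divide_eq)
qed

lemma x_less_bary_Suc: "i < n \<Longrightarrow> x i < bary (Suc i)"
  by (intro less_bary) (auto intro: x_less)

lemma bary_step: "i < n \<Longrightarrow> tail i * bary i = m i * x i + tail (Suc i) * bary (Suc i)"
  using tail_pos[of i] tail_pos[of "Suc i"]
  by (simp add: bary_def sum.atLeast_Suc_atMost)

lemma bary_0: "bary 0 = 0"
  using m_mean by (simp add: bary_def atLeast0AtMost)

lemma bary_last: "bary n = x n"
  using m_pos[of n] by (simp add: bary_def tail_def)

text \<open>Splits off the lowest atom. Read for a Wiener path at \<open>bary i\<close>, the ratio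
  \<open>m i / tail i\<close> is the gambler's ruin probability of leaving (\<open>x i\<close>,
  \<open>bary (Suc i)\<close>) at \<open>x i\<close>, which is why the rule embeds the right
  masses.\<close>

lemma bary_convex:
  assumes "i < n"
  shows "bary i = (m i / tail i) * x i + (1 - m i / tail i) * bary (Suc i)"
proof -
  have "bary i = (m i * x i + tail (Suc i) * bary (Suc i)) / tail i"
    using bary_step[OF assms] tail_pos[of i] assms by (simp add: field_simps)
  also have "tail (Suc i) = tail i - m i" using tail_step[of i] assms by simp
  finally show ?thesis using tail_pos[of i] assms by (simp add: field_simps)
qed

lemma weight_ratio: "i < n \<Longrightarrow> 0 < m i / tail i \<and> m i / tail i < 1"
  using tail_pos[of i] tail_pos[of "Suc i"] tail_step[of i] m_pos[of i] by (simp add: field_simps)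

lemma x_less_bary: assumes "i < n" shows "x i < bary i"
proof -
  have "0 < (1 - m i / tail i) * (bary (Suc i) - x i)"
    using weight_ratio[OF assms] x_less_bary_Suc[OF assms] by (intro mult_pos_pos) auto
  then show ?thesis using bary_convex[OF assms] by (simp add: algebra_simps)
qed

lemma bary_less_Suc: assumes "i < n" shows "bary i < bary (Suc i)"
proof -
  have "0 < (m i / tail i) * (bary (Suc i) - x i)"
    using weight_ratio[OF assms] x_less_bary_Suc[OF assms] by (intro mult_pos_pos) auto
  then show ?thesis using bary_convex[OF assms] by (simp add: algebra_simps)
qed

lemma bary_less: "i < j \<Longrightarrow> j \<le> n \<Longrightarrow> bary i < bary j"
proof (induction j)
  case (Suc j)
  then show ?case using bary_less_Suc[of j] by (cases "i = j") auto
qed simp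

lemma bary_mono: "i \<le> j \<Longrightarrow> j \<le> n \<Longrightarrow> bary i \<le> bary j"
  using bary_less[of i j] by (cases "i = j") auto

lemma x_mono: "i \<le> j \<Longrightarrow> j \<le> n \<Longrightarrow> x i \<le> x j"
  using x_less[of i j] by (cases "i = j") auto

lemma cond_weight_convex:
  assumes "i < n"
  shows "cond_weight i j = (m i / tail i) * of_bool (i = j) + (1 - m i / tail i) * cond_weight (Suc i) j"
proof -
  have "1 - m i / tail i = tail (Suc i) / tail i"
    using tail_step[of i] tail_pos[of i] assms by (simp add: field_simps)
  then show ?thesis using tail_pos[of i] tail_pos[of "Suc i"] assms
    by (cases "i = j") (auto simp: cond_weight_def)
qed

text \<open>Both sides are affine in \<open>w\<close>. The number \<open>q w\<close> is the
  probability of leaving the stage interval at \<open>x i\<close> from position \<open>w\<close>, so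
  the right side is the law of W_T as seen from there; on the left the same law is reached from
  \<open>bary i\<close> by moving along \<open>slope i\<close>.\<close>

lemma cond_weight_interpolate:
  assumes "i < n"
  defines "q \<equiv> \<lambda>w. (bary (Suc i) - w) / (bary (Suc i) - x i)"
  shows "cond_weight i j + slope i j * (w - bary i) = q w * of_bool (i = j) + (1 - q w) * cond_weight (Suc i) j"
proof -
  define D where "D = bary (Suc i) - x i"
  define p where "p = m i / tail i"
  define e :: real where "e = of_bool (i = j)"
  define r where "r = cond_weight (Suc i) j"
  have D: "D > 0" using x_less_bary_Suc[OF assms(1)] by (simp add: D_def)
  have b: "bary i = bary (Suc i) - p * D"
    using bary_convex[OF assms(1)] by (simp add: p_def D_def algebra_simps)
  have qw: "q w = (bary (Suc i) - w) / D" by (simp add: q_def D_def)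
  have sl: "slope i j = (r - e) / D" by (simp add: slope_def r_def e_def D_def)
  have cw: "cond_weight i j = p * e + (1 - p) * r"
    using cond_weight_convex[OF assms(1)] by (simp add: p_def e_def r_def)
  show ?thesis unfolding b qw sl cw e_def[symmetric] r_def[symmetric] using D by (simp add: field_simps)
qed

lemma slope_bary_diff:
  "i < n \<Longrightarrow> slope i j * (bary (Suc i) - bary i) = cond_weight (Suc i) j - cond_weight i j"
  using cond_weight_interpolate[of i j "bary (Suc i)"] by simp

lemma cond_weight_0: "cond_weight 0 j = m j"
  using m_sum by (simp add: cond_weight_def tail_def atLeast0AtMost)

lemma cond_weight_sum:
  assumes "i \<le> n" shows "(\<Sum>j\<le>n. cond_weight i j) = 1"
proof -
  have "(\<Sum>j\<le>n. cond_weight i j) = (\<Sum>j\<in>{i..n}. m j / tail i)"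
    by (rule sum.mono_neutral_cong_right) (auto simp: cond_weight_def)
  also have "\<dots> = 1" using tail_pos[OF assms] by (simp add: tail_def flip: sum_divide_distrib)
  finally show ?thesis .
qed

lemma cond_weight_mean:
  assumes "i \<le> n" shows "(\<Sum>j\<le>n. cond_weight i j * x j) = bary i"
proof -
  have "(\<Sum>j\<le>n. cond_weight i j * x j) = (\<Sum>j\<in>{i..n}. m j * x j / tail i)"
    by (rule sum.mono_neutral_cong_right) (auto simp: cond_weight_def)
  also have "\<dots> = bary i" by (simp add: bary_def flip: sum_divide_distrib)
  finally show ?thesis .
qed

lemma cond_weight_nonneg: "i \<le> n \<Longrightarrow> j \<le> n \<Longrightarrow> 0 \<le> cond_weight i j"
  using tail_pos[of i] m_pos[of j] by (auto simp: cond_weight_def)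

text \<open>\<open>gap i S W \<ge> 0\<close> says that \<open>S\<close> has reached \<open>bary i\<close> or that the Azema--Yor rule has already
  stopped at an atom below \<open>x i\<close>; writing it as a continuous function of \<open>(S, W)\<close> makes the stage
  times hitting times of continuous adapted processes although the barycentre function jumps.\<close>

primrec lower_gap :: "nat \<Rightarrow> real \<Rightarrow> real \<Rightarrow> real" where
  "lower_gap 0 s w = -1"
| "lower_gap (Suc i) s w = max (lower_gap i s w) (min (s - bary i) (x i - w))"

definition gap :: "nat \<Rightarrow> real \<Rightarrow> real \<Rightarrow> real" where
  "gap i s w = max (s - bary i) (lower_gap i s w)"

text \<open>For signs, \<open>max\<close> is disjunction and \<open>min\<close> is conjunction; the
  initial value -1 is the empty disjunction.\<close>

lemma lower_gap_nonneg_iff: "0 \<le> lower_gap i s w \<longleftrightarrow> (\<exists>j<i. bary j \<le> s \<and> w \<le> x j)"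
  by (induction i) (auto simp: less_Suc_eq le_max_iff_disj)

lemma gap_nonneg_iff: "0 \<le> gap i s w \<longleftrightarrow> bary i \<le> s \<or> (\<exists>j<i. bary j \<le> s \<and> w \<le> x j)"
  by (auto simp: gap_def le_max_iff_disj lower_gap_nonneg_iff)

definition path_gap :: "(real \<Rightarrow> real) \<Rightarrow> nat \<Rightarrow> real \<Rightarrow> real" where
  "path_gap w i t = gap i (runsup w t) (w t)"

text \<open>Linear in stopped values of the path: each stage contributes its own increment of
  \<open>w\<close> times its slope. Continuity, adaptedness and the martingale property are thereby
  inherited from W, and the meaning as conditional masses is established afterwards, stage by
  stage.\<close>

definition state :: "(real \<Rightarrow> real) \<Rightarrow> real \<Rightarrow> nat \<Rightarrow> real" where
  "state w t j = m j + (\<Sum>i<n. slope i j * (w (stop_at (path_gap w (Suc i)) t) - w (stop_at (path_gap w i) t)))"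

lemma continuous_on_path_gap:
  assumes "continuous_on {0..} w"
  shows "continuous_on {0..} (path_gap w i)"
proof -
  have "continuous_on {0..} (\<lambda>t. lower_gap i (runsup w t) (w t))"
    by (induction i) (auto intro!: continuous_intros continuous_on_runsup assms)
  then show ?thesis unfolding path_gap_def gap_def
    by (intro continuous_intros continuous_on_runsup assms)
qed


text \<open>Shape of \<open>state\<close> during stage \<open>i\<close>: completed stages telescope,
  stage \<open>i\<close> is in progress, later stages have not begun.\<close>

lemma sum_single_step:
  fixes f g :: "nat \<Rightarrow> real"
  assumes "i < n" "\<And>k. k < i \<Longrightarrow> f k = g (Suc k) - g k" "\<And>k. i < k \<Longrightarrow> k < n \<Longrightarrow> f k = 0"
  shows "(\<Sum>k<n. f k) = g i - g 0 + f i"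
proof -
  have "(\<Sum>k<n. f k) = (\<Sum>k<Suc i. f k)"
    by (rule sum.mono_neutral_right) (use assms in auto)
  also have "\<dots> = (\<Sum>k<i. g (Suc k) - g k) + f i" using assms(2) by simp
  also have "\<dots> = g i - g 0 + f i" by (simp add: sum_lessThan_telescope)
  finally show ?thesis .
qed

section \<open>Stage times of one path and the values of the state\<close>

context
  fixes w :: "real \<Rightarrow> real"
  assumes cont: "continuous_on {0..} w" and start: "w 0 = 0"
    and hits: "\<exists>t\<ge>0. 0 \<le> path_gap w n t"
begin

abbreviation \<sigma> where "\<sigma> i \<equiv> hit_time (path_gap w i)"

text \<open>A stop at an atom below \<open>x i\<close> is counted in \<open>gap i\<close> as well,
  and a stop at \<open>x i\<close> itself presupposes that the maximum has reached
  \<open>bary i\<close>. This orders the stage times.\<close>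

lemma path_gap_Suc: "0 \<le> path_gap w (Suc i) t \<Longrightarrow> i < n \<Longrightarrow> 0 \<le> path_gap w i t"
  using bary_less_Suc[of i] unfolding path_gap_def gap_nonneg_iff by (auto simp: less_Suc_eq)

lemma path_gap_antimono: "i \<le> k \<Longrightarrow> k \<le> n \<Longrightarrow> 0 \<le> path_gap w k t \<Longrightarrow> 0 \<le> path_gap w i t"
  by (induction k) (auto simp: le_Suc_eq dest: path_gap_Suc)

lemma hits': "i \<le> n \<Longrightarrow> \<exists>t\<ge>0. 0 \<le> path_gap w i t"
  using hits path_gap_antimono[of i n] by blast

lemma sigma:
  assumes "i \<le> n"
  shows "0 \<le> \<sigma> i" "0 \<le> path_gap w i (\<sigma> i)"
    and "0 \<le> t \<Longrightarrow> 0 \<le> path_gap w i t \<Longrightarrow> \<sigma> i \<le> t"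
    and "0 \<le> t \<Longrightarrow> before_hit (path_gap w i) t \<longleftrightarrow> t < \<sigma> i"
    and "0 \<le> t \<Longrightarrow> stop_at (path_gap w i) t = min t (\<sigma> i)"
  using hits'[OF assms] hit_time_attained[OF continuous_on_path_gap[OF cont]]
    before_hit_iff[OF continuous_on_path_gap[OF cont]] stop_at_eq[OF continuous_on_path_gap[OF cont]]
  by blast+

lemma sigma_mono: "i \<le> k \<Longrightarrow> k \<le> n \<Longrightarrow> \<sigma> i \<le> \<sigma> k"
  using sigma(1,2)[of k] path_gap_antimono[of i k] by (intro sigma(3)) auto

lemma runsup_start: "runsup w 0 = 0"
  using runsup_attained[OF cont, of 0] start by auto

lemma sigma_0: "\<sigma> 0 = 0"
proof -
  have "\<sigma> 0 \<le> 0"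
    by (intro sigma(3)) (auto simp: path_gap_def gap_nonneg_iff runsup_start bary_0)
  then show ?thesis using sigma(1)[of 0] by simp
qed

text \<open>A time at which the running maximum is attained already satisfies the condition defining
  \<open>\<sigma> i\<close>, so it is \<open>\<sigma> i\<close>. Overshooting is excluded by the
  intermediate value theorem, since the path starts at 0, which is at most
  \<open>bary i\<close>.\<close>

lemma reaches_level:
  assumes "i \<le> n" "bary i \<le> runsup w (\<sigma> i)"
  shows "w (\<sigma> i) = bary i" "runsup w (\<sigma> i) = bary i"
proof -
  have ge: "\<sigma> i \<le> s" if "0 \<le> s" "bary i \<le> runsup w s" for s
    using that assms by (intro sigma(3)) (auto simp: path_gap_def gap_nonneg_iff)
  obtain s where s: "0 \<le> s" "s \<le> \<sigma> i" "runsup w (\<sigma> i) = w s"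
    using runsup_attained[OF cont sigma(1)[OF assms(1)]] by auto
  have "\<sigma> i \<le> s" using s assms(2) runsup_ge[OF cont, of s s] by (intro ge) auto
  then have top: "runsup w (\<sigma> i) = w (\<sigma> i)" using s by simp
  have "w (\<sigma> i) \<le> bary i"
  proof (rule ccontr)
    assume *: "\<not> ?thesis"
    have "0 \<le> bary i" using bary_mono[of 0 i] assms(1) by (simp add: bary_0)
    then have "w 0 \<le> bary i" using start by simp
    moreover have "continuous_on {0..\<sigma> i} w"
      by (rule continuous_on_subset[OF cont]) auto
    ultimately obtain r where r: "0 \<le> r" "r \<le> \<sigma> i" "w r = bary i"
      using IVT'[of w 0 "bary i" "\<sigma> i"] * sigma(1)[OF assms(1)] by force
    then have "\<sigma> i \<le> r" using runsup_ge[OF cont, of r r] by (intro ge) auto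
    then show False using r * by simp
  qed
  then show "w (\<sigma> i) = bary i" "runsup w (\<sigma> i) = bary i" using top assms(2) by auto
qed

text \<open>The other way to make \<open>gap i\<close> nonnegative, a stop at an atom below
  \<open>x i\<close>, makes \<open>gap n\<close> nonnegative too and would give
  \<open>\<sigma> n \<le> \<sigma> i\<close>. Hence before the end the stage times are genuine first
  passages to the barycentres.\<close>

lemma stopped_or_level:
  assumes "i \<le> n" "\<sigma> i < \<sigma> n"
  shows "w (\<sigma> i) = bary i" "runsup w (\<sigma> i) = bary i"
proof -
  have "bary i \<le> runsup w (\<sigma> i)"
  proof (rule ccontr)
    assume "\<not> ?thesis"
    then have "\<exists>j<i. bary j \<le> runsup w (\<sigma> i) \<and> w (\<sigma> i) \<le> x j"
      using sigma(2)[OF assms(1)] by (auto simp: path_gap_def gap_nonneg_iff)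
    then have "0 \<le> path_gap w n (\<sigma> i)"
      unfolding path_gap_def gap_nonneg_iff using assms(1) by (meson less_le_trans)
    then have "\<sigma> n \<le> \<sigma> i" using sigma(1)[OF assms(1)] by (intro sigma(3)) auto
    then show False using assms by simp
  qed
  then show "w (\<sigma> i) = bary i" "runsup w (\<sigma> i) = bary i" using reaches_level assms by auto
qed

text \<open>Serves both for times inside stage \<open>i\<close> (with \<open>u = t\<close>) and for
  the final time (with \<open>u\<close> and \<open>t\<close> equal to \<open>\<sigma> n\<close>).
  Completed stages sit at their barycentres, so \<open>slope_bary_diff\<close> telescopes from
  \<open>cond_weight 0\<close> to \<open>cond_weight i\<close>.\<close>

lemma state_eq:
  assumes "i < n" "0 \<le> t" "\<sigma> i < \<sigma> n" "\<And>k. k \<le> i \<Longrightarrow> \<sigma> k \<le> t"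
    and "\<And>k. i < k \<Longrightarrow> k \<le> n \<Longrightarrow> min t (\<sigma> k) = u"
  shows "state w t j = cond_weight i j + slope i j * (w u - bary i)"
proof -
  have lev: "w (min t (\<sigma> k)) = bary k" if "k \<le> i" for k
  proof -
    have "\<sigma> k < \<sigma> n" using sigma_mono[of k i] that assms by simp
    then have "w (\<sigma> k) = bary k" using that assms by (intro stopped_or_level) auto
    then show ?thesis using assms(4)[OF that] by simp
  qed
  let ?f = "\<lambda>k. slope k j * (w (stop_at (path_gap w (Suc k)) t) - w (stop_at (path_gap w k) t))"
  have f: "?f k = slope k j * (w (min t (\<sigma> (Suc k))) - w (min t (\<sigma> k)))" if "k < n" for k
    using that sigma(5)[of k t] sigma(5)[of "Suc k" t] assms(2) by simp
  have "(\<Sum>k<n. ?f k) = cond_weight i j - cond_weight 0 j + ?f i"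
  proof (rule sum_single_step)
    fix k assume k: "k < i"
    have "?f k = slope k j * (bary (Suc k) - bary k)"
      using f[of k] k assms(1) lev[of k] lev[of "Suc k"] by simp
    then show "?f k = cond_weight (Suc k) j - cond_weight k j"
      using slope_bary_diff[of k j] k assms(1) by simp
  next
    fix k assume "i < k" "k < n"
    then show "?f k = 0" using f[of k] assms(5)[of k] assms(5)[of "Suc k"] by simp
  qed (use assms in auto)
  moreover have "?f i = slope i j * (w u - bary i)"
    using f[of i] assms(1) lev[of i] assms(5)[of "Suc i"] by simp
  ultimately show ?thesis by (simp add: state_def cond_weight_0)
qed

lemma last_level:
  assumes "0 \<le> t" "t < \<sigma> n"
  obtains i where "i < n" "\<sigma> i \<le> t" "t < \<sigma> (Suc i)"
proof -
  define A where "A = {k. k \<le> n \<and> \<sigma> k \<le> t}"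
  have fin: "finite A" by (rule finite_subset[of _ "{..n}"]) (auto simp: A_def)
  have "0 \<in> A" using assms by (simp add: A_def sigma_0)
  then have "Max A \<in> A" using fin by (intro Max_in) auto
  then have "Max A \<le> n" "\<sigma> (Max A) \<le> t" by (auto simp: A_def)
  then have "Max A < n" using assms by (metis le_neq_implies_less not_less)
  moreover have "Suc (Max A) \<notin> A"
  proof
    assume "Suc (Max A) \<in> A"
    then have "Suc (Max A) \<le> Max A" using fin by (intro Max_ge)
    then show False by simp
  qed
  ultimately show ?thesis using \<open>\<sigma> (Max A) \<le> t\<close> by (intro that[of "Max A"]) (auto simp: A_def)
qed

text \<open>Since \<open>\<sigma> i\<close> the maximum is at least \<open>bary i\<close>, so
  negativity of \<open>gap (Suc i)\<close> leaves no room for \<open>w t\<close> to be at or below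
  \<open>x i\<close>.\<close>

lemma alive_bounds:
  assumes "i < n" "0 \<le> t" "\<sigma> i \<le> t" "t < \<sigma> (Suc i)"
  shows "x i < w t" "w t < bary (Suc i)"
proof -
  have "\<not> 0 \<le> path_gap w (Suc i) t"
    using sigma(3)[of "Suc i" t] assms by auto
  then have *: "runsup w t < bary (Suc i)" "\<not> (bary i \<le> runsup w t \<and> w t \<le> x i)"
    unfolding path_gap_def gap_nonneg_iff by auto
  have "\<sigma> i < \<sigma> n" using sigma_mono[of "Suc i" n] assms by simp
  then have "bary i \<le> runsup w t"
    using stopped_or_level[of i] runsup_mono[OF cont sigma(1)[of i] assms(3)] assms by simp
  then show "x i < w t" "w t < bary (Suc i)" using * runsup_ge[OF cont, of t t] assms by auto
qed

text \<open>The strict bounds on \<open>q\<close> say that exactly \<open>x i\<close>, ...,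
  \<open>x n\<close> are atoms, which fixes the kernel K; the last clause says which indicators in
  the integrand are active.\<close>

theorem state_before:
  assumes "0 \<le> t" "t < \<sigma> n"
  obtains i q where "i < n" "x i < bary (Suc i)" "0 < q" "q < 1"
    "\<And>j. state w t j = q * of_bool (i = j) + (1 - q) * cond_weight (Suc i) j"
    "\<And>k. k \<le> n \<Longrightarrow> before_hit (path_gap w k) t \<longleftrightarrow> i < k"
proof -
  obtain i where i: "i < n" "\<sigma> i \<le> t" "t < \<sigma> (Suc i)" using last_level[OF assms] .
  define q where "q = (bary (Suc i) - w t) / (bary (Suc i) - x i)"
  note b = alive_bounds[OF i(1) assms(1) i(2,3)]
  have le: "\<sigma> k \<le> t" if "k \<le> i" for k using sigma_mono[of k i] that i by simp
  have gt: "t < \<sigma> k" if "i < k" "k \<le> n" for k using sigma_mono[of "Suc i" k] that i by simp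
  have "state w t j = cond_weight i j + slope i j * (w t - bary i)" for j
  proof (rule state_eq)
    show "\<sigma> i < \<sigma> n" using i gt[of n] le[of i] by simp
    show "min t (\<sigma> k) = t" if "i < k" "k \<le> n" for k
      using gt[OF that] by simp
  qed (fact i(1) assms(1) le)+
  then have "state w t j = q * of_bool (i = j) + (1 - q) * cond_weight (Suc i) j" for j
    using cond_weight_interpolate[OF i(1)] by (simp add: q_def)
  moreover have "before_hit (path_gap w k) t \<longleftrightarrow> i < k" if "k \<le> n" for k
    using sigma(4)[OF that assms(1)] le[of k] gt[of k] that by force
  moreover have "0 < q" "q < 1" using b by (auto simp: q_def)
  ultimately show ?thesis using that i(1) x_less_bary_Suc[OF i(1)] by blast
qed

text \<open>Let \<open>i\<close> be the last stage with \<open>\<sigma> i < \<sigma> n\<close>; its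
  interval is left exactly at \<open>\<sigma> n\<close>. An exit at the top is a stop only in the
  final stage, where \<open>bary n = x n\<close>; any other exit is at \<open>x i\<close>. In either
  case the interpolation weight is 0 or 1.\<close>

lemma stopped_at_atom:
  "\<exists>i\<le>n. w (\<sigma> n) = x i \<and> (\<forall>j\<le>n. state w (\<sigma> n) j = of_bool (i = j))"
proof (cases "n = 0")
  case True
  have "w (\<sigma> n) = x 0" using True sigma_0 start bary_0 bary_last by simp
  moreover have "state w t 0 = 1" for t unfolding state_def using True m_sum by simp
  ultimately show ?thesis using True by auto
next
  case False
  \<comment> \<open>At time 0 path and maximum are both 0. Stopping there would need
    \<open>bary n \<le> 0\<close>, impossible for \<open>n > 0\<close> since
    \<open>bary 0 = 0\<close>, or an atom with \<open>bary j \<le> x j\<close> and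
    \<open>j < n\<close>.\<close>
  have "\<sigma> n \<noteq> 0"
  proof
    assume "\<sigma> n = 0"
    then have "0 \<le> path_gap w n 0" using sigma(2)[of n] by simp
    then have "bary n \<le> 0 \<or> (\<exists>j<n. bary j \<le> 0 \<and> 0 \<le> x j)"
      by (simp add: path_gap_def gap_nonneg_iff runsup_start start)
    moreover have "0 < bary n" using bary_less[of 0 n] False by (simp add: bary_0)
    ultimately obtain j where "j < n" "bary j \<le> 0" "0 \<le> x j" by auto
    then show False using x_less_bary[of j] by simp
  qed
  then have pos: "0 < \<sigma> n" using sigma(1)[of n] by simp
  define A where "A = {k. k < n \<and> \<sigma> k < \<sigma> n}"
  have fin: "finite A" by (rule finite_subset[of _ "{..n}"]) (auto simp: A_def)
  have "0 \<in> A" using pos False by (simp add: A_def sigma_0)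
  then have "Max A \<in> A" using fin by (intro Max_in) auto
  define i where "i = Max A"
  have i: "i < n" "\<sigma> i < \<sigma> n" using \<open>Max A \<in> A\<close> by (auto simp: A_def i_def)
  have next_eq: "\<sigma> (Suc i) = \<sigma> n"
  proof (rule ccontr)
    assume ne: "\<sigma> (Suc i) \<noteq> \<sigma> n"
    then have "Suc i \<noteq> n" by metis
    then have "Suc i \<in> A" using i ne sigma_mono[of "Suc i" n] by (simp add: A_def)
    then have "Suc i \<le> Max A" using fin by (intro Max_ge)
    then show False by (simp add: i_def)
  qed
  have le: "\<sigma> k \<le> \<sigma> n" if "k \<le> i" for k using sigma_mono[of k n] that i by simp
  have eq: "\<sigma> k = \<sigma> n" if "i < k" "k \<le> n" for k
    using sigma_mono[of "Suc i" k] sigma_mono[of k n] that next_eq by simp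
  have "state w (\<sigma> n) j = cond_weight i j + slope i j * (w (\<sigma> n) - bary i)" for j
  proof (rule state_eq)
    show "min (\<sigma> n) (\<sigma> k) = \<sigma> n" if "i < k" "k \<le> n" for k
      using eq[OF that] by simp
  qed (fact i(1) sigma(1)[OF order_refl] i(2) le)+
  then have st: "state w (\<sigma> n) j = (bary (Suc i) - w (\<sigma> n)) / (bary (Suc i) - x i) * of_bool (i = j)
      + (1 - (bary (Suc i) - w (\<sigma> n)) / (bary (Suc i) - x i)) * cond_weight (Suc i) j" for j
    using cond_weight_interpolate[OF i(1), of j] by simp
  have D: "x i < bary (Suc i)" using x_less_bary_Suc[OF i(1)] .
  have S_ge: "bary i \<le> runsup w (\<sigma> n)"
    using stopped_or_level[of i] runsup_mono[OF cont sigma(1)[of i], of "\<sigma> n"] i by simp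
  show ?thesis
  proof (cases "bary (Suc i) \<le> runsup w (\<sigma> n)")
    case True
    have lev: "w (\<sigma> n) = bary (Suc i)" "runsup w (\<sigma> n) = bary (Suc i)"
      using reaches_level[of "Suc i"] True i next_eq by auto
    \<comment> \<open>Path and maximum coincide at \<open>bary (Suc i)\<close>. If this were not the
      last level, a stop would require an atom \<open>x j\<close> at least this high with
      \<open>bary j\<close> at most this high, hence \<open>j \<le> Suc i\<close>, but those atoms
      all lie strictly below \<open>bary (Suc i)\<close>.\<close>
    have "Suc i = n"
    proof (rule ccontr)
      assume "Suc i \<noteq> n"
      then have "Suc i < n" using i by simp
      have "bary n \<le> bary (Suc i) \<or> (\<exists>j<n. bary j \<le> bary (Suc i) \<and> bary (Suc i) \<le> x j)"
        using sigma(2)[of n] by (simp add: path_gap_def gap_nonneg_iff lev)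
      then obtain j where j: "j < n" "bary j \<le> bary (Suc i)" "bary (Suc i) \<le> x j"
        using bary_less[OF \<open>Suc i < n\<close>] by auto
      then have "j \<le> Suc i" using bary_less[of "Suc i" j] by force
      then have "x j \<le> x (Suc i)" using \<open>Suc i < n\<close> by (intro x_mono) auto
      then show False using j x_less_bary[OF \<open>Suc i < n\<close>] by simp
    qed
    then have "w (\<sigma> n) = x n" using lev bary_last by simp
    moreover have "tail n = m n" by (simp add: tail_def)
    moreover have "state w (\<sigma> n) j = of_bool (n = j)" if "j \<le> n" for j
    proof -
      have "state w (\<sigma> n) j = cond_weight (Suc i) j" using st[of j] lev(1) by simp
      also have "\<dots> = cond_weight n j" by (simp only: \<open>Suc i = n\<close>)
      also have "\<dots> = of_bool (n = j)"
        using that m_pos[of n] \<open>tail n = m n\<close> by (auto simp: cond_weight_def)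
      finally show ?thesis .
    qed
    ultimately show ?thesis by blast
  next
    case False
    then obtain j where j: "j < Suc i" "bary j \<le> runsup w (\<sigma> n)" "w (\<sigma> n) \<le> x j"
      using sigma(2)[of "Suc i"] i by (auto simp: path_gap_def gap_nonneg_iff next_eq)
    \<comment> \<open>A path ending below \<open>x i\<close> would meet \<open>x i\<close> strictly
      before \<open>\<sigma> n\<close>, while \<open>alive_bounds\<close> still keeps it
      above.\<close>
    have "x i \<le> w (\<sigma> n)"
    proof (rule ccontr)
      assume *: "\<not> ?thesis"
      have "continuous_on {\<sigma> i..\<sigma> n} w"
        by (rule continuous_on_subset[OF cont]) (use sigma(1)[of i] i in auto)
      moreover have "w (\<sigma> i) = bary i" using stopped_or_level[of i] i by simp
      ultimately obtain r where r: "\<sigma> i \<le> r" "r \<le> \<sigma> n" "w r = x i"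
        using IVT2'[of w "\<sigma> n" "x i" "\<sigma> i"] * x_less_bary[OF i(1)] i(2) by force
      then have "r \<noteq> \<sigma> n" using * by auto
      then have "x i < w r"
        using alive_bounds(1)[of i r] i r sigma(1)[of i] next_eq by simp
      then show False using r by simp
    qed
    moreover have "x j \<le> x i" using j i by (intro x_mono) auto
    ultimately have "w (\<sigma> n) = x i" using j by simp
    then show ?thesis using st D i by (intro exI[of _ i]) auto
  qed
qed

theorem state_after:
  assumes "\<sigma> n \<le> t"
  obtains i where "i \<le> n" "w (\<sigma> n) = x i" "\<And>j. j \<le> n \<Longrightarrow> state w t j = of_bool (i = j)"
    "\<And>k. k \<le> n \<Longrightarrow> \<not> before_hit (path_gap w k) t"
proof -
  have t: "0 \<le> t" using assms sigma(1)[of n] by simp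
  have "stop_at (path_gap w k) t = stop_at (path_gap w k) (\<sigma> n)" if "k \<le> n" for k
    using sigma(5)[OF that] t sigma(1)[of n] sigma_mono[of k n] that assms by simp
  then have "state w t j = state w (\<sigma> n) j" for j
    unfolding state_def by (intro arg_cong2[where f="(+)"] sum.cong) auto
  moreover have "\<not> before_hit (path_gap w k) t" if "k \<le> n" for k
    using sigma(4)[OF that t] sigma_mono[of k n] that assms by simp
  ultimately show ?thesis using stopped_at_atom that by auto
qed

end

end


section \<open>Finite laws and the kernel K\<close>

text \<open>The index set is a parameter so that the same facts apply to mu (all indices), to mu_t
  in stage \<open>i\<close> (indices \<open>{i..n}\<close>) and to mu_t after stopping (one index);
  strict positivity makes these points exactly the atoms.\<close>

locale finite_law =
  fixes \<nu> :: "real measure" and I :: "nat set" and x v :: "nat \<Rightarrow> real"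
  assumes prob: "prob_space \<nu>" and sets_law: "sets \<nu> = sets borel"
    and fin: "finite I" and inj: "inj_on x I"
    and pos: "\<And>j. j \<in> I \<Longrightarrow> 0 < v j"
    and law: "\<And>E. E \<in> sets borel \<Longrightarrow> measure \<nu> E = (\<Sum>j\<in>I. v j * indicat_real E (x j))"
begin

sublocale prob_space \<nu> by (rule prob)

lemma measure_atom: "i \<in> I \<Longrightarrow> measure \<nu> {x i} = v i"
proof -
  assume i: "i \<in> I"
  have "measure \<nu> {x i} = (\<Sum>j\<in>I. v j * indicat_real {x i} (x j))" by (rule law) simp
  also have "\<dots> = (\<Sum>j\<in>I. if j = i then v j else 0)"
    by (rule sum.cong) (use i inj in \<open>auto simp: inj_on_def indicator_def\<close>)
  finally show ?thesis using i fin by simp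
qed

lemma Supp_eq: "Supp \<nu> = x ` I"
proof -
  have "measure \<nu> {y} = 0" if "y \<notin> x ` I" for y
  proof -
    have "measure \<nu> {y} = (\<Sum>j\<in>I. v j * indicat_real {y} (x j))" by (rule law) simp
    also have "\<dots> = 0" using that by (intro sum.neutral) (auto simp: indicator_def)
    finally show ?thesis .
  qed
  then show ?thesis using measure_atom pos by (auto simp: Supp_def) (metis less_irrefl)
qed

lemma sum_v: "(\<Sum>j\<in>I. v j) = 1"
  using law[of UNIV] prob_space sets_eq_imp_space_eq[OF sets_law] by simp

lemma finitely_supported: "finitely_supported \<nu>"
proof -
  have "measure \<nu> (x ` I) = 1"
    using sum_v fin by (subst law) (auto intro!: sum.cong simp: finite_imp_closed)
  then show ?thesis
    using prob sets_law fin by (simp add: finitely_supported_def Supp_eq)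
qed

lemma AE_atom: "AE y in \<nu>. y \<in> x ` I"
proof -
  have "measure \<nu> (x ` I) = 1" using finitely_supported by (simp add: finitely_supported_def Supp_eq)
  moreover have "x ` I \<in> sets \<nu>" using fin by (simp add: sets_law finite_imp_closed)
  ultimately show ?thesis by (simp add: AE_in_set_eq_1)
qed

lemma integral_eq:
  fixes f :: "real \<Rightarrow> real"
  assumes f: "f \<in> borel_measurable borel"
  shows "(\<integral>y. f y \<partial>\<nu>) = (\<Sum>j\<in>I. v j * f (x j))"
proof -
  have [measurable]: "f \<in> borel_measurable \<nu>" using f by (simp add: measurable_cong_sets[OF sets_law refl])
  have sing: "{y} \<in> sets \<nu>" for y by (simp add: sets_law)
  have "(\<integral>y. f y \<partial>\<nu>) = (\<integral>y. (\<Sum>j\<in>I. f (x j) * indicat_real {x j} y) \<partial>\<nu>)"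
  proof (rule integral_cong_AE)
    show "(\<lambda>y. \<Sum>j\<in>I. f (x j) * indicat_real {x j} y) \<in> borel_measurable \<nu>"
      using sing by measurable
    show "AE y in \<nu>. f y = (\<Sum>j\<in>I. f (x j) * indicat_real {x j} y)"
      using AE_atom
    proof eventually_elim
      case (elim y)
      then obtain i where i: "i \<in> I" "y = x i" by auto
      have "(\<Sum>j\<in>I. f (x j) * indicat_real {x j} y) = (\<Sum>j\<in>I. if j = i then f (x j) else 0)"
        by (rule sum.cong) (use i inj in \<open>auto simp: inj_on_def indicator_def\<close>)
      then show ?case using i fin by simp
    qed
  qed measurable
  also have "\<dots> = (\<Sum>j\<in>I. f (x j) * measure \<nu> {x j})"
    by (subst Bochner_Integration.integral_sum)
       (auto intro!: sum.cong integrable_real_indicator simp: sing emeasure_eq_measure)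
  also have "\<dots> = (\<Sum>j\<in>I. v j * f (x j))"
    by (rule sum.cong) (auto simp: measure_atom)
  finally show ?thesis .
qed

lemma set_integral_eq:
  fixes f :: "real \<Rightarrow> real"
  assumes "f \<in> borel_measurable borel" "E \<in> sets borel"
  shows "(LINT y:E|\<nu>. f y) = (\<Sum>j\<in>I. v j * (indicat_real E (x j) * f (x j)))"
  unfolding set_lebesgue_integral_def using assms by (subst integral_eq) auto

text \<open>Candidates for K are constrained only on the support and by extensionality. Such a
  function takes finitely many values on Borel pieces, so the integral conditions on it can be
  evaluated by \<open>integral_eq\<close>.\<close>

lemma measurable_extensional:
  fixes k :: "real \<Rightarrow> real"
  assumes "k \<in> extensional (x ` I)"
  shows "k \<in> borel_measurable borel"
proof -
  have "k = (\<lambda>y. if y \<in> x ` I then (\<Sum>j\<in>I. k (x j) * indicat_real {x j} y) else undefined)"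
  proof
    fix y
    show "k y = (if y \<in> x ` I then (\<Sum>j\<in>I. k (x j) * indicat_real {x j} y) else undefined)"
    proof (cases "y \<in> x ` I")
      case True
      then obtain i where i: "i \<in> I" "y = x i" by auto
      have "(\<Sum>j\<in>I. k (x j) * indicat_real {x j} y) = (\<Sum>j\<in>I. if j = i then k (x j) else 0)"
        by (rule sum.cong) (use i inj in \<open>auto simp: inj_on_def indicator_def\<close>)
      then show ?thesis using i fin by simp
    next
      case False
      then show ?thesis using assms by (simp add: extensional_def)
    qed
  qed
  moreover have "(\<lambda>y. if y \<in> x ` I then (\<Sum>j\<in>I. k (x j) * indicat_real {x j} y) else undefined) \<in> borel_measurable borel"
    using fin by (intro measurable_If_set borel_measurable_sum) (auto simp: finite_imp_closed)
  ultimately show ?thesis by simp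
qed

text \<open>K has two unknown values, and conditions (ii) and (iii) are two linear equations for
  them. With \<open>P\<close> the mass above the least atom, (ii) gives the value
  \<open>- P * c / v i\<close> there; inserting it into (iii) gives \<open>c * D = 1\<close>. The
  weight \<open>v i\<close> cancels on integration, so the result involves only the masses above
  \<open>x i\<close>.\<close>

lemma K_fun_set_integral:
  assumes i: "i \<in> I" and least: "\<And>j. j \<in> I \<Longrightarrow> j \<noteq> i \<Longrightarrow> x i < x j" and ne: "I \<noteq> {i}"
    and E: "E \<in> sets borel"
  shows "(LINT y:E|\<nu>. K_fun \<nu> y) =
    ((\<Sum>j\<in>I-{i}. v j * indicat_real E (x j)) - (\<Sum>j\<in>I-{i}. v j) * indicat_real E (x i))
      / (\<Sum>j\<in>I-{i}. v j * (x j - x i))"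
proof -
  define R where "R = I - {i}"
  define P where "P = (\<Sum>j\<in>R. v j)"
  define D where "D = (\<Sum>j\<in>R. v j * (x j - x i))"
  define c where "c = 1 / D"
  have R: "R \<noteq> {}" "finite R" "i \<notin> R" using i ne fin by (auto simp: R_def)
  have I_eq: "I = insert i R" using i by (auto simp: R_def)
  have D: "D > 0" unfolding D_def by (rule sum_pos) (use R pos least in \<open>auto simp: R_def\<close>)
  have vi: "v i > 0" using pos i by simp
  have Min: "Min (Supp \<nu>) = x i"
  proof -
    have "x i \<le> x j" if "j \<in> I" for j using least[OF that] by (cases "j = i") auto
    then show ?thesis unfolding Supp_eq using i fin by (intro Min_eqI) auto
  qed
  have rest: "Supp \<nu> - {Min (Supp \<nu>)} = x ` R"
    unfolding Min using inj i by (auto simp: Supp_eq R_def inj_on_def)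
  have card: "card (Supp \<nu>) \<ge> 2"
  proof -
    have "card R \<ge> 1" using R by (simp add: Suc_leI card_gt_0_iff)
    then show ?thesis using R inj by (simp add: Supp_eq card_image) (simp add: I_eq)
  qed
  have sumI: "(\<Sum>j\<in>I. g j) = g i + (\<Sum>j\<in>R. g j)" for g :: "nat \<Rightarrow> real"
    unfolding R_def by (rule sum.remove[OF fin i])
  \<comment> \<open>The solution of the two equations, with \<open>undefined\<close> off the support
    as extensionality demands.\<close>
  define k0 where "k0 = (\<lambda>y. if y \<in> x ` R then c else if y = x i then - P * c / v i else undefined)"
  have xiR: "x i \<notin> x ` R" using least by (force simp: R_def)
  have k0: "k0 (x i) = - P * c / v i" "\<And>j. j \<in> R \<Longrightarrow> k0 (x j) = c" using xiR by (auto simp: k0_def)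
  define Q where "Q k \<longleftrightarrow> k \<in> extensional (Supp \<nu>)
              \<and> (\<exists>c. \<forall>x \<in> Supp \<nu> - {Min (Supp \<nu>)}. k x = c)
              \<and> (\<integral>x. k x \<partial>\<nu>) = 0 \<and> (\<integral>x. x * k x \<partial>\<nu>) = 1" for k
  have DPQ: "(\<Sum>j\<in>R. v j * x j) = D + P * x i"
    by (simp add: D_def P_def sum_distrib_right right_diff_distrib sum_subtractf)
  have DPQ': "(\<Sum>j\<in>R. v j * (x j * a)) = (D + P * x i) * a" for a
    unfolding DPQ[symmetric] sum_distrib_right by (simp add: mult.assoc)
  have Q0: "Q k0"
  proof -
    have ext: "k0 \<in> extensional (x ` I)" using I_eq by (auto simp: k0_def extensional_def)
    have m: "k0 \<in> borel_measurable borel" by (rule measurable_extensional[OF ext])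
    have "(\<integral>y. k0 y \<partial>\<nu>) = v i * (- P * c / v i) + (\<Sum>j\<in>R. v j * c)"
      by (simp add: integral_eq[OF m] sumI k0)
    moreover have "(\<Sum>j\<in>R. v j * c) = P * c" by (simp add: P_def sum_distrib_right)
    ultimately have 1: "(\<integral>y. k0 y \<partial>\<nu>) = 0" using vi by simp
    have int: "(\<integral>y. y * k0 y \<partial>\<nu>) = v i * (x i * (- P * c / v i)) + (\<Sum>j\<in>R. v j * (x j * c))"
      using m by (subst integral_eq) (auto simp: sumI k0)
    have 2: "(\<integral>y. y * k0 y \<partial>\<nu>) = 1"
    proof -
      have "v i * (x i * (- P * c / v i)) + (D + P * x i) * c = D * c" using vi by (simp add: field_simps)
      then show ?thesis using int DPQ'[of c] D by (simp add: c_def)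
    qed
    show ?thesis unfolding Q_def rest using 1 2 ext k0 by (auto simp: Supp_eq)
  qed
  have uniq: "k = k0" if "Q k" for k
  proof -
    from that obtain c' where ext: "k \<in> extensional (x ` I)" and c': "\<And>j. j \<in> R \<Longrightarrow> k (x j) = c'"
      and int: "(\<integral>x. k x \<partial>\<nu>) = 0" "(\<integral>x. x * k x \<partial>\<nu>) = 1"
      unfolding Q_def rest by (auto simp: Supp_eq)
    have m: "k \<in> borel_measurable borel" by (rule measurable_extensional[OF ext])
    have "v i * k (x i) + (\<Sum>j\<in>R. v j * c') = 0"
      using int(1) by (simp add: integral_eq[OF m] sumI c')
    then have 1: "v i * k (x i) = - P * c'" by (simp add: P_def sum_distrib_right)
    have "v i * (x i * k (x i)) + (\<Sum>j\<in>R. v j * (x j * c')) = 1"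
      using int(2) m by (subst (asm) integral_eq) (auto simp: sumI c')
    moreover note DPQ'[of c']
    moreover have "v i * (x i * k (x i)) = x i * (v i * k (x i))" by simp
    ultimately have "x i * (- P * c') + (D + P * x i) * c' = 1" unfolding 1 by simp
    then have "c' = c" using D by (simp add: c_def field_simps)
    then have "v i * k (x i) = v i * k0 (x i)" using 1 vi k0(1) by simp
    then have "k (x i) = k0 (x i)" using vi by simp
    moreover have "k y = k0 y" if "y \<notin> x ` I" for y
      using that ext i by (auto simp: k0_def extensional_def R_def)
    ultimately show ?thesis using c' k0(2) \<open>c' = c\<close> I_eq by (intro HOL.ext) (metis imageE insertE)
  qed
  have "K_fun \<nu> = (THE k. Q k)"
    using finitely_supported card by (simp add: K_fun_def Q_def)
  also have "\<dots> = k0" by (rule the_equality[of Q, OF Q0 uniq])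
  finally have K: "K_fun \<nu> = k0" .
  have m: "k0 \<in> borel_measurable borel"
    by (rule measurable_extensional) (use Q0 in \<open>simp add: Q_def Supp_eq\<close>)
  have "(LINT y:E|\<nu>. K_fun \<nu> y) = v i * (indicat_real E (x i) * (- P * c / v i)) + (\<Sum>j\<in>R. v j * (indicat_real E (x j) * c))"
    unfolding K by (simp add: set_integral_eq[OF m E] sumI k0)
  also have "(\<Sum>j\<in>R. v j * (indicat_real E (x j) * c)) = (\<Sum>j\<in>R. v j * indicat_real E (x j)) * c"
    by (simp add: sum_distrib_right mult.assoc)
  also have "v i * (indicat_real E (x i) * (- P * c / v i)) = - P * indicat_real E (x i) * c" using vi by simp
  finally show ?thesis
    unfolding R_def[symmetric] P_def[symmetric] D_def[symmetric] by (simp add: c_def diff_divide_distrib)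
qed

lemma K_fun_dirac: "I = {i} \<Longrightarrow> K_fun \<nu> = (\<lambda>y. 0)"
  by (simp add: K_fun_def Supp_eq)

end

section \<open>From masses at points to finite laws\<close>

text \<open>Points of total mass 1 leave nothing elsewhere. An arbitrary version of the conditional
  law can therefore be recovered from its masses at the atoms of mu.\<close>

lemma finite_law_from_atoms:
  fixes \<nu> :: "real measure"
  assumes "prob_space \<nu>" "sets \<nu> = sets borel" "finite I" "inj_on x I"
    and total: "(\<Sum>j\<in>I. measure \<nu> {x j}) = 1" and E: "E \<in> sets borel"
  shows "measure \<nu> E = (\<Sum>j\<in>I. measure \<nu> {x j} * indicat_real E (x j))"
proof -
  interpret prob_space \<nu> by fact
  define S where "S = x ` I"
  have "finite S" using assms(3) by (simp add: S_def)
  then have "S \<in> sets borel" by (intro borel_closed finite_imp_closed)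
  then have S: "finite S" "S \<in> sets \<nu>" using \<open>finite S\<close> unfolding assms(2) by auto
  have sing: "{y} \<in> sets \<nu>" for y by (simp add: assms(2))
  have union: "measure \<nu> A = (\<Sum>y\<in>A. measure \<nu> {y})" if "finite A" for A
  proof -
    have "measure \<nu> (\<Union>y\<in>A. {y}) = (\<Sum>y\<in>A. measure \<nu> {y})"
      using that sing by (intro finite_measure_finite_Union) (auto simp: disjoint_family_on_def)
    then show ?thesis by simp
  qed
  have "measure \<nu> S = 1"
    using total union[OF S(1)] by (simp add: S_def sum.reindex[OF assms(4)])
  then have AE: "AE y in \<nu>. y \<in> S" using S by (simp add: AE_in_set_eq_1)
  have "measure \<nu> E = measure \<nu> (S \<inter> E)"
    by (rule measure_eq_AE) (use AE E S assms(2) in auto)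
  also have "\<dots> = (\<Sum>y\<in>S \<inter> E. measure \<nu> {y})" using S by (intro union) auto
  also have "\<dots> = (\<Sum>y\<in>S. measure \<nu> {y} * indicat_real E y)"
    using S(1) by (intro sum.mono_neutral_cong_left) (auto simp: indicator_def)
  also have "\<dots> = (\<Sum>j\<in>I. measure \<nu> {x j} * indicat_real E (x j))"
    unfolding S_def by (simp add: sum.reindex[OF assms(4)])
  finally show ?thesis .
qed

lemma finitely_supported_atom_seq:
  assumes fs: "finitely_supported \<mu>" and mean: "(\<integral>x. x \<partial>\<mu>) = 0"
  obtains n x v where "atom_seq n x v" "finite_law \<mu> {..n} x v"
proof -
  interpret prob_space \<mu> using fs by (simp add: finitely_supported_def)
  define S where "S = Supp \<mu>"
  have S: "finite S" "measure \<mu> S = 1" "sets \<mu> = sets borel"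
    using fs by (auto simp: finitely_supported_def S_def)
  have "S \<noteq> {}" using S(2) by auto
  \<comment> \<open>Indices run from 0 to \<open>n\<close>, so \<open>n\<close> is one less than the
    number of atoms; the support is nonempty because it has measure 1.\<close>
  define n where "n = card S - 1"
  have card: "card S = Suc n" using S \<open>S \<noteq> {}\<close> by (simp add: n_def card_gt_0_iff)
  define x where "x i = sorted_list_of_set S ! i" for i
  define v where "v i = measure \<mu> {x i}" for i
  have x_less: "x i < x j" if "i < j" "j \<le> n" for i j
    unfolding x_def using that card S(1) strict_sorted_list_of_set[of S]
    by (intro sorted_wrt_nth_less[where P="(<)"]) auto
  have img: "x ` {..n} = S"
  proof -
    have "x ` {..<length (sorted_list_of_set S)} = set (sorted_list_of_set S)"
      by (auto simp: x_def set_conv_nth)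
    then show ?thesis using card S(1) by (simp add: lessThan_Suc_atMost)
  qed
  have inj: "inj_on x {..n}"
    by (rule inj_onI) (metis atMost_iff less_irrefl linorder_neqE_nat x_less)
  have v_pos: "0 < v i" if "i \<le> n" for i
    using that img by (auto simp: v_def S_def Supp_def)
  have "(\<Sum>j\<le>n. measure \<mu> {x j}) = (\<Sum>y\<in>S. measure \<mu> {y})"
    unfolding img[symmetric] by (simp add: sum.reindex[OF inj])
  also have "\<dots> = measure \<mu> S"
    using S by (intro finite_measure_eq_sum_singleton[symmetric]) auto
  finally have total: "(\<Sum>j\<le>n. measure \<mu> {x j}) = 1" using S by simp
  interpret finite_law \<mu> "{..n}" x v
  proof
    fix E :: "real set" assume "E \<in> sets borel"
    then show "measure \<mu> E = (\<Sum>j\<le>n. v j * indicat_real E (x j))"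
      unfolding v_def by (intro finite_law_from_atoms prob_space_axioms S inj total) auto
  qed (use S inj v_pos in auto)
  have "atom_seq n x v"
  proof
    show "(\<Sum>i\<le>n. v i) = 1" using sum_v by simp
    show "(\<Sum>i\<le>n. v i * x i) = 0" using integral_eq[of "\<lambda>y. y"] mean by simp
  qed (use x_less v_pos in auto)
  moreover have "finite_law \<mu> {..n} x v" by unfold_locales
  ultimately show ?thesis using that by blast
qed

section \<open>The stopping condition in terms of the gap function\<close>

context atom_seq
begin

lemma barycentre_eq:
  assumes "finite_law \<mu> {..n} x m" "i \<le> n" "\<And>j. j \<le> n \<Longrightarrow> y \<le> x j \<longleftrightarrow> i \<le> j"
  shows "barycentre \<mu> y = bary i"
proof -
  interpret finite_law \<mu> "{..n}" x m by fact
  have "measure \<mu> {y..} = (\<Sum>j\<le>n. m j * indicat_real {y..} (x j))" by (rule law) simp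
  also have "\<dots> = tail i" unfolding tail_def
    by (rule sum.mono_neutral_cong_right) (use assms(3) in \<open>auto simp: indicator_def\<close>)
  finally have 1: "measure \<mu> {y..} = tail i" .
  have "(LINT y:{y..}|\<mu>. y) = (\<Sum>j\<le>n. m j * (indicat_real {y..} (x j) * x j))"
    by (rule set_integral_eq) auto
  also have "\<dots> = (\<Sum>j=i..n. m j * x j)"
    by (rule sum.mono_neutral_cong_right) (use assms(3) in \<open>auto simp: indicator_def\<close>)
  finally show ?thesis using 1 tail_pos[OF assms(2)] by (simp add: barycentre_def bary_def)
qed

lemma barycentre_above:
  assumes "finite_law \<mu> {..n} x m" "x n < y"
  shows "barycentre \<mu> y = y"
proof -
  interpret finite_law \<mu> "{..n}" x m by fact
  have "measure \<mu> {y..} = (\<Sum>j\<le>n. m j * indicat_real {y..} (x j))" by (rule law) simp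
  also have "\<dots> = 0"
  proof (rule sum.neutral, rule ballI)
    fix j assume "j \<in> {..n}"
    then have "x j < y" using x_mono[of j n] assms(2) by simp
    then show "m j * indicat_real {y..} (x j) = 0" by (simp add: indicator_def)
  qed
  finally show ?thesis by (simp add: barycentre_def)
qed

text \<open>Up to \<open>x n\<close> the barycentre at \<open>y\<close> is \<open>bary i\<close> for
  the lowest atom \<open>x i\<close> not below \<open>y\<close>; as \<open>bary\<close> increases,
  the existential in \<open>gap_nonneg_iff\<close> is decided by that \<open>i\<close>. Above
  \<open>x n\<close> both conditions hold because \<open>y \<le> s\<close>, which is the relation
  between W and its maximum.\<close>

lemma barycentre_le_iff_gap:
  assumes "finite_law \<mu> {..n} x m" "y \<le> s"
  shows "barycentre \<mu> y \<le> s \<longleftrightarrow> 0 \<le> gap n s y"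
proof (cases "y \<le> x n")
  case True
  define i where "i = (LEAST j. y \<le> x j)"
  have i: "y \<le> x i" "i \<le> n" using True unfolding i_def by (auto intro: LeastI Least_le)
  have iff: "y \<le> x j \<longleftrightarrow> i \<le> j" if "j \<le> n" for j
    using i x_mono[of i j] that Least_le[of "\<lambda>j. y \<le> x j" j] by (auto simp: i_def)
  have "barycentre \<mu> y = bary i" by (rule barycentre_eq[OF assms(1) i(2) iff])
  moreover have "0 \<le> gap n s y \<longleftrightarrow> bary i \<le> s"
  proof
    assume "0 \<le> gap n s y"
    then consider "bary n \<le> s" | j where "j < n" "bary j \<le> s" "y \<le> x j"
      by (auto simp: gap_nonneg_iff)
    then show "bary i \<le> s"
    proof cases
      case 1
      then show ?thesis using bary_mono[of i n] i by simp
    next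
      case 2
      then show ?thesis using bary_mono[of i j] iff[of j] by simp
    qed
  next
    assume "bary i \<le> s"
    then show "0 \<le> gap n s y" using i by (cases "i = n") (auto simp: gap_nonneg_iff)
  qed
  ultimately show ?thesis by simp
next
  case False
  then show ?thesis using barycentre_above[OF assms(1), of y] assms(2)
    by (simp add: gap_nonneg_iff bary_last)
qed

end


section \<open>Discrete stochastic integrals\<close>

definition clip :: "real \<Rightarrow> real \<Rightarrow> real" where
  "clip R z = max (- R) (min R z)"

lemma clip_error: "0 < R \<Longrightarrow> \<bar>z - clip R z\<bar> \<le> z\<^sup>2 / R"
proof (cases "\<bar>z\<bar> \<le> R")
  case True
  then have "clip R z = z" by (auto simp: clip_def)
  moreover assume "0 < R"
  ultimately show ?thesis by simp
next
  case False
  assume R: "0 < R"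
  have "\<bar>z\<bar> * R \<le> \<bar>z\<bar> * \<bar>z\<bar>" using False R by (intro mult_left_mono) auto
  then have "\<bar>z\<bar> \<le> z\<^sup>2 / R" using R by (simp add: field_simps power2_eq_square)
  moreover have "\<bar>z - clip R z\<bar> \<le> \<bar>z\<bar>" using R by (auto simp: clip_def)
  ultimately show ?thesis by simp
qed

context prob_space
begin

text \<open>The \<open>L\<^sup>2\<close> bound makes the \<open>X k\<close> uniformly integrable: truncating at \<open>R\<close> changes their means by
  at most \<open>C / R\<close>.\<close>

lemma expectation_limit_zero:
  fixes X :: "nat \<Rightarrow> 'a \<Rightarrow> real"
  assumes X[measurable]: "\<And>k. X k \<in> borel_measurable M" and Y[measurable]: "Y \<in> borel_measurable M"
    and lim: "AE \<omega> in M. (\<lambda>k. X k \<omega>) \<longlonglongrightarrow> Y \<omega>"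
    and sq: "\<And>k. integrable M (\<lambda>\<omega>. (X k \<omega>)\<^sup>2)" "\<And>k. expectation (\<lambda>\<omega>. (X k \<omega>)\<^sup>2) \<le> C"
    and zero: "\<And>k. expectation (X k) = 0"
    and bound: "AE \<omega> in M. \<bar>Y \<omega>\<bar> \<le> B"
  shows "expectation Y = 0"
proof -
  have int: "integrable M (X k)" for k by (rule square_integrable_imp_integrable[OF X sq(1)])
  \<comment> \<open>A truncation level of at least \<open>B\<close> leaves the limit unchanged, and
    mean zero turns the expectation of the truncated variable into the truncation error.\<close>
  have main: "\<bar>expectation Y\<bar> \<le> C / R" if R: "0 < R" "B \<le> R" for R
  proof -
    have mc[measurable]: "clip R \<in> borel_measurable borel" unfolding clip_def[abs_def] by measurable
    have ic: "integrable M (\<lambda>\<omega>. clip R (X k \<omega>))" for k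
      by (rule integrable_const_bound[where B=R]) (use R in \<open>auto simp: clip_def\<close>)
    have "(\<lambda>k. expectation (\<lambda>\<omega>. clip R (X k \<omega>))) \<longlonglongrightarrow> expectation (\<lambda>\<omega>. clip R (Y \<omega>))"
    proof (rule integral_dominated_convergence[where w="\<lambda>_. R"])
      show "AE \<omega> in M. (\<lambda>k. clip R (X k \<omega>)) \<longlonglongrightarrow> clip R (Y \<omega>)"
        using lim by eventually_elim (auto simp: clip_def intro!: tendsto_intros)
      show "AE \<omega> in M. norm (clip R (X k \<omega>)) \<le> R" for k
        using R by (auto simp: clip_def)
    qed auto
    moreover have "expectation (\<lambda>\<omega>. clip R (Y \<omega>)) = expectation Y"
    proof (rule integral_cong_AE)
      show "AE \<omega> in M. clip R (Y \<omega>) = Y \<omega>"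
        using bound by eventually_elim (use R in \<open>auto simp: clip_def\<close>)
    qed auto
    moreover have "\<bar>expectation (\<lambda>\<omega>. clip R (X k \<omega>))\<bar> \<le> C / R" for k
    proof -
      have "\<bar>expectation (\<lambda>\<omega>. clip R (X k \<omega>))\<bar> = \<bar>expectation (\<lambda>\<omega>. X k \<omega> - clip R (X k \<omega>))\<bar>"
        using int[of k] ic[of k] zero[of k] by simp
      also have "\<dots> \<le> expectation (\<lambda>\<omega>. \<bar>X k \<omega> - clip R (X k \<omega>)\<bar>)" by (rule integral_abs_bound)
      also have "\<dots> \<le> expectation (\<lambda>\<omega>. (X k \<omega>)\<^sup>2 / R)"
        by (intro integral_mono integrable_abs Bochner_Integration.integrable_diff int ic
            integrable_divide_zero clip_error sq R)
      also have "\<dots> \<le> C / R" using sq(2)[of k] R by (simp add: divide_right_mono)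
      finally show ?thesis .
    qed
    ultimately show ?thesis
      by (metis (no_types, lifting) LIMSEQ_le_const2 tendsto_rabs)
  qed
  have "(\<lambda>k. C / real k) \<longlonglongrightarrow> 0" by (rule lim_const_over_n)
  moreover have "\<forall>\<^sub>F k in sequentially. \<bar>expectation Y\<bar> \<le> C / real k"
    using eventually_ge_at_top[of "nat \<lceil>max B 1\<rceil>"]
    by eventually_elim (intro main, linarith+)
  ultimately have "\<bar>expectation Y\<bar> \<le> 0"
    by (rule tendsto_lowerbound) simp
  then show ?thesis by simp
qed

end

section \<open>Independent increments and sums of martingale differences\<close>

locale wiener =
  fixes M :: "'a measure" and W :: "real \<Rightarrow> 'a \<Rightarrow> real" and F :: "real \<Rightarrow> 'a measure"
  assumes wiener: "wiener_process M W" and F_def: "F = natural_filtration M W"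
begin

sublocale prob_space M using wiener by (simp add: wiener_process_def)

lemma W_meas[measurable]: "0 \<le> t \<Longrightarrow> W t \<in> borel_measurable M"
  and W_start: "AE \<omega> in M. W 0 \<omega> = 0"
  and W_cont: "\<omega> \<in> space M \<Longrightarrow> continuous_on {0..} (\<lambda>t. W t \<omega>)"
  and W_incr: "0 \<le> s \<Longrightarrow> s < t \<Longrightarrow> distributed M lborel (\<lambda>\<omega>. W t \<omega> - W s \<omega>) (normal_density 0 (sqrt (t - s)))"
  and W_indep: "0 \<le> s \<Longrightarrow> s < t \<Longrightarrow> indep_set (sets (F s)) {(\<lambda>\<omega>. W t \<omega> - W s \<omega>) -` A \<inter> space M | A. A \<in> sets borel}"
  using wiener by (auto simp: wiener_process_def F_def)

lemma space_F[simp]: "space (F t) = space M"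
  unfolding F_def natural_filtration_def by (rule space_measure_of) auto

lemma sets_F: "sets (F t) = sigma_sets (space M) (\<Union>s\<in>{0..t}. {W s -` A \<inter> space M | A. A \<in> sets borel})"
  unfolding F_def natural_filtration_def by (rule sets_measure_of) auto

lemma F_mono: "s \<le> t \<Longrightarrow> sets (F s) \<subseteq> sets (F t)"
  unfolding sets_F by (intro sigma_sets_mono' UN_mono) auto

lemma F_sub: "sets (F t) \<subseteq> sets M"
  unfolding sets_F by (rule sets.sigma_sets_subset) (auto intro!: measurable_sets[OF W_meas])

lemma W_adapted: "0 \<le> s \<Longrightarrow> s \<le> t \<Longrightarrow> W s \<in> borel_measurable (F t)"
proof (rule measurableI)
  fix A :: "real set" assume "0 \<le> s" "s \<le> t" "A \<in> sets borel"
  then show "W s -` A \<inter> space (F t) \<in> sets (F t)"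
    unfolding sets_F space_F by (intro sigma_sets.Basic UN_I[of s]) auto
qed auto

lemma subalg: "subalgebra M (F t)" and subalg_mono: "s \<le> t \<Longrightarrow> subalgebra (F t) (F s)"
  using F_sub F_mono by (auto simp: subalgebra_def)

lemma F_meas_M: "f \<in> borel_measurable (F t) \<Longrightarrow> f \<in> borel_measurable M"
  by (rule measurable_from_subalg[OF subalg])

lemma F_meas_mono: "f \<in> borel_measurable (F s) \<Longrightarrow> s \<le> t \<Longrightarrow> f \<in> borel_measurable (F t)"
  by (rule measurable_from_subalg[OF subalg_mono])

lemma sigma_finite_F: "sigma_finite_subalgebra M (F t)"
  by (rule finite_measure_subalgebra_is_sigma_finite) (unfold_locales, rule subalg)

text \<open>Independence is given for two families of events. Both are stable under intersection, so
  it extends to the generated sigma-algebras and hence to random variables.\<close>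

lemma indep_increment:
  assumes "0 \<le> s" "s < t" "X \<in> borel_measurable (F s)"
  shows "indep_var borel X borel (\<lambda>\<omega>. W t \<omega> - W s \<omega>)"
proof -
  let ?D = "{(\<lambda>\<omega>. W t \<omega> - W s \<omega>) -` A \<inter> space M | A. A \<in> sets borel}"
  have "Int_stable ?D"
  proof (rule Int_stableI)
    fix a b assume "a \<in> ?D" "b \<in> ?D"
    then obtain A B where "A \<in> sets borel" "B \<in> sets borel"
      "a = (\<lambda>\<omega>. W t \<omega> - W s \<omega>) -` A \<inter> space M" "b = (\<lambda>\<omega>. W t \<omega> - W s \<omega>) -` B \<inter> space M" by auto
    then show "a \<inter> b \<in> ?D" by (auto intro!: exI[of _ "A \<inter> B"])
  qed
  moreover have "Int_stable (sets (F s))" by (auto simp: Int_stable_def)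
  ultimately have "indep_set (sigma_sets (space M) (sets (F s))) (sigma_sets (space M) ?D)"
    by (intro indep_set_sigma_sets W_indep assms)
  moreover have "sigma_sets (space M) {X -` A \<inter> space M | A. A \<in> sets borel} \<subseteq> sigma_sets (space M) (sets (F s))"
    using measurable_sets[OF assms(3)] by (intro sigma_sets_mono') auto
  ultimately have "indep_set (sigma_sets (space M) {X -` A \<inter> space M | A. A \<in> sets borel}) (sigma_sets (space M) ?D)"
    unfolding indep_sets2_eq by blast
  then show ?thesis
    using assms F_meas_M[OF assms(3)] by (simp add: indep_var_eq)
qed

lemma increment_moments:
  assumes "0 \<le> s" "s < t"
  shows "integrable M (\<lambda>\<omega>. W t \<omega> - W s \<omega>)" "expectation (\<lambda>\<omega>. W t \<omega> - W s \<omega>) = 0"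
    and "integrable M (\<lambda>\<omega>. (W t \<omega> - W s \<omega>)\<^sup>2)" "expectation (\<lambda>\<omega>. (W t \<omega> - W s \<omega>)\<^sup>2) = t - s"
proof -
  let ?D = "\<lambda>\<omega>. W t \<omega> - W s \<omega>"
  note D = W_incr[OF assms]
  have s: "0 < sqrt (t - s)" using assms by simp
  show "integrable M ?D"
    using distributed_integrable[OF D, of "\<lambda>x. x"] integrable_normal_moment_nz_1[OF s, of 0] by simp
  show 0: "expectation ?D = 0" by (rule normal_distributed_expectation[OF s D])
  show "integrable M (\<lambda>\<omega>. (?D \<omega>)\<^sup>2)"
    using distributed_integrable[OF D, of "\<lambda>x. x^2"] integrable_normal_moment[OF s, of 0 2] by simp
  show "expectation (\<lambda>\<omega>. (?D \<omega>)\<^sup>2) = t - s"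
    using normal_distributed_variance[OF s D] assms by (simp add: 0)
qed

text \<open>Products of independent integrable variables factor, and the increment has mean 0 and
  variance \<open>t - s\<close>. The case \<open>s = t\<close>, where the increment vanishes and has
  no density, is separate.\<close>

lemma expectation_mult_increment:
  assumes "0 \<le> s" "s \<le> t" "X \<in> borel_measurable (F s)" "integrable M X"
  shows "integrable M (\<lambda>\<omega>. X \<omega> * (W t \<omega> - W s \<omega>))"
    and "expectation (\<lambda>\<omega>. X \<omega> * (W t \<omega> - W s \<omega>)) = 0"
    and "integrable M (\<lambda>\<omega>. X \<omega> * (W t \<omega> - W s \<omega>)\<^sup>2)"
    and "expectation (\<lambda>\<omega>. X \<omega> * (W t \<omega> - W s \<omega>)\<^sup>2) = expectation X * (t - s)"
proof -
  have *: "integrable M (\<lambda>\<omega>. X \<omega> * (W t \<omega> - W s \<omega>)) \<and> expectation (\<lambda>\<omega>. X \<omega> * (W t \<omega> - W s \<omega>)) = 0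
    \<and> integrable M (\<lambda>\<omega>. X \<omega> * (W t \<omega> - W s \<omega>)\<^sup>2)
    \<and> expectation (\<lambda>\<omega>. X \<omega> * (W t \<omega> - W s \<omega>)\<^sup>2) = expectation X * (t - s)"
  proof (cases "s = t")
    case False
    then have st: "s < t" using assms by simp
    note D = increment_moments[OF assms(1) st]
    have i1: "indep_var borel X borel (\<lambda>\<omega>. W t \<omega> - W s \<omega>)"
      by (rule indep_increment[OF assms(1) st assms(3)])
    have i2: "indep_var borel X borel (\<lambda>\<omega>. (W t \<omega> - W s \<omega>)\<^sup>2)"
      using indep_var_compose[OF i1, of "\<lambda>x. x" borel "\<lambda>x. x\<^sup>2" borel] by (simp add: comp_def)
    show ?thesis
      using indep_var_lebesgue_integral[OF i1 assms(4) D(1)] indep_var_integrable[OF i1 assms(4) D(1)]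
        indep_var_lebesgue_integral[OF i2 assms(4) D(3)] indep_var_integrable[OF i2 assms(4) D(3)] D
      by simp
  qed simp
  then show "integrable M (\<lambda>\<omega>. X \<omega> * (W t \<omega> - W s \<omega>))"
    "expectation (\<lambda>\<omega>. X \<omega> * (W t \<omega> - W s \<omega>)) = 0"
    "integrable M (\<lambda>\<omega>. X \<omega> * (W t \<omega> - W s \<omega>)\<^sup>2)"
    "expectation (\<lambda>\<omega>. X \<omega> * (W t \<omega> - W s \<omega>)\<^sup>2) = expectation X * (t - s)" by auto
qed

text \<open>The discrete Ito isometry, as an upper bound. In the square of \<open>Z (Suc N)\<close>
  the cross term is an \<open>F (p N)\<close>-measurable factor times a later increment, so its mean
  vanishes.\<close>

lemma discrete_integral_moments:
  fixes p :: "nat \<Rightarrow> real"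
  assumes p: "0 \<le> p 0" "\<And>j. p j \<le> p (Suc j)"
    and \<xi>: "\<And>j. \<xi> j \<in> borel_measurable (F (p j))" "\<And>j \<omega>. \<omega> \<in> space M \<Longrightarrow> \<bar>\<xi> j \<omega>\<bar> \<le> C"
  defines "Z \<equiv> \<lambda>N \<omega>. \<Sum>j<N. \<xi> j \<omega> * (W (p (Suc j)) \<omega> - W (p j) \<omega>)"
  shows "Z N \<in> borel_measurable (F (p N))" "integrable M (\<lambda>\<omega>. (Z N \<omega>)\<^sup>2)"
    and "expectation (Z N) = 0" "expectation (\<lambda>\<omega>. (Z N \<omega>)\<^sup>2) \<le> C\<^sup>2 * (p N - p 0)"
proof -
  have pos: "0 \<le> p j" for j by (induction j) (use p order_trans in \<open>blast+\<close>)
  have "Z N \<in> borel_measurable (F (p N)) \<and> integrable M (\<lambda>\<omega>. (Z N \<omega>)\<^sup>2)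
    \<and> expectation (Z N) = 0 \<and> expectation (\<lambda>\<omega>. (Z N \<omega>)\<^sup>2) \<le> C\<^sup>2 * (p N - p 0)"
  proof (induction N)
    case 0
    then show ?case by (simp add: Z_def)
  next
    case (Suc N)
    let ?D = "\<lambda>\<omega>. W (p (Suc N)) \<omega> - W (p N) \<omega>"
    have Z: "Z N \<in> borel_measurable (F (p N))" and Z2: "integrable M (\<lambda>\<omega>. (Z N \<omega>)\<^sup>2)"
      and Z0: "expectation (Z N) = 0" and ZC: "expectation (\<lambda>\<omega>. (Z N \<omega>)\<^sup>2) \<le> C\<^sup>2 * (p N - p 0)"
      using Suc by auto
    have ZM: "Z N \<in> borel_measurable M" and \<xi>M: "\<xi> N \<in> borel_measurable M"
      using F_meas_M Z \<xi>(1) by blast+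
    have iZ: "integrable M (Z N)" by (rule square_integrable_imp_integrable[OF ZM Z2])
    have i\<xi>: "integrable M (\<xi> N)"
      by (rule integrable_const_bound[where B=C]) (use \<xi>(2) \<xi>M in auto)
    have \<xi>2: "(\<xi> N \<omega>)\<^sup>2 \<le> C\<^sup>2" if "\<omega> \<in> space M" for \<omega>
      using power_mono[OF \<xi>(2)[OF that, of N], of 2] by simp
    have i\<xi>2: "integrable M (\<lambda>\<omega>. (\<xi> N \<omega>)\<^sup>2)"
      by (rule integrable_const_bound[where B="C\<^sup>2"]) (use \<xi>2 \<xi>M in auto)
    have iZ\<xi>: "integrable M (\<lambda>\<omega>. 2 * Z N \<omega> * \<xi> N \<omega>)"
    proof (rule Bochner_Integration.integrable_bound[where f="\<lambda>\<omega>. 2 * C * Z N \<omega>"])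
      show "AE \<omega> in M. norm (2 * Z N \<omega> * \<xi> N \<omega>) \<le> norm (2 * C * Z N \<omega>)"
      proof (rule AE_I2)
        fix \<omega> assume "\<omega> \<in> space M"
        then have "\<bar>\<xi> N \<omega>\<bar> \<le> \<bar>C\<bar>" using \<xi>(2)[of \<omega> N] by simp
        then have "\<bar>\<xi> N \<omega>\<bar> * \<bar>Z N \<omega>\<bar> \<le> \<bar>C\<bar> * \<bar>Z N \<omega>\<bar>" by (rule mult_right_mono) simp
        then show "norm (2 * Z N \<omega> * \<xi> N \<omega>) \<le> norm (2 * C * Z N \<omega>)"
          by (simp add: abs_mult mult.commute)
      qed
    qed (use iZ ZM \<xi>M in auto)
    note m1 = expectation_mult_increment[OF pos p(2) \<xi>(1) i\<xi>]
    have "(\<lambda>\<omega>. 2 * Z N \<omega> * \<xi> N \<omega>) \<in> borel_measurable (F (p N))" using Z \<xi>(1)[of N] by simp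
    note m2 = expectation_mult_increment[OF pos p(2) this iZ\<xi>]
    have "(\<lambda>\<omega>. (\<xi> N \<omega>)\<^sup>2) \<in> borel_measurable (F (p N))" using \<xi>(1)[of N] by simp
    note m3 = expectation_mult_increment[OF pos p(2) this i\<xi>2]
    have Zs: "Z (Suc N) = (\<lambda>\<omega>. Z N \<omega> + \<xi> N \<omega> * ?D \<omega>)" by (auto simp: Z_def)
    have Zs2: "(\<lambda>\<omega>. (Z (Suc N) \<omega>)\<^sup>2) =
      (\<lambda>\<omega>. (Z N \<omega>)\<^sup>2 + 2 * Z N \<omega> * \<xi> N \<omega> * ?D \<omega> + (\<xi> N \<omega>)\<^sup>2 * (?D \<omega>)\<^sup>2)"
      unfolding Zs by (auto simp: power2_eq_square algebra_simps)
    have "Z (Suc N) \<in> borel_measurable (F (p (Suc N)))"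
      unfolding Zs using F_meas_mono[OF Z p(2)] F_meas_mono[OF \<xi>(1)[of N] p(2)]
        W_adapted[OF pos[of N] p(2)[of N]] W_adapted[OF pos[of "Suc N"] order_refl] by simp
    moreover have "integrable M (\<lambda>\<omega>. (Z (Suc N) \<omega>)\<^sup>2)"
      unfolding Zs2 using Z2 m2(1) m3(3) by simp
    moreover have "expectation (Z (Suc N)) = 0"
      unfolding Zs using iZ m1 Z0 by simp
    moreover have "expectation (\<lambda>\<omega>. (Z (Suc N) \<omega>)\<^sup>2) =
        expectation (\<lambda>\<omega>. (Z N \<omega>)\<^sup>2) + expectation (\<lambda>\<omega>. (\<xi> N \<omega>)\<^sup>2) * (p (Suc N) - p N)"
      unfolding Zs2 using Z2 m2 m3 by simp
    moreover have "expectation (\<lambda>\<omega>. (\<xi> N \<omega>)\<^sup>2) \<le> C\<^sup>2"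
      using i\<xi>2 \<xi>2 by (intro integral_le_const) auto
    then have "expectation (\<lambda>\<omega>. (\<xi> N \<omega>)\<^sup>2) * (p (Suc N) - p N) \<le> C\<^sup>2 * (p (Suc N) - p N)"
      using p(2) by (intro mult_right_mono) auto
    ultimately show ?case using ZC by (simp add: algebra_simps)
  qed
  then show "Z N \<in> borel_measurable (F (p N))" "integrable M (\<lambda>\<omega>. (Z N \<omega>)\<^sup>2)"
    "expectation (Z N) = 0" "expectation (\<lambda>\<omega>. (Z N \<omega>)\<^sup>2) \<le> C\<^sup>2 * (p N - p 0)" by auto
qed

text \<open>The density of the increment up to time \<open>k\<close> is at most
  \<open>1 / sqrt (2 * pi * k)\<close>, so staying within \<open>B\<close> at time \<open>k\<close>
  has probability of order \<open>1 / sqrt k\<close>; the event of staying within \<open>B\<close>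
  at all integer times is therefore null. This gives finiteness of T almost surely.\<close>

lemma AE_unbounded: "AE \<omega> in M. \<exists>k::nat. B < \<bar>W (real k) \<omega> - W 0 \<omega>\<bar>"
proof -
  define A where "A k = {\<omega> \<in> space M. \<bar>W (real k) \<omega> - W 0 \<omega>\<bar> \<le> B}" for k :: nat
  have A[measurable]: "A k \<in> sets M" for k unfolding A_def by measurable
  have bound: "prob (A k) \<le> 2 * max B 0 / sqrt (2 * pi * k)" if "0 < k" for k
  proof -
    let ?s = "sqrt (real k)"
    have D: "distributed M lborel (\<lambda>\<omega>. W (real k) \<omega> - W 0 \<omega>) (normal_density 0 ?s)"
      using W_incr[of 0 "real k"] that by simp
    have "emeasure M (A k) = emeasure M ((\<lambda>\<omega>. W (real k) \<omega> - W 0 \<omega>) -` {-B..B} \<inter> space M)"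
      by (rule arg_cong[where f="emeasure M"]) (auto simp: A_def)
    also have "\<dots> = (\<integral>\<^sup>+x. ennreal (normal_density 0 ?s x) * indicator {-B..B} x \<partial>lborel)"
      by (rule distributed_emeasure[OF D]) simp
    also have "\<dots> \<le> (\<integral>\<^sup>+x. ennreal (1 / sqrt (2 * pi * k)) * indicator {-B..B} x \<partial>lborel)"
    proof (intro nn_integral_mono mult_right_mono ennreal_leI)
      fix x :: real
      have "exp (- (x - 0)\<^sup>2 / (2 * ?s\<^sup>2)) \<le> 1" by simp
      then have "1 / sqrt (2 * pi * ?s\<^sup>2) * exp (- (x - 0)\<^sup>2 / (2 * ?s\<^sup>2)) \<le> 1 / sqrt (2 * pi * ?s\<^sup>2) * 1"
        by (rule mult_left_mono) simp
      then show "normal_density 0 ?s x \<le> 1 / sqrt (2 * pi * k)" by (simp add: normal_density_def)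
    qed simp
    also have "\<dots> = ennreal (1 / sqrt (2 * pi * k)) * ennreal (2 * max B 0)"
      by (subst nn_integral_cmult_indicator) (auto simp: max_def emeasure_lborel_Icc_eq)
    also have "\<dots> = ennreal (2 * max B 0 / sqrt (2 * pi * k))"
      by (simp flip: ennreal_mult)
    finally show ?thesis
      by (simp add: emeasure_eq_measure)
  qed
  have "(\<lambda>k. 2 * max B 0 / sqrt (2 * pi * real k)) \<longlonglongrightarrow> 0"
    by real_asymp
  then have small: "prob (\<Inter>k. A k) \<le> 0"
  proof (rule tendsto_lowerbound)
    show "\<forall>\<^sub>F k in sequentially. prob (\<Inter>k. A k) \<le> 2 * max B 0 / sqrt (2 * pi * real k)"
      using eventually_gt_at_top[of 0]
    proof eventually_elim
      case (elim k)
      have "prob (\<Inter>k. A k) \<le> prob (A k)" by (rule finite_measure_mono) auto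
      then show ?case using bound[OF elim] by simp
    qed
  qed simp
  have "(\<Inter>k. A k) \<in> null_sets M"
    using small by (intro null_setsI) (auto simp: emeasure_eq_measure measure_le_0_iff)
  then show ?thesis
    by (rule AE_I') (auto simp: A_def not_less)
qed

end


section \<open>Continuous adapted processes\<close>

lemma rational_sequence_from_right:
  "\<exists>r :: nat \<Rightarrow> real. (\<forall>k. r k \<in> \<rat> \<and> s < r k) \<and> r \<longlonglongrightarrow> s"
proof -
  have "\<exists>q\<in>\<rat>. s < q \<and> q < s + 1 / real (Suc k)" for k
    by (rule Rats_dense_in_real) simp
  then obtain r where r: "\<And>k. r k \<in> \<rat>" "\<And>k. s < r k" "\<And>k. r k < s + 1 / real (Suc k)" by metis
  have "r \<longlonglongrightarrow> s"
  proof (rule tendsto_sandwich[where f="\<lambda>_. s" and h="\<lambda>k. s + 1 / real (Suc k)"])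
    show "(\<lambda>k. s + 1 / real (Suc k)) \<longlonglongrightarrow> s"
      using tendsto_add[OF tendsto_const LIMSEQ_inverse_real_of_nat, of s] by (simp add: inverse_eq_divide)
    show "\<forall>\<^sub>F k in sequentially. s \<le> r k" using r(2) by (simp add: less_imp_le)
    show "\<forall>\<^sub>F k in sequentially. r k \<le> s + 1 / real (Suc k)" using r(3) by (simp add: less_imp_le)
  qed simp
  then show ?thesis using r by blast
qed

text \<open>The quantifier runs over a fixed countable set of rationals; \<open>min t q\<close>
  brings in the endpoint \<open>t\<close>, which may be irrational.\<close>

lemma all_le_iff_rational:
  fixes w :: "real \<Rightarrow> real"
  assumes "continuous_on {0..} w" "0 \<le> t"
  shows "(\<forall>s\<in>{0..t}. w s \<le> c) \<longleftrightarrow> (\<forall>q\<in>\<rat> \<inter> {0..}. w (min t q) \<le> c)"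
proof
  assume R: "\<forall>q\<in>\<rat> \<inter> {0..}. w (min t q) \<le> c"
  show "\<forall>s\<in>{0..t}. w s \<le> c"
  proof
    fix s assume s: "s \<in> {0..t}"
    obtain r where r: "\<And>k. r k \<in> \<rat>" "\<And>k. s < r k" "r \<longlonglongrightarrow> s"
      using rational_sequence_from_right[of s] by blast
    have "(\<lambda>k. min t (r k)) \<longlonglongrightarrow> min t s" by (intro tendsto_intros r)
    then have "(\<lambda>k. w (min t (r k))) \<longlonglongrightarrow> w (min t s)"
      by (rule continuous_on_tendsto_compose[OF assms(1)])
        (use s r(2) assms(2) in \<open>auto intro!: always_eventually intro: less_imp_le order.strict_trans1\<close>)
    moreover have "w (min t (r k)) \<le> c" for k
      using R r(1)[of k] s less_imp_le[OF r(2)[of k]] by (auto dest: order_trans)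
    ultimately have "w (min t s) \<le> c" by (intro LIMSEQ_le_const2) auto
    then show "w s \<le> c" using s by simp
  qed
qed (use assms(2) in auto)

text \<open>On \<open>{0..t}\<close> the predicate \<open>before_hit\<close> is that of some finite
  \<sigma>. Beyond \<open>t\<close> the two may differ, but there both truncated times equal
  \<open>t\<close> and the increment is 0.\<close>

lemma grid_sum_stop_at:
  fixes w :: "real \<Rightarrow> real"
  assumes w: "continuous_on {0..} w" and g: "continuous_on {0..} g" and at: "0 \<le> a" "a \<le> t"
    and h: "\<And>k. 0 \<le> h k" "h \<longlonglongrightarrow> 0" and N: "\<forall>\<^sub>F k in sequentially. t \<le> a + real (N k) * h k"
  shows "(\<lambda>k. \<Sum>j<N k. of_bool (before_hit g (a + real j * h k))
           * (w (min t (a + real (Suc j) * h k)) - w (min t (a + real j * h k))))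
         \<longlonglongrightarrow> w (stop_at g t) - w (stop_at g a)"
proof -
  obtain \<sigma> where \<sigma>: "0 \<le> \<sigma>" "\<And>r. 0 \<le> r \<Longrightarrow> r \<le> t \<Longrightarrow> before_hit g r \<longleftrightarrow> r < \<sigma>"
    "\<And>r. 0 \<le> r \<Longrightarrow> r \<le> t \<Longrightarrow> stop_at g r = min r \<sigma>"
    using stop_at_local[OF g, of t] at by auto
  have eq: "of_bool (before_hit g (a + real j * h k))
           * (w (min t (a + real (Suc j) * h k)) - w (min t (a + real j * h k)))
      = of_bool (a + real j * h k < \<sigma>)
           * (w (min t (a + real (Suc j) * h k)) - w (min t (a + real j * h k)))" for j k
  proof (cases "a + real j * h k \<le> t")
    case True
    then show ?thesis using \<sigma>(2)[of "a + real j * h k"] at h(1)[of k] by simp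
  next
    case False
    moreover have "a + real j * h k \<le> a + real (Suc j) * h k" using h(1)[of k] by (simp add: algebra_simps)
    ultimately have "min t (a + real (Suc j) * h k) = min t (a + real j * h k)" by simp
    then show ?thesis by simp
  qed
  have "stop_at g t = min t \<sigma>" "stop_at g a = min a \<sigma>" using \<sigma>(3) at by auto
  then show ?thesis
    unfolding eq using grid_sum_tendsto[OF w at \<sigma>(1) h N] by simp
qed

context wiener
begin

definition continuous_adapted :: "(real \<Rightarrow> 'a \<Rightarrow> real) \<Rightarrow> bool" where
  "continuous_adapted G \<longleftrightarrow> (\<forall>t\<ge>0. G t \<in> borel_measurable (F t))
     \<and> (\<forall>\<omega>\<in>space M. continuous_on {0..} (\<lambda>t. G t \<omega>))"

lemma continuous_adaptedD:
  assumes "continuous_adapted G"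
  shows "0 \<le> s \<Longrightarrow> s \<le> t \<Longrightarrow> G s \<in> borel_measurable (F t)"
    and "\<omega> \<in> space M \<Longrightarrow> continuous_on {0..} (\<lambda>t. G t \<omega>)"
  using assms F_meas_mono[of "G s" s t] by (auto simp: continuous_adapted_def)

lemma continuous_adapted_W: "continuous_adapted W"
  using W_cont W_adapted by (auto simp: continuous_adapted_def)

lemma continuous_adapted_time: "continuous_adapted (\<lambda>t _. t)"
  by (auto simp: continuous_adapted_def continuous_on_id)

lemma continuous_adapted_runsup:
  assumes "continuous_adapted G"
  shows "continuous_adapted (\<lambda>t \<omega>. runsup (\<lambda>s. G s \<omega>) t)"
  unfolding continuous_adapted_def
proof (intro conjI allI impI ballI)
  fix t :: real assume t: "0 \<le> t"
  have "{\<omega> \<in> space M. runsup (\<lambda>s. G s \<omega>) t \<le> c} \<in> sets (F t)" for c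
  proof -
    have "runsup (\<lambda>s. G s \<omega>) t \<le> c \<longleftrightarrow> (\<forall>q\<in>\<rat> \<inter> {0..}. G (min t q) \<omega> \<le> c)" if "\<omega> \<in> space M" for \<omega>
      unfolding runsup_le_iff[OF continuous_adaptedD(2)[OF assms that] t]
      by (rule all_le_iff_rational[OF continuous_adaptedD(2)[OF assms that] t])
    moreover have "(0::real) \<in> \<rat> \<inter> {0..}" by simp
    ultimately have "{\<omega> \<in> space M. runsup (\<lambda>s. G s \<omega>) t \<le> c} = (\<Inter>q\<in>\<rat> \<inter> {0..}. {\<omega> \<in> space (F t). G (min t q) \<omega> \<le> c})"
      unfolding space_F by blast
    also have "\<dots> \<in> sets (F t)"
    proof (rule sets.countable_INT')
      have "{\<omega> \<in> space (F t). G (min t q) \<omega> \<le> c} \<in> sets (F t)" if "q \<in> \<rat> \<inter> {0..}" for q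
      proof -
        from that have [measurable]: "G (min t q) \<in> borel_measurable (F t)"
          using t by (intro continuous_adaptedD[OF assms]) auto
        show ?thesis by measurable
      qed
      then show "(\<lambda>q. {\<omega> \<in> space (F t). G (min t q) \<omega> \<le> c}) ` (\<rat> \<inter> {0..}) \<subseteq> sets (F t)" by blast
    qed (auto simp: countable_rat intro!: countable_Int1 bexI[of _ 0])
    finally show ?thesis .
  qed
  then show "(\<lambda>\<omega>. runsup (\<lambda>s. G s \<omega>) t) \<in> borel_measurable (F t)"
    unfolding borel_measurable_iff_le by simp
qed (use continuous_on_runsup continuous_adaptedD(2)[OF assms] in blast)

lemma before_hit_measurable:
  assumes "continuous_adapted G" "0 \<le> t"
  shows "{\<omega> \<in> space M. before_hit (\<lambda>s. G s \<omega>) t} \<in> sets (F t)"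
proof -
  have [measurable]: "(\<lambda>\<omega>. runsup (\<lambda>s. G s \<omega>) t) \<in> borel_measurable (F t)"
    by (rule continuous_adaptedD(1)[OF continuous_adapted_runsup[OF assms(1)] assms(2) order_refl])
  have "{\<omega> \<in> space M. before_hit (\<lambda>s. G s \<omega>) t} = {\<omega> \<in> space (F t). runsup (\<lambda>s. G s \<omega>) t < 0}"
    using before_hit_iff_runsup[OF continuous_adaptedD(2)[OF assms(1)] assms(2)] by auto
  also have "\<dots> \<in> sets (F t)" by measurable
  finally show ?thesis .
qed

lemma before_hit_borel:
  assumes "continuous_adapted G" "0 \<le> s" "s \<le> t"
  shows "(\<lambda>\<omega>. of_bool (before_hit (\<lambda>s. G s \<omega>) s) :: real) \<in> borel_measurable (F t)"
proof -
  have "{\<omega> \<in> space (F t). before_hit (\<lambda>s. G s \<omega>) s} \<in> sets (F t)"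
    using before_hit_measurable[OF assms(1,2)] F_mono[OF assms(3)] by auto
  then have [measurable]: "Measurable.pred (F t) (\<lambda>\<omega>. before_hit (\<lambda>s. G s \<omega>) s)"
    by (simp add: pred_def)
  show ?thesis unfolding of_bool_def by measurable
qed

text \<open>The stopped value is \<open>U 0\<close> plus the pathwise limit of grid sums whose terms
  are all known at time \<open>t\<close>, so adaptedness follows without composing \<open>U\<close>
  with a random time.\<close>

lemma continuous_adapted_stopped:
  assumes U: "continuous_adapted U" and G: "continuous_adapted G"
  shows "continuous_adapted (\<lambda>t \<omega>. U (stop_at (\<lambda>s. G s \<omega>) t) \<omega>)"
  unfolding continuous_adapted_def
proof (intro conjI allI impI ballI)
  fix t :: real assume t: "0 \<le> t"
  let ?h = "\<lambda>k::nat. t / real (Suc k)"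
  let ?f = "\<lambda>k \<omega>. U 0 \<omega> + (\<Sum>j<Suc k. of_bool (before_hit (\<lambda>s. G s \<omega>) (0 + real j * ?h k))
           * (U (min t (0 + real (Suc j) * ?h k)) \<omega> - U (min t (0 + real j * ?h k)) \<omega>))"
  show "(\<lambda>\<omega>. U (stop_at (\<lambda>s. G s \<omega>) t) \<omega>) \<in> borel_measurable (F t)"
  proof (rule borel_measurable_LIMSEQ_real)
    fix k
    show "?f k \<in> borel_measurable (F t)"
    proof (intro borel_measurable_add borel_measurable_sum borel_measurable_times
        borel_measurable_diff before_hit_borel[OF G] continuous_adaptedD(1)[OF U])
      fix j assume "j \<in> {..<Suc k}"
      then have "real j * t \<le> real (Suc k) * t" using t by (intro mult_right_mono) auto
      then show "0 + real j * ?h k \<le> t" by (simp add: field_simps)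
    qed (use t in auto)
  next
    fix \<omega> assume "\<omega> \<in> space (F t)"
    then have \<omega>: "\<omega> \<in> space M" by simp
    have "stop_at (\<lambda>s. G s \<omega>) 0 = 0"
      using stop_at_bounds[OF continuous_adaptedD(2)[OF G \<omega>], of 0] by simp
    moreover have "(\<lambda>k. t / real (Suc k)) \<longlonglongrightarrow> 0"
      using LIMSEQ_Suc[OF lim_const_over_n[of t]] .
    then have "(\<lambda>k. (\<Sum>j<Suc k. of_bool (before_hit (\<lambda>s. G s \<omega>) (0 + real j * ?h k))
           * (U (min t (0 + real (Suc j) * ?h k)) \<omega> - U (min t (0 + real j * ?h k)) \<omega>)))
        \<longlonglongrightarrow> U (stop_at (\<lambda>s. G s \<omega>) t) \<omega> - U (stop_at (\<lambda>s. G s \<omega>) 0) \<omega>"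
      by (intro grid_sum_stop_at continuous_adaptedD(2)[OF G \<omega>] continuous_adaptedD(2)[OF U \<omega>])
        (use t in auto)
    ultimately show "(\<lambda>k. ?f k \<omega>) \<longlonglongrightarrow> U (stop_at (\<lambda>s. G s \<omega>) t) \<omega>"
      using tendsto_add[OF tendsto_const, of _ _ _ "U 0 \<omega>"] by force
  qed
next
  fix \<omega> assume \<omega>: "\<omega> \<in> space M"
  show "continuous_on {0..} (\<lambda>t. U (stop_at (\<lambda>s. G s \<omega>) t) \<omega>)"
    by (rule continuous_on_stopped[OF continuous_adaptedD(2)[OF G \<omega>] continuous_adaptedD(2)[OF U \<omega>]])
qed

text \<open>On \<open>{0..t}\<close> the whole process is encoded by two
  \<open>F t\<close>-measurable quantities: \<open>s\<close> precedes the hit if it precedes the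
  time stopped at \<open>t\<close>, or if there is no hit up to \<open>t\<close>. The second
  alternative accounts for \<open>s = t\<close>.\<close>

lemma before_hit_progressive:
  assumes G: "continuous_adapted G"
  shows "progressively_measurable F (\<lambda>s \<omega>. of_bool (before_hit (\<lambda>s. G s \<omega>) s))"
  unfolding progressively_measurable_def
proof (intro allI impI)
  fix t :: real assume t: "0 \<le> t"
  have [measurable]: "(\<lambda>\<omega>. stop_at (\<lambda>s. G s \<omega>) t) \<in> borel_measurable (F t)"
    using continuous_adaptedD(1)[OF continuous_adapted_stopped[OF continuous_adapted_time G] t order_refl] .
  have "{\<omega> \<in> space (F t). before_hit (\<lambda>s. G s \<omega>) t} \<in> sets (F t)"
    using before_hit_measurable[OF G t] by simp
  then have [measurable]: "Measurable.pred (F t) (\<lambda>\<omega>. before_hit (\<lambda>s. G s \<omega>) t)"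
    by (simp add: pred_def)
  have [measurable]: "(\<lambda>s. s) \<in> borel_measurable (restrict_space borel {0..t::real})"
    by (rule measurable_restrict_space1) simp
  have "(\<lambda>(s, \<omega>). of_bool (s < stop_at (\<lambda>s. G s \<omega>) t \<or> before_hit (\<lambda>s. G s \<omega>) t) :: real)
      \<in> borel_measurable (restrict_space borel {0..t} \<Otimes>\<^sub>M F t)"
    unfolding of_bool_def by measurable
  moreover have "before_hit (\<lambda>s. G s \<omega>) s \<longleftrightarrow> s < stop_at (\<lambda>s. G s \<omega>) t \<or> before_hit (\<lambda>s. G s \<omega>) t"
    if "s \<in> {0..t}" "\<omega> \<in> space M" for s \<omega>
    using stop_at_local[OF continuous_adaptedD(2)[OF G that(2)] t] that by force
  moreover have "(\<lambda>(s, \<omega>). of_bool (before_hit (\<lambda>s. G s \<omega>) s) :: real) z =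
      (\<lambda>(s, \<omega>). of_bool (s < stop_at (\<lambda>s. G s \<omega>) t \<or> before_hit (\<lambda>s. G s \<omega>) t)) z"
    if "z \<in> space (restrict_space borel {0..t} \<Otimes>\<^sub>M F t)" for z
    using calculation(2)[of "fst z" "snd z"] that
    by (simp add: space_pair_measure space_restrict_space case_prod_unfold mem_Times_iff)
  ultimately show "(\<lambda>(s, \<omega>). of_bool (before_hit (\<lambda>s. G s \<omega>) s) :: real)
      \<in> borel_measurable (restrict_space borel {0..t} \<Otimes>\<^sub>M F t)"
    by (metis (no_types, lifting) measurable_cong)
qed

end

locale step_integrand = wiener M W F for M :: "'a measure" and W F +
  fixes I :: "nat set" and d :: "nat \<Rightarrow> real" and G :: "nat \<Rightarrow> real \<Rightarrow> 'a \<Rightarrow> real"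
  assumes finI: "finite I" and G: "\<And>i. i \<in> I \<Longrightarrow> continuous_adapted (G i)"
begin

definition H :: "real \<Rightarrow> 'a \<Rightarrow> real" where
  "H s \<omega> = (\<Sum>i\<in>I. d i * of_bool (before_hit (\<lambda>r. G i r \<omega>) s))"

text \<open>An indefinite integral of \<open>H\<close> along each path: integrating the indicator of
  times before \<sigma> against W gives W at the stopped time, up to its initial value.\<close>

definition J :: "real \<Rightarrow> 'a \<Rightarrow> real" where
  "J t \<omega> = (\<Sum>i\<in>I. d i * W (stop_at (\<lambda>r. G i r \<omega>) t) \<omega>)"

abbreviation "C \<equiv> (\<Sum>i\<in>I. \<bar>d i\<bar>)"

lemma H_measurable: "0 \<le> s \<Longrightarrow> s \<le> t \<Longrightarrow> H s \<in> borel_measurable (F t)"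
  unfolding H_def[abs_def]
  by (intro borel_measurable_sum borel_measurable_times before_hit_borel G) auto

lemma H_bound: "\<bar>H s \<omega>\<bar> \<le> C"
  unfolding H_def by (rule sum_abs[THEN order_trans]) (auto intro!: sum_mono simp: abs_mult)

lemma H_progressive: "progressively_measurable F H"
  unfolding progressively_measurable_def
proof (intro allI impI)
  fix t :: real assume t: "0 \<le> t"
  have "(\<lambda>z. \<Sum>i\<in>I. d i * (\<lambda>(s, \<omega>). of_bool (before_hit (\<lambda>r. G i r \<omega>) s)) z)
      \<in> borel_measurable (restrict_space borel {0..t} \<Otimes>\<^sub>M F t)"
    using before_hit_progressive[OF G] t unfolding progressively_measurable_def
    by (intro borel_measurable_sum borel_measurable_times) auto
  then show "(\<lambda>(s, \<omega>). H s \<omega>) \<in> borel_measurable (restrict_space borel {0..t} \<Otimes>\<^sub>M F t)"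
    by (simp add: H_def case_prod_unfold)
qed

lemma continuous_adapted_J: "continuous_adapted J"
proof -
  have *: "continuous_adapted (\<lambda>t \<omega>. W (stop_at (\<lambda>r. G i r \<omega>) t) \<omega>)" if "i \<in> I" for i
    by (rule continuous_adapted_stopped[OF continuous_adapted_W G[OF that]])
  show ?thesis
    unfolding continuous_adapted_def J_def[abs_def]
    using continuous_adaptedD[OF *] by (auto intro!: borel_measurable_sum borel_measurable_times continuous_intros)
qed

lemma J_measurable: "0 \<le> t \<Longrightarrow> J t \<in> borel_measurable (F t)"
  and J_continuous: "\<omega> \<in> space M \<Longrightarrow> continuous_on {0..} (\<lambda>t. J t \<omega>)"
  using continuous_adaptedD[OF continuous_adapted_J] by auto

lemma J_start: "\<omega> \<in> space M \<Longrightarrow> J 0 \<omega> = (\<Sum>i\<in>I. d i) * W 0 \<omega>"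
proof -
  assume \<omega>: "\<omega> \<in> space M"
  have "stop_at (\<lambda>r. G i r \<omega>) 0 = 0" if "i \<in> I" for i
    using stop_at_bounds[OF continuous_adaptedD(2)[OF G[OF that] \<omega>], of 0] by simp
  then show ?thesis by (simp add: J_def sum_distrib_right)
qed

lemma grid_sum_H:
  assumes \<omega>: "\<omega> \<in> space M" and at: "0 \<le> a" "a \<le> t"
    and h: "\<And>k. 0 \<le> h k" "h \<longlonglongrightarrow> 0" and N: "\<forall>\<^sub>F k in sequentially. t \<le> a + real (N k) * h k"
  shows "(\<lambda>k. \<Sum>j<N k. H (a + real j * h k) \<omega>
           * (W (min t (a + real (Suc j) * h k)) \<omega> - W (min t (a + real j * h k)) \<omega>))
         \<longlonglongrightarrow> J t \<omega> - J a \<omega>"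
proof -
  let ?S = "\<lambda>i k. \<Sum>j<N k. of_bool (before_hit (\<lambda>r. G i r \<omega>) (a + real j * h k))
           * (W (min t (a + real (Suc j) * h k)) \<omega> - W (min t (a + real j * h k)) \<omega>)"
  have "(\<lambda>k. \<Sum>i\<in>I. d i * ?S i k) \<longlonglongrightarrow>
      (\<Sum>i\<in>I. d i * (W (stop_at (\<lambda>r. G i r \<omega>) t) \<omega> - W (stop_at (\<lambda>r. G i r \<omega>) a) \<omega>))"
    by (intro tendsto_intros grid_sum_stop_at W_cont continuous_adaptedD(2)[OF G] \<omega> at h N)
  moreover have "(\<Sum>i\<in>I. d i * ?S i k) = (\<Sum>j<N k. H (a + real j * h k) \<omega>
           * (W (min t (a + real (Suc j) * h k)) \<omega> - W (min t (a + real j * h k)) \<omega>))" for k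
    unfolding H_def sum_distrib_left sum_distrib_right
    by (subst sum.swap) (simp add: mult.assoc)
  ultimately show ?thesis
    by (simp add: J_def right_diff_distrib sum_subtractf)
qed

text \<open>All grid points lie at or after \<open>a\<close>, so multiplying the coefficients by the
  indicator of \<open>A\<close> keeps them adapted. The sums then have mean zero and second moments
  at most \<open>C\<^sup>2 * (t - a)\<close>, uniformly in the mesh, which allows the passage to the
  pathwise limit.\<close>

lemma J_martingale:
  assumes at: "0 \<le> a" "a \<le> t" and A: "A \<in> sets (F a)"
    and bound: "\<And>s. 0 \<le> s \<Longrightarrow> AE \<omega> in M. \<bar>J s \<omega>\<bar> \<le> B"
  shows "expectation (\<lambda>\<omega>. indicator A \<omega> * J t \<omega>) = expectation (\<lambda>\<omega>. indicator A \<omega> * J a \<omega>)"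
proof -
  define h where "h k = (t - a) / real (Suc k)" for k
  define p where "p k j = a + real j * h k" for k j
  define \<xi> where "\<xi> k j \<omega> = (if j < Suc k then indicator A \<omega> * H (p k j) \<omega> else 0)" for k j \<omega>
  define X where "X k \<omega> = (\<Sum>j<Suc k. \<xi> k j \<omega> * (W (p k (Suc j)) \<omega> - W (p k j) \<omega>))" for k \<omega>
  have AM[measurable]: "A \<in> sets M" using A F_sub by blast
  have h: "0 \<le> h k" for k using at by (simp add: h_def)
  have p: "a \<le> p k j" "p k j \<le> p k (Suc j)" for k j
    using h[of k] by (auto simp: p_def algebra_simps)
  have p_end: "p k (Suc k) = t" for k by (simp add: p_def h_def)
  have \<xi>: "\<xi> k j \<in> borel_measurable (F (p k j))" for k j
  proof -
    have "A \<in> sets (F (p k j))" using A F_mono[OF p(1)] by blast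
    then show ?thesis using H_measurable[of "p k j" "p k j"] p(1)[of k j] at
      unfolding \<xi>_def[abs_def] by (cases "j < Suc k") (auto intro!: borel_measurable_times)
  qed
  have \<xi>C: "\<bar>\<xi> k j \<omega>\<bar> \<le> C" for k j \<omega>
  proof -
    have "0 \<le> C" by (simp add: sum_nonneg)
    then show ?thesis using H_bound[of "p k j" \<omega>] by (auto simp: \<xi>_def indicator_def)
  qed
  have p0: "0 \<le> p k 0" "p k 0 = a" for k using at by (auto simp: p_def)
  note dim = discrete_integral_moments[of "p _" "\<xi> _" C, OF p0(1) p(2) \<xi> \<xi>C, folded X_def]
  have Jm: "J s \<in> borel_measurable M" if "0 \<le> s" for s by (rule F_meas_M[OF J_measurable[OF that]])
  have [measurable]: "J t \<in> borel_measurable M" "J a \<in> borel_measurable M" using Jm at by auto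
  have "expectation (\<lambda>\<omega>. indicator A \<omega> * (J t \<omega> - J a \<omega>)) = 0"
  proof (rule expectation_limit_zero[where X = X])
    show "X k \<in> borel_measurable M" for k unfolding X_def[abs_def] by (rule F_meas_M[OF dim(1)])
    show "integrable M (\<lambda>\<omega>. (X k \<omega>)\<^sup>2)" "expectation (X k) = 0" for k
      unfolding X_def[abs_def] by (rule dim(2,3))+
    show "expectation (\<lambda>\<omega>. (X k \<omega>)\<^sup>2) \<le> C\<^sup>2 * (t - a)" for k
      using dim(4)[of k "Suc k"] unfolding X_def p_end p0(2) .
    show "AE \<omega> in M. (\<lambda>k. X k \<omega>) \<longlonglongrightarrow> indicator A \<omega> * (J t \<omega> - J a \<omega>)"
    proof (rule AE_I2)
      fix \<omega> assume \<omega>: "\<omega> \<in> space M"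
      have p_le: "p k j \<le> t" if "j \<le> Suc k" for k j
        using mult_right_mono[of "real j" "real (Suc k)" "h k"] that h[of k] p_end[of k] by (simp add: p_def)
      have "(\<lambda>k. \<Sum>j<Suc k. H (a + real j * h k) \<omega>
           * (W (min t (a + real (Suc j) * h k)) \<omega> - W (min t (a + real j * h k)) \<omega>)) \<longlonglongrightarrow> J t \<omega> - J a \<omega>"
      proof (rule grid_sum_H[OF \<omega> at h])
        show "h \<longlonglongrightarrow> 0" unfolding h_def using LIMSEQ_Suc[OF lim_const_over_n[of "t - a"]] .
        show "\<forall>\<^sub>F k in sequentially. t \<le> a + real (Suc k) * h k"
          using p_end by (simp add: p_def)
      qed
      then have "(\<lambda>k. indicator A \<omega> * (\<Sum>j<Suc k. H (a + real j * h k) \<omega>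
           * (W (min t (a + real (Suc j) * h k)) \<omega> - W (min t (a + real j * h k)) \<omega>)))
           \<longlonglongrightarrow> indicator A \<omega> * (J t \<omega> - J a \<omega>)" by (intro tendsto_intros)
      moreover have "X k \<omega> = indicator A \<omega> * (\<Sum>j<Suc k. H (a + real j * h k) \<omega>
           * (W (min t (a + real (Suc j) * h k)) \<omega> - W (min t (a + real j * h k)) \<omega>))" for k
        unfolding X_def sum_distrib_left
      proof (rule sum.cong)
        fix j assume "j \<in> {..<Suc k}"
        then have "j < Suc k" "min t (p k (Suc j)) = p k (Suc j)" "min t (p k j) = p k j"
          using p_le[of j k] p_le[of "Suc j" k] by auto
        then show "\<xi> k j \<omega> * (W (p k (Suc j)) \<omega> - W (p k j) \<omega>) = indicator A \<omega> * (H (a + real j * h k) \<omega>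
           * (W (min t (a + real (Suc j) * h k)) \<omega> - W (min t (a + real j * h k)) \<omega>))"
          by (simp add: \<xi>_def p_def mult.assoc)
      qed simp
      ultimately show "(\<lambda>k. X k \<omega>) \<longlonglongrightarrow> indicator A \<omega> * (J t \<omega> - J a \<omega>)" by simp
    qed
    show "AE \<omega> in M. \<bar>indicator A \<omega> * (J t \<omega> - J a \<omega>)\<bar> \<le> 2 * B"
      using bound[OF at(1)] bound[OF order_trans[OF at]]
      by eventually_elim (auto simp: indicator_def)
  qed auto
  moreover have "integrable M (\<lambda>\<omega>. indicator A \<omega> * J s \<omega>)" if "0 \<le> s" for s
  proof (rule integrable_const_bound[where B="B"])
    show "AE \<omega> in M. norm (indicator A \<omega> * J s \<omega>) \<le> B"
      using bound[OF that] by eventually_elim (auto simp: indicator_def)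
  qed (use Jm[OF that] in measurable)
  ultimately show ?thesis using at by (simp add: right_diff_distrib)
qed

end


section \<open>Ito integrals of step processes\<close>

lemma (in prob_space) pointwise_imp_in_probability:
  fixes X :: "nat \<Rightarrow> 'a \<Rightarrow> real"
  assumes X[measurable]: "\<And>k. X k \<in> borel_measurable M" and Y[measurable]: "Y \<in> borel_measurable M"
    and lim: "\<And>\<omega>. \<omega> \<in> space M \<Longrightarrow> (\<lambda>k. X k \<omega>) \<longlonglongrightarrow> Y \<omega>" and e: "0 < e"
  shows "(\<lambda>k. prob {\<omega> \<in> space M. \<bar>X k \<omega> - Y \<omega>\<bar> > e}) \<longlonglongrightarrow> 0"
proof -
  let ?A = "\<lambda>k. {\<omega> \<in> space M. \<bar>X k \<omega> - Y \<omega>\<bar> > e}"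
  have "(\<lambda>k. expectation (indicat_real (?A k))) \<longlonglongrightarrow> expectation (\<lambda>_. 0)"
  proof (rule integral_dominated_convergence[where w="\<lambda>_. 1"])
    show "AE \<omega> in M. (\<lambda>k. indicat_real (?A k) \<omega>) \<longlonglongrightarrow> 0"
    proof (rule AE_I2)
      fix \<omega> assume "\<omega> \<in> space M"
      then have "\<forall>\<^sub>F k in sequentially. dist (X k \<omega>) (Y \<omega>) < e"
        using lim e tendstoD by blast
      then have "\<forall>\<^sub>F k in sequentially. indicat_real (?A k) \<omega> = 0"
        by eventually_elim (auto simp: dist_real_def indicator_def)
      then show "(\<lambda>k. indicat_real (?A k) \<omega>) \<longlonglongrightarrow> 0" by (rule tendsto_eventually)
    qed
  qed (auto simp: indicator_def)
  then show ?thesis by simp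
qed

lemma grid_index:
  fixes s h :: real
  assumes "0 < s" "0 < h"
  obtains j :: nat where "real j * h < s" "s \<le> real (Suc j) * h"
proof -
  have "0 < s / h" using assms by simp
  then have "0 \<le> \<lceil>s / h\<rceil> - 1" by linarith
  then obtain j where j: "int j = \<lceil>s / h\<rceil> - 1" by (metis nonneg_int_cases)
  then have "real j < s / h" "s / h \<le> real (Suc j)" by linarith+
  then show ?thesis using that assms by (simp add: field_simps)
qed

lemma simple_process_grid:
  assumes "0 < h" "real j * h < s" "s \<le> real (Suc j) * h" "j < N"
  shows "simple_process N (\<lambda>j. real j * h) \<xi> s \<omega> = \<xi> j \<omega>"
proof -
  have "\<xi> i \<omega> * indicat_real {real i * h<..real (Suc i) * h} s = (if i = j then \<xi> j \<omega> else 0)" for i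
  proof (cases "i = j")
    case False
    then consider "Suc i \<le> j" | "Suc j \<le> i" by linarith
    then have "s \<notin> {real i * h<..real (Suc i) * h}"
    proof cases
      case 1
      then have "real (Suc i) * h \<le> real j * h" using assms(1) by (intro mult_right_mono) auto
      then have "real (Suc i) * h < s" using assms(2) by linarith
      then show ?thesis by (simp del: of_nat_Suc)
    next
      case 2
      then have "real (Suc j) * h \<le> real i * h" using assms(1) by (intro mult_right_mono) auto
      then have "s \<le> real i * h" using assms(3) by linarith
      then show ?thesis by (simp del: of_nat_Suc)
    qed
    then show ?thesis using False by simp
  qed (use assms in auto)
  then show ?thesis unfolding simple_process_def using assms(4) by simp
qed

context step_integrand
begin

text \<open>In each grid cell the two processes differ only within distance \<open>h\<close> after one of the hitting times,
  so the error is bounded uniformly in \<open>\<omega>\<close>.\<close>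

lemma simple_process_approximation:
  assumes \<omega>: "\<omega> \<in> space M" and h: "0 < h" and N: "t \<le> real N * h" and t: "0 \<le> t"
  shows "(\<integral>\<^sup>+s\<in>{0..t}. ennreal ((simple_process N (\<lambda>j. real j * h) (\<lambda>j. H (real j * h)) s \<omega> - H s \<omega>)\<^sup>2) \<partial>lborel)
    \<le> ennreal (C\<^sup>2 * h)"
proof -
  let ?S = "\<lambda>s. simple_process N (\<lambda>j. real j * h) (\<lambda>j. H (real j * h)) s \<omega>"
  have "\<forall>i\<in>I. \<exists>\<sigma>. \<forall>r\<in>{0..t}. before_hit (\<lambda>r. G i r \<omega>) r \<longleftrightarrow> r < \<sigma>"
    using stop_at_local[OF continuous_adaptedD(2)[OF G \<omega>] t] by meson
  then obtain \<sigma> where \<sigma>: "\<And>i r. i \<in> I \<Longrightarrow> r \<in> {0..t} \<Longrightarrow> before_hit (\<lambda>r. G i r \<omega>) r \<longleftrightarrow> r < \<sigma> i"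
    by metis
  have C: "0 \<le> C" by (simp add: sum_nonneg)
  have ptw: "(?S s - H s \<omega>)\<^sup>2 \<le> (\<Sum>i\<in>I. C * \<bar>d i\<bar> * indicator {\<sigma> i..\<sigma> i + h} s)" if s: "0 < s" "s \<le> t" for s
  proof -
    obtain j where j: "real j * h < s" "s \<le> real (Suc j) * h" by (rule grid_index[OF s(1) h])
    have "real j * h < real N * h" using j N s by simp
    then have "j < N" using h by simp
    then have "?S s = H (real j * h) \<omega>" by (rule simple_process_grid[OF h j])
    then have "\<bar>?S s - H s \<omega>\<bar> = \<bar>\<Sum>i\<in>I. d i * (of_bool (real j * h < \<sigma> i) - of_bool (s < \<sigma> i))\<bar>"
      using \<sigma> j s h by (simp add: H_def right_diff_distrib sum_subtractf)
    also have "\<dots> \<le> (\<Sum>i\<in>I. \<bar>d i * (of_bool (real j * h < \<sigma> i) - of_bool (s < \<sigma> i))\<bar>)"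
      by (rule sum_abs)
    also have "\<dots> \<le> (\<Sum>i\<in>I. \<bar>d i\<bar> * indicator {\<sigma> i..\<sigma> i + h} s)"
      unfolding abs_mult using j
      by (intro sum_mono mult_left_mono step_difference_bound) (auto simp: algebra_simps)
    finally have 1: "\<bar>?S s - H s \<omega>\<bar> \<le> (\<Sum>i\<in>I. \<bar>d i\<bar> * indicator {\<sigma> i..\<sigma> i + h} s)" .
    have 2: "(\<Sum>i\<in>I. \<bar>d i\<bar> * indicator {\<sigma> i..\<sigma> i + h} s) \<le> C"
      by (intro sum_mono) (auto simp: indicator_def)
    \<comment> \<open>One factor is bounded by the constant \<open>C\<close>, the other by the
      indicators, so the integral of the square is linear in \<open>h\<close>.\<close>
    have "(?S s - H s \<omega>)\<^sup>2 = \<bar>?S s - H s \<omega>\<bar> * \<bar>?S s - H s \<omega>\<bar>" by (simp add: power2_eq_square)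
    also have "\<dots> \<le> C * (\<Sum>i\<in>I. \<bar>d i\<bar> * indicator {\<sigma> i..\<sigma> i + h} s)"
      using 1 2 C by (intro mult_mono) auto
    finally show ?thesis by (simp add: sum_distrib_left mult.assoc)
  qed
  have "(\<integral>\<^sup>+s\<in>{0..t}. ennreal ((?S s - H s \<omega>)\<^sup>2) \<partial>lborel)
      \<le> (\<integral>\<^sup>+s. (\<Sum>i\<in>I. ennreal (C * \<bar>d i\<bar>) * indicator {\<sigma> i..\<sigma> i + h} s) \<partial>lborel)"
  proof (rule nn_integral_mono_AE)
    \<comment> \<open>Time 0 belongs to no left-open cell, so the simple process vanishes there; a
      single point does not affect the integral.\<close>
    have "AE s in lborel. s \<noteq> (0::real)" by (rule AE_lborel_singleton)
    then show "AE s in lborel. ennreal ((?S s - H s \<omega>)\<^sup>2) * indicator {0..t} s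
        \<le> (\<Sum>i\<in>I. ennreal (C * \<bar>d i\<bar>) * indicator {\<sigma> i..\<sigma> i + h} s)"
    proof eventually_elim
      case (elim s)
      show ?case
      proof (cases "s \<in> {0..t}")
        case True
        have "ennreal ((?S s - H s \<omega>)\<^sup>2) \<le> ennreal (\<Sum>i\<in>I. C * \<bar>d i\<bar> * indicator {\<sigma> i..\<sigma> i + h} s)"
          by (rule ennreal_leI, rule ptw) (use True elim in auto)
        also have "\<dots> = (\<Sum>i\<in>I. ennreal (C * \<bar>d i\<bar> * indicator {\<sigma> i..\<sigma> i + h} s))"
          by (rule sum_ennreal[symmetric]) (use C in auto)
        also have "\<dots> = (\<Sum>i\<in>I. ennreal (C * \<bar>d i\<bar>) * indicator {\<sigma> i..\<sigma> i + h} s)"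
          by (rule sum.cong) (auto split: split_indicator)
        finally show ?thesis using True by simp
      qed simp
    qed
  qed
  also have "\<dots> = (\<Sum>i\<in>I. ennreal (C * \<bar>d i\<bar>) * ennreal h)"
    by (subst nn_integral_sum) (use h in \<open>auto simp: nn_integral_cmult_indicator\<close>)
  also have "\<dots> = ennreal (\<Sum>i\<in>I. C * \<bar>d i\<bar> * h)"
    using C h by (subst sum_ennreal[symmetric]) (auto simp: ennreal_mult less_imp_le)
  also have "(\<Sum>i\<in>I. C * \<bar>d i\<bar> * h) = C\<^sup>2 * h"
    by (simp add: power2_eq_square sum_distrib_left sum_distrib_right)
  finally show ?thesis .
qed

theorem is_ito_integral_J:
  assumes H': "AE \<omega> in M. \<forall>s\<ge>0. H' s \<omega> = H s \<omega>"
  shows "is_ito_integral M F W H' (\<lambda>t \<omega>. J t \<omega> - J 0 \<omega>)"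
proof -
  \<comment> \<open>One sequence of simple processes must serve every \<open>t\<close>: mesh
    \<open>1 / (k+1)\<close> with \<open>(k+1)\<^sup>2\<close> cells covers the interval up to
    \<open>k+1\<close>, so it refines and grows at once.\<close>
  define h where "h k = 1 / real (Suc k)" for k :: nat
  define N where "N k = Suc k * Suc k" for k :: nat
  have h: "0 < h k" for k by (simp add: h_def)
  have h0: "h \<longlonglongrightarrow> 0"
    unfolding h_def using LIMSEQ_inverse_real_of_nat by (simp add: inverse_eq_divide)
  have Nh: "real (N k) * h k = real (Suc k)" for k
    unfolding N_def h_def of_nat_mult by (simp del: of_nat_Suc)
  have ev: "\<forall>\<^sub>F k in sequentially. t \<le> real (N k) * h k" for t
    unfolding Nh using eventually_ge_at_top[of "nat \<lceil>t\<rceil>"] by eventually_elim linarith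
  have JM[measurable]: "J t \<in> borel_measurable M" if "0 \<le> t" for t by (rule F_meas_M[OF J_measurable[OF that]])
  have HF: "H (real j * h k) \<in> borel_measurable (F (real j * h k))" for j k
    using h[of k] by (intro H_measurable) (auto simp: less_imp_le)
  have "\<forall>k. simple_data M F (N k) (\<lambda>j. real j * h k) (\<lambda>j. H (real j * h k))"
  proof
    fix k
    show "simple_data M F (N k) (\<lambda>j. real j * h k) (\<lambda>j. H (real j * h k))"
      unfolding simple_data_def
    proof (intro conjI allI impI)
      fix i show "real i * h k \<le> real (Suc i) * h k" using h[of k] by (intro mult_right_mono) auto
    next
      fix i show "\<exists>B. \<forall>\<omega>\<in>space M. \<bar>H (real i * h k) \<omega>\<bar> \<le> B" using H_bound by blast
    qed (use HF in auto)
  qed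
  moreover have "(\<lambda>k. measure M {\<omega> \<in> space M.
       (\<integral>\<^sup>+s\<in>{0..t}. ennreal ((simple_process (N k) (\<lambda>j. real j * h k) (\<lambda>j. H (real j * h k)) s \<omega> - H s \<omega>)\<^sup>2) \<partial>lborel)
         > ennreal e}) \<longlonglongrightarrow> 0" if t: "0 \<le> t" and e: "0 < e" for t e
  proof (rule tendsto_eventually)
    have "(\<lambda>k. C\<^sup>2 * h k) \<longlonglongrightarrow> C\<^sup>2 * 0" by (intro tendsto_intros h0)
    then have "\<forall>\<^sub>F k in sequentially. C\<^sup>2 * h k < e" using e by (auto dest: order_tendstoD)
    with ev[of t] show "\<forall>\<^sub>F k in sequentially. measure M {\<omega> \<in> space M.
       (\<integral>\<^sup>+s\<in>{0..t}. ennreal ((simple_process (N k) (\<lambda>j. real j * h k) (\<lambda>j. H (real j * h k)) s \<omega> - H s \<omega>)\<^sup>2) \<partial>lborel)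
         > ennreal e} = 0"
    proof eventually_elim
      case (elim k)
      have "(\<integral>\<^sup>+s\<in>{0..t}. ennreal ((simple_process (N k) (\<lambda>j. real j * h k) (\<lambda>j. H (real j * h k)) s \<omega> - H s \<omega>)\<^sup>2) \<partial>lborel)
         \<le> ennreal e" if "\<omega> \<in> space M" for \<omega>
        using simple_process_approximation[OF that h elim(1) t] ennreal_leI[OF less_imp_le[OF elim(2)]]
        by (rule order_trans)
      then have "{\<omega> \<in> space M.
       (\<integral>\<^sup>+s\<in>{0..t}. ennreal ((simple_process (N k) (\<lambda>j. real j * h k) (\<lambda>j. H (real j * h k)) s \<omega> - H s \<omega>)\<^sup>2) \<partial>lborel)
         > ennreal e} = {}" by (auto simp: not_less)
      then show ?case by (metis measure_empty)
    qed
  qed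
  moreover have "(\<lambda>k. measure M {\<omega> \<in> space M.
       \<bar>simple_integral W (N k) (\<lambda>j. real j * h k) (\<lambda>j. H (real j * h k)) t \<omega> - (J t \<omega> - J 0 \<omega>)\<bar> > e}) \<longlonglongrightarrow> 0"
    if t: "0 \<le> t" and e: "0 < e" for t e
  proof (rule pointwise_imp_in_probability[OF _ _ _ e])
    show "simple_integral W (N k) (\<lambda>j. real j * h k) (\<lambda>j. H (real j * h k)) t \<in> borel_measurable M" for k
      unfolding simple_integral_def[abs_def]
      using t h[of k] by (intro borel_measurable_sum borel_measurable_times borel_measurable_diff
          F_meas_M[OF HF] W_meas) (auto simp: less_imp_le)
    show "(\<lambda>\<omega>. J t \<omega> - J 0 \<omega>) \<in> borel_measurable M" using JM[OF t] JM[of 0] by simp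
    show "(\<lambda>k. simple_integral W (N k) (\<lambda>j. real j * h k) (\<lambda>j. H (real j * h k)) t \<omega>) \<longlonglongrightarrow> J t \<omega> - J 0 \<omega>"
      if "\<omega> \<in> space M" for \<omega>
      unfolding simple_integral_def
      using grid_sum_H[OF that order_refl t less_imp_le[OF h] h0, of N] ev[of t] by simp
  qed
  ultimately show ?thesis
    unfolding is_ito_integral_def
    using H' H_progressive JM J_continuous
    by (intro conjI exI[of _ H] exI[of _ N] exI[of _ "\<lambda>k j. real j * h k"] exI[of _ "\<lambda>k j. H (real j * h k)"])
      (auto intro!: continuous_intros)
qed

end


section \<open>Conditional laws of the stopped value\<close>

lemma eq_of_right_continuous:
  fixes f g :: "real \<Rightarrow> real"
  assumes f: "\<And>t. 0 \<le> t \<Longrightarrow> continuous (at_right t) f" and g: "continuous_on {0..} g"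
    and eq: "\<And>q. q \<in> \<rat> \<Longrightarrow> 0 \<le> q \<Longrightarrow> f q = g q" and t: "0 \<le> t"
  shows "f t = g t"
proof -
  obtain r :: "nat \<Rightarrow> real" where r: "\<And>k. r k \<in> \<rat>" "\<And>k. t < r k" "r \<longlonglongrightarrow> t"
    using rational_sequence_from_right[of t] by blast
  have "filterlim r (at_right t) sequentially"
    unfolding filterlim_at using r by (auto intro: always_eventually)
  moreover have "(f \<longlongrightarrow> f t) (at_right t)" using f[OF t] by (simp add: continuous_within)
  ultimately have "(\<lambda>k. f (r k)) \<longlonglongrightarrow> f t" by (rule filterlim_compose[rotated])
  moreover have "(\<lambda>k. g (r k)) \<longlonglongrightarrow> g t"
    by (rule continuous_on_tendsto_compose[OF g r(3)])
      (use t r(2) in \<open>auto intro!: always_eventually intro: less_imp_le order.strict_trans1\<close>)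
  moreover have "f (r k) = g (r k)" for k
    using eq[OF r(1)[of k]] t r(2)[of k] by simp
  ultimately show ?thesis by (simp add: LIMSEQ_unique)
qed

lemma continuous_on_imp_at_right:
  fixes g :: "real \<Rightarrow> real"
  assumes "continuous_on {0..} g" "0 \<le> t"
  shows "continuous (at_right t) g"
proof -
  have "continuous (at t within {0..}) g" using assms by (simp add: continuous_on_eq_continuous_within)
  then show ?thesis by (rule continuous_within_subset) (use assms(2) in auto)
qed

text \<open>Regroups increments over stages by stopped values: at level \<open>i\<close> stage
  \<open>i - 1\<close> ends and stage \<open>i\<close> begins, with no stage before level 0 or after
  level \<open>n\<close>.\<close>

lemma sum_by_parts:
  fixes k f :: "nat \<Rightarrow> real"
  shows "(\<Sum>i\<le>n. ((if 0 < i then k (i - 1) else 0) - (if i < n then k i else 0)) * f i)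
    = (\<Sum>i<n. k i * (f (Suc i) - f i))"
proof -
  have "(\<Sum>i\<le>n. (if 0 < i then k (i - 1) else 0) * f i) = (\<Sum>i<n. k i * f (Suc i))"
    by (subst sum.atMost_shift) simp
  moreover have "(\<Sum>i\<le>n. (if i < n then k i else 0) * f i) = (\<Sum>i<n. k i * f i)"
    by (rule sum.mono_neutral_cong_right) auto
  ultimately show ?thesis
    by (simp add: left_diff_distrib right_diff_distrib sum_subtractf)
qed

text \<open>Each \<open>slope i\<close> is a multiple of the difference of two probability vectors,
  so it sums to 0. Total mass 1 therefore holds along every \<open>w\<close>, whereas nonnegativity
  is proved only for good paths.\<close>

lemma (in atom_seq) state_sum: "(\<Sum>j\<le>n. state w t j) = 1"
proof -
  have "(\<Sum>j\<le>n. slope i j) = 0" if "i < n" for i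
    using cond_weight_sum[of "Suc i"] that by (simp add: slope_def sum_subtractf flip: sum_divide_distrib)
  then have "(\<Sum>j\<le>n. \<Sum>i<n. slope i j * c i) = 0" for c :: "nat \<Rightarrow> real"
    by (subst sum.swap) (simp flip: sum_distrib_right)
  then show ?thesis using m_sum by (simp add: state_def sum.distrib)
qed

definition atom_law :: "nat \<Rightarrow> (nat \<Rightarrow> real) \<Rightarrow> (nat \<Rightarrow> real) \<Rightarrow> real measure" where
  "atom_law n x v = distr (point_measure {..n} (\<lambda>j. ennreal (v j))) borel x"

lemma atom_law:
  assumes "\<And>j. j \<le> n \<Longrightarrow> 0 \<le> v j" "(\<Sum>j\<le>n. v j) = 1"
  shows "sets (atom_law n x v) = sets borel" "prob_space (atom_law n x v)"
    and "E \<in> sets borel \<Longrightarrow> emeasure (atom_law n x v) E = ennreal (\<Sum>j\<le>n. v j * indicat_real E (x j))"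
    and "E \<in> sets borel \<Longrightarrow> measure (atom_law n x v) E = (\<Sum>j\<le>n. v j * indicat_real E (x j))"
proof -
  show s: "sets (atom_law n x v) = sets borel" by (simp add: atom_law_def)
  have em: "emeasure (atom_law n x v) E = ennreal (\<Sum>j\<le>n. v j * indicat_real E (x j))" if "E \<in> sets borel" for E
  proof -
    have "emeasure (atom_law n x v) E = emeasure (point_measure {..n} (\<lambda>j. ennreal (v j))) (x -` E \<inter> {..n})"
      unfolding atom_law_def using that
      by (subst emeasure_distr) (auto simp: space_point_measure measurable_point_measure_eq1)
    also have "\<dots> = (\<Sum>j\<in>x -` E \<inter> {..n}. ennreal (v j))"
      by (rule emeasure_point_measure_finite) auto
    also have "\<dots> = ennreal (\<Sum>j\<in>x -` E \<inter> {..n}. v j)"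
      by (rule sum_ennreal) (use assms in auto)
    also have "(\<Sum>j\<in>x -` E \<inter> {..n}. v j) = (\<Sum>j\<le>n. v j * indicat_real E (x j))"
      by (rule sum.mono_neutral_cong_left) (auto simp: indicator_def)
    finally show ?thesis .
  qed
  then show "E \<in> sets borel \<Longrightarrow> emeasure (atom_law n x v) E = ennreal (\<Sum>j\<le>n. v j * indicat_real E (x j))" .
  have "space (atom_law n x v) = UNIV" by (simp add: atom_law_def)
  then show "prob_space (atom_law n x v)"
    using em[of UNIV] assms(2) by (intro prob_spaceI) simp
  show "measure (atom_law n x v) E = (\<Sum>j\<le>n. v j * indicat_real E (x j))" if "E \<in> sets borel"
    unfolding measure_def em[OF that] by (rule enn2real_ennreal) (use assms(1) in \<open>auto intro: sum_nonneg\<close>)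
qed

section \<open>The conditional mass of a Borel set as a process\<close>

locale azema_yor = wiener M W F + atom_seq n x m
  for M :: "'a measure" and W F n x m +
  fixes \<mu> :: "real measure"
  assumes law_mu: "finite_law \<mu> {..n} x m"
begin

abbreviation path :: "'a \<Rightarrow> real \<Rightarrow> real" where "path \<omega> \<equiv> (\<lambda>s. W s \<omega>)"

definition gap_process :: "nat \<Rightarrow> real \<Rightarrow> 'a \<Rightarrow> real" where
  "gap_process i s \<omega> = path_gap (path \<omega>) i s"

lemma gap_process_path: "(\<lambda>s. gap_process i s \<omega>) = path_gap (path \<omega>) i"
  by (simp add: gap_process_def)

lemma continuous_adapted_gap: "continuous_adapted (gap_process i)"
  unfolding continuous_adapted_def
proof (intro conjI allI impI ballI)
  fix t :: real assume t: "0 \<le> t"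
  have [measurable]: "(\<lambda>\<omega>. runsup (path \<omega>) t) \<in> borel_measurable (F t)" "W t \<in> borel_measurable (F t)"
    using continuous_adaptedD(1)[OF continuous_adapted_runsup[OF continuous_adapted_W] t order_refl]
      W_adapted[OF t order_refl] by auto
  have [measurable]: "(\<lambda>\<omega>. lower_gap i (runsup (path \<omega>) t) (W t \<omega>)) \<in> borel_measurable (F t)"
    by (induction i) auto
  show "gap_process i t \<in> borel_measurable (F t)"
    unfolding gap_process_def[abs_def] path_gap_def gap_def by measurable
next
  fix \<omega> assume "\<omega> \<in> space M"
  then show "continuous_on {0..} (\<lambda>t. gap_process i t \<omega>)"
    unfolding gap_process_path by (rule continuous_on_path_gap[OF W_cont])
qed

definition set_slope :: "real set \<Rightarrow> nat \<Rightarrow> real" where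
  "set_slope E i = (\<Sum>j\<le>n. slope i j * indicat_real E (x j))"

definition coeff :: "real set \<Rightarrow> nat \<Rightarrow> real" where
  "coeff E i = (if 0 < i then set_slope E (i - 1) else 0) - (if i < n then set_slope E i else 0)"

sublocale step: step_integrand M W F "{..n}" "coeff E" gap_process for E
  by unfold_locales (auto intro: continuous_adapted_gap)

definition mass :: "real set \<Rightarrow> real \<Rightarrow> 'a \<Rightarrow> real" where
  "mass E t \<omega> = (\<Sum>j\<le>n. state (path \<omega>) t j * indicat_real E (x j))"

lemma coeff_sum: "(\<Sum>i\<le>n. coeff E i * f i) = (\<Sum>i<n. set_slope E i * (f (Suc i) - f i))"
  unfolding coeff_def by (rule sum_by_parts)

lemma mass_eq:
  assumes "E \<in> sets borel"
  shows "mass E t \<omega> = measure \<mu> E + step.J E t \<omega>"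
proof -
  interpret mu: finite_law \<mu> "{..n}" x m by (rule law_mu)
  let ?D = "\<lambda>i. W (stop_at (path_gap (path \<omega>) (Suc i)) t) \<omega> - W (stop_at (path_gap (path \<omega>) i) t) \<omega>"
  have "step.J E t \<omega> = (\<Sum>i<n. set_slope E i * ?D i)"
    unfolding step.J_def gap_process_path by (rule coeff_sum)
  also have "\<dots> = (\<Sum>j\<le>n. (\<Sum>i<n. slope i j * ?D i) * indicat_real E (x j))"
    unfolding set_slope_def sum_distrib_right by (subst sum.swap) (simp add: ac_simps)
  finally show ?thesis
    unfolding mass_def state_def by (simp add: mu.law[OF assms] distrib_right sum.distrib)
qed

text \<open>Each difference of predicates is the indicator of one stage, so along a good path the
  integrand is the slope of the current stage and 0 after stopping.\<close>

lemma H_eq: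
  "step.H E s \<omega> = (\<Sum>i<n. set_slope E i *
     (of_bool (before_hit (path_gap (path \<omega>) (Suc i)) s) - of_bool (before_hit (path_gap (path \<omega>) i) s)))"
  unfolding step.H_def gap_process_path by (rule coeff_sum)

text \<open>Summation by parts against a constant shows that the coefficients add up to 0, so the
  initial value of W drops out.\<close>

lemma J_0: "\<omega> \<in> space M \<Longrightarrow> step.J E 0 \<omega> = 0"
  using step.J_start[of \<omega> E] coeff_sum[of E "\<lambda>_. 1"] by simp

definition good :: "'a \<Rightarrow> bool" where
  "good \<omega> \<longleftrightarrow> \<omega> \<in> space M \<and> W 0 \<omega> = 0 \<and> (\<exists>t\<ge>0. 0 \<le> path_gap (path \<omega>) n t)"

text \<open>At the integer time supplied by unboundedness the path is at most \<open>x 0\<close> or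
  at least \<open>x n\<close>. The first triggers a stop because the maximum is at least
  \<open>bary 0 = 0\<close> (for \<open>n = 0\<close> this already is the last level); the second
  does because \<open>bary n = x n\<close>.\<close>

lemma AE_good: "AE \<omega> in M. good \<omega>"
  using AE_unbounded[of "\<bar>x 0\<bar> + \<bar>x n\<bar>"] W_start AE_space
proof eventually_elim
  case (elim \<omega>)
  obtain k :: nat where k: "\<bar>x 0\<bar> + \<bar>x n\<bar> < \<bar>W (real k) \<omega>\<bar>" using elim by auto
  have "0 \<le> path_gap (path \<omega>) n (real k)"
  proof (cases "W (real k) \<omega> < 0")
    case True
    then have "W (real k) \<omega> \<le> x 0" using k by linarith
    moreover have "bary 0 \<le> runsup (path \<omega>) (real k)"
      using runsup_ge[OF W_cont[OF elim(3)], of 0 "real k"] elim(2) by (simp add: bary_0)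
    ultimately show ?thesis unfolding path_gap_def gap_nonneg_iff by (metis gr0I)
  next
    case False
    then have "x n \<le> W (real k) \<omega>" using k by linarith
    then have "bary n \<le> runsup (path \<omega>) (real k)"
      using runsup_ge[OF W_cont[OF elim(3)], of "real k" "real k"] by (simp add: bary_last)
    then show ?thesis by (simp add: path_gap_def gap_nonneg_iff)
  qed
  then show ?case using elim unfolding good_def by (intro conjI exI[of _ "real k"]) auto
qed

section \<open>The stopped value as terminal value of the mass martingale\<close>

abbreviation X :: "'a \<Rightarrow> real" where "X \<equiv> stopped_value W (azema_yor_time \<mu> W)"

text \<open>By \<open>barycentre_le_iff_gap\<close> the discontinuous rule is the hitting time of a
  continuous function, so its infimum is attained when finite; otherwise it is the infimum of the
  empty set, \<open>top\<close>.\<close>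

lemma azema_yor_time_eq:
  assumes \<omega>: "\<omega> \<in> space M"
  shows "azema_yor_time \<mu> W \<omega> = (if \<exists>t\<ge>0. 0 \<le> path_gap (path \<omega>) n t
    then ennreal (hit_time (path_gap (path \<omega>) n)) else top)"
proof -
  note g = continuous_on_path_gap[OF W_cont[OF \<omega>], of n]
  have "running_max W t \<omega> \<ge> barycentre \<mu> (W t \<omega>) \<longleftrightarrow> 0 \<le> path_gap (path \<omega>) n t" if "0 \<le> t" for t
    using barycentre_le_iff_gap[OF law_mu runsup_ge[OF W_cont[OF \<omega>] that order_refl]]
    by (simp add: running_max_def runsup_def path_gap_def)
  then have T: "azema_yor_time \<mu> W \<omega> = Inf {ennreal t | t. 0 \<le> t \<and> 0 \<le> path_gap (path \<omega>) n t}"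
    unfolding azema_yor_time_def by (intro arg_cong[where f=Inf]) auto
  show ?thesis
  proof (cases "\<exists>t\<ge>0. 0 \<le> path_gap (path \<omega>) n t")
    case True
    then obtain t0 where t0: "0 \<le> t0" "0 \<le> path_gap (path \<omega>) n t0" by auto
    note hit = hit_time_attained[OF g]
    have "Inf {ennreal t | t. 0 \<le> t \<and> 0 \<le> path_gap (path \<omega>) n t} = ennreal (hit_time (path_gap (path \<omega>) n))"
    proof (rule antisym)
      show "Inf {ennreal t | t. 0 \<le> t \<and> 0 \<le> path_gap (path \<omega>) n t} \<le> ennreal (hit_time (path_gap (path \<omega>) n))"
        by (rule Inf_lower) (use hit[OF t0] in auto)
      show "ennreal (hit_time (path_gap (path \<omega>) n)) \<le> Inf {ennreal t | t. 0 \<le> t \<and> 0 \<le> path_gap (path \<omega>) n t}"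
        by (rule Inf_greatest) (use hit(3) in \<open>auto intro: ennreal_leI\<close>)
    qed
    then show ?thesis using True T by simp
  next
    case False
    then have "{ennreal t | t. 0 \<le> t \<and> 0 \<le> path_gap (path \<omega>) n t} = {}" by auto
    then show ?thesis unfolding T if_not_P[OF False] by (simp only: Inf_empty)
  qed
qed

lemma X_good: "good \<omega> \<Longrightarrow> X \<omega> = W (hit_time (path_gap (path \<omega>) n)) \<omega>"
  using hit_time_attained(1)[OF continuous_on_path_gap[OF W_cont[of \<omega>], of n]]
  by (auto simp: good_def stopped_value_def azema_yor_time_eq)

lemma X_measurable[measurable]: "X \<in> borel_measurable M"
proof (rule borel_measurable_LIMSEQ_real)
  \<comment> \<open>Measurability is needed on all of \<open>space M\<close>, including paths that
    never stop, where \<open>enn2real top = 0\<close> makes \<open>X\<close> equal to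
    \<open>W 0\<close>. The approximants carry this dummy value until the stop has occurred.\<close>
  let ?X = "\<lambda>k \<omega>. of_bool (before_hit (\<lambda>s. gap_process n s \<omega>) (real k)) * W 0 \<omega>
     + (1 - of_bool (before_hit (\<lambda>s. gap_process n s \<omega>) (real k))) * W (stop_at (\<lambda>s. gap_process n s \<omega>) (real k)) \<omega>"
  show "?X k \<in> borel_measurable M" for k
  proof -
    have [measurable]: "(\<lambda>\<omega>. of_bool (before_hit (\<lambda>s. gap_process n s \<omega>) (real k)) :: real) \<in> borel_measurable M"
      "(\<lambda>\<omega>. W (stop_at (\<lambda>s. gap_process n s \<omega>) (real k)) \<omega>) \<in> borel_measurable M"
      using F_meas_M[OF before_hit_borel[OF continuous_adapted_gap]]
        F_meas_M[OF continuous_adaptedD(1)[OF continuous_adapted_stopped[OF continuous_adapted_W continuous_adapted_gap]]]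
      by (metis of_nat_0_le_iff order_refl)+
    show ?thesis by measurable
  qed
  fix \<omega> assume \<omega>: "\<omega> \<in> space M"
  note g = continuous_on_path_gap[OF W_cont[OF \<omega>], of n]
  show "(\<lambda>k. ?X k \<omega>) \<longlonglongrightarrow> X \<omega>"
  proof (cases "\<exists>t\<ge>0. 0 \<le> path_gap (path \<omega>) n t")
    case True
    then obtain t0 where t0: "0 \<le> t0" "0 \<le> path_gap (path \<omega>) n t0" by auto
    let ?\<sigma> = "hit_time (path_gap (path \<omega>) n)"
    have "X \<omega> = W ?\<sigma> \<omega>"
      using True hit_time_attained(1)[OF g t0] by (simp add: stopped_value_def azema_yor_time_eq[OF \<omega>])
    moreover have "\<forall>\<^sub>F k in sequentially. ?X k \<omega> = W ?\<sigma> \<omega>"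
      using eventually_ge_at_top[of "nat \<lceil>?\<sigma>\<rceil>"]
    proof eventually_elim
      case (elim k)
      then have "?\<sigma> \<le> real k" by linarith
      then show ?case
        using before_hit_iff[OF g t0, of "real k"] stop_at_eq[OF g t0, of "real k"]
        by (simp add: gap_process_path)
    qed
    ultimately show ?thesis by (simp add: tendsto_eventually)
  next
    case False
    then have "before_hit (path_gap (path \<omega>) n) t" for t unfolding before_hit_def by (meson atLeastAtMost_iff not_le)
    then have "?X k \<omega> = W 0 \<omega>" for k by (simp add: gap_process_path)
    moreover have "azema_yor_time \<mu> W \<omega> = top"
      unfolding azema_yor_time_eq[OF \<omega>] by (rule if_not_P[OF False])
    then have "X \<omega> = W 0 \<omega>" by (simp add: stopped_value_def)
    ultimately show ?thesis by simp
  qed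
qed

lemma state_good:
  assumes "good \<omega>" "0 \<le> t"
  shows "j \<le> n \<Longrightarrow> 0 \<le> state (path \<omega>) t j"
    and "hit_time (path_gap (path \<omega>) n) \<le> t \<Longrightarrow> mass E t \<omega> = indicat_real E (X \<omega>)"
proof -
  have \<omega>: "\<omega> \<in> space M" and pre: "continuous_on {0..} (path \<omega>)" "W 0 \<omega> = 0" "\<exists>t\<ge>0. 0 \<le> path_gap (path \<omega>) n t"
    using assms(1) W_cont by (auto simp: good_def)
  show "0 \<le> state (path \<omega>) t j" if "j \<le> n"
  proof (cases "t < hit_time (path_gap (path \<omega>) n)")
    case True
    then show ?thesis
      by (rule state_before[OF pre assms(2)]) (use cond_weight_nonneg that in auto)
  next
    case False
    then have "hit_time (path_gap (path \<omega>) n) \<le> t" by simp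
    then show ?thesis by (rule state_after[OF pre]) (use that in auto)
  qed
  show "mass E t \<omega> = indicat_real E (X \<omega>)" if after: "hit_time (path_gap (path \<omega>) n) \<le> t"
  proof (rule state_after[OF pre after])
    fix i assume i: "i \<le> n" "W (hit_time (path_gap (path \<omega>) n)) \<omega> = x i"
      "\<And>j. j \<le> n \<Longrightarrow> state (path \<omega>) t j = of_bool (i = j)"
    have "mass E t \<omega> = (\<Sum>j\<le>n. if j = i then indicat_real E (x j) else 0)"
      unfolding mass_def by (rule sum.cong) (auto simp: i(3))
    also have "\<dots> = indicat_real E (x i)" using i(1) by simp
    finally show ?thesis using X_good[OF assms(1)] i(2) by simp
  qed
qed

lemma mass_bounds:
  assumes "good \<omega>" "0 \<le> t"
  shows "0 \<le> mass E t \<omega>" "mass E t \<omega> \<le> 1"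
proof -
  show "0 \<le> mass E t \<omega>"
    unfolding mass_def using state_good(1)[OF assms] by (intro sum_nonneg) auto
  have "mass E t \<omega> \<le> (\<Sum>j\<le>n. state (path \<omega>) t j)"
    unfolding mass_def using state_good(1)[OF assms] by (intro sum_mono) (auto simp: indicator_def)
  then show "mass E t \<omega> \<le> 1" by (simp add: state_sum)
qed

lemma mass_measurable: "E \<in> sets borel \<Longrightarrow> 0 \<le> t \<Longrightarrow> mass E t \<in> borel_measurable (F t)"
  using step.J_measurable[of t E] by (simp add: mass_eq cong: measurable_cong)

lemma mass_continuous:
  "E \<in> sets borel \<Longrightarrow> \<omega> \<in> space M \<Longrightarrow> continuous_on {0..} (\<lambda>t. mass E t \<omega>)"
  using step.J_continuous[of \<omega> E] by (auto simp: mass_eq intro!: continuous_intros)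

lemma mass_martingale:
  assumes E: "E \<in> sets borel" and a: "0 \<le> a" and A: "A \<in> sets (F a)"
  shows "expectation (\<lambda>\<omega>. indicator A \<omega> * mass E a \<omega>) = expectation (\<lambda>\<omega>. indicator A \<omega> * indicat_real E (X \<omega>))"
proof -
  have [measurable]: "A \<in> sets M" using A F_sub by blast
  have massM[measurable]: "mass E t \<in> borel_measurable M" if "0 \<le> t" for t
    by (rule F_meas_M[OF mass_measurable[OF E that]])
  have JM: "step.J E t \<in> borel_measurable M" if "0 \<le> t" for t
    by (rule F_meas_M[OF step.J_measurable[OF that]])
  interpret mu: finite_law \<mu> "{..n}" x m by (rule law_mu)
  \<comment> \<open>\<open>J\<close> is the difference of two numbers in [0,1], the conditional and
    the initial mass.\<close>
  have J_bound: "AE \<omega> in M. \<bar>step.J E t \<omega>\<bar> \<le> 1" if "0 \<le> t" for t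
    using AE_good
  proof eventually_elim
    case (elim \<omega>)
    then show ?case
      using mass_bounds[OF elim that, of E] mu.prob_le_1[of E] measure_nonneg[of \<mu> E]
      unfolding mass_eq[OF E] by linarith
  qed
  have int: "integrable M (\<lambda>\<omega>. indicator A \<omega> * step.J E t \<omega>)" if "0 \<le> t" for t
  proof (rule integrable_const_bound[where B=1])
    show "AE \<omega> in M. norm (indicator A \<omega> * step.J E t \<omega>) \<le> 1"
      using J_bound[OF that] by eventually_elim (auto simp: indicator_def)
  qed (use JM[OF that] in measurable)
  have const: "expectation (\<lambda>\<omega>. indicator A \<omega> * mass E t \<omega>) = expectation (\<lambda>\<omega>. indicator A \<omega> * mass E a \<omega>)"
    if "a \<le> t" for t
  proof -
    have "integrable M (\<lambda>\<omega>. indicat_real A \<omega> * measure \<mu> E)"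
      by (intro integrable_mult_left integrable_real_indicator) (auto simp: emeasure_eq_measure)
    then show ?thesis
      using step.J_martingale[OF a that A J_bound] int[OF a] int[OF order_trans[OF a that]]
      by (simp add: mass_eq[OF E] distrib_left)
  qed
  have "(\<lambda>k. expectation (\<lambda>\<omega>. indicator A \<omega> * mass E (a + real k) \<omega>))
      \<longlonglongrightarrow> expectation (\<lambda>\<omega>. indicator A \<omega> * indicat_real E (X \<omega>))"
  proof (rule integral_dominated_convergence[where w="\<lambda>_. 1"])
    show "(\<lambda>\<omega>. indicator A \<omega> * indicat_real E (X \<omega>)) \<in> borel_measurable M" using E by measurable
    show "(\<lambda>\<omega>. indicator A \<omega> * mass E (a + real k) \<omega>) \<in> borel_measurable M" for k
      by (intro borel_measurable_times borel_measurable_indicator massM) (use a in auto)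
    show "AE \<omega> in M. norm (indicator A \<omega> * mass E (a + real k) \<omega>) \<le> 1" for k
      using AE_good
      by eventually_elim (use mass_bounds[of _ "a + real k" E] a in \<open>auto simp: indicator_def\<close>)
    show "AE \<omega> in M. (\<lambda>k. indicator A \<omega> * mass E (a + real k) \<omega>) \<longlonglongrightarrow> indicator A \<omega> * indicat_real E (X \<omega>)"
      using AE_good
    proof eventually_elim
      case (elim \<omega>)
      have "\<forall>\<^sub>F k in sequentially. mass E (a + real k) \<omega> = indicat_real E (X \<omega>)"
        using eventually_ge_at_top[of "nat \<lceil>hit_time (path_gap (path \<omega>) n)\<rceil>"]
      proof eventually_elim
        case (elim k)
        then have "hit_time (path_gap (path \<omega>) n) \<le> a + real k" using a by linarith
        then show ?case using state_good(2)[OF \<open>good \<omega>\<close>, of "a + real k" E] a by simp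
      qed
      then have "(\<lambda>k. mass E (a + real k) \<omega>) \<longlonglongrightarrow> indicat_real E (X \<omega>)" by (rule tendsto_eventually)
      then show ?case by (intro tendsto_intros)
    qed
  qed simp
  moreover have "expectation (\<lambda>\<omega>. indicator A \<omega> * mass E (a + real k) \<omega>) = expectation (\<lambda>\<omega>. indicator A \<omega> * mass E a \<omega>)" for k
    by (rule const) simp
  ultimately show ?thesis by (simp add: LIMSEQ_const_iff)
qed

lemma mass_cond_exp:
  assumes E: "E \<in> sets borel" and t: "0 \<le> t"
  shows "AE \<omega> in M. real_cond_exp M (F t) (\<lambda>\<omega>. indicat_real E (X \<omega>)) \<omega> = mass E t \<omega>"
proof -
  interpret sigma_finite_subalgebra M "F t" by (rule sigma_finite_F)
  show ?thesis
  proof (rule real_cond_exp_charact)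
    fix A assume "A \<in> sets (F t)"
    then show "(\<integral>\<omega>\<in>A. indicat_real E (X \<omega>) \<partial>M) = (\<integral>\<omega>\<in>A. mass E t \<omega> \<partial>M)"
      using mass_martingale[OF E t] by (simp add: set_lebesgue_integral_def)
  next
    show "integrable M (\<lambda>\<omega>. indicat_real E (X \<omega>))"
      by (rule integrable_const_bound[where B=1]) (use E in \<open>auto simp: indicator_def\<close>)
    show "integrable M (mass E t)"
    proof (rule integrable_const_bound[where B=1])
      show "AE \<omega> in M. norm (mass E t \<omega>) \<le> 1"
        using AE_good by eventually_elim (use mass_bounds[OF _ t, of _ E] in auto)
    qed (rule F_meas_M[OF mass_measurable[OF E t]])
  qed (rule mass_measurable[OF E t])
qed

section \<open>An explicit version of the conditional law\<close>

text \<open>The second branch only matters on the null set where \<open>W 0 \<noteq> 0\<close> or \<open>T\<close> is infinite; it makes the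
  explicit law a probability measure for every \<open>\<omega>\<close>.\<close>

definition weights :: "real \<Rightarrow> 'a \<Rightarrow> nat \<Rightarrow> real" where
  "weights t \<omega> j = (if \<forall>i\<le>n. 0 \<le> state (path \<omega>) t i then state (path \<omega>) t j else of_bool (j = 0))"

lemma weights_prob: "0 \<le> weights t \<omega> j" if "j \<le> n"
  using that by (simp add: weights_def)

lemma weights_sum: "(\<Sum>j\<le>n. weights t \<omega> j) = 1"
proof (cases "\<forall>i\<le>n. 0 \<le> state (path \<omega>) t i")
  case True
  then show ?thesis using state_sum by (simp add: weights_def)
next
  case False
  then have "(\<Sum>j\<le>n. weights t \<omega> j) = (\<Sum>j\<le>n. if j = 0 then 1 else 0)"
    unfolding weights_def by (intro sum.cong) auto
  then show ?thesis by simp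
qed

definition explicit_law :: "real \<Rightarrow> 'a \<Rightarrow> real measure" where
  "explicit_law t \<omega> = atom_law n x (weights t \<omega>)"

lemma explicit_law:
  "sets (explicit_law t \<omega>) = sets borel" "prob_space (explicit_law t \<omega>)"
  "E \<in> sets borel \<Longrightarrow> emeasure (explicit_law t \<omega>) E = ennreal (\<Sum>j\<le>n. weights t \<omega> j * indicat_real E (x j))"
  "E \<in> sets borel \<Longrightarrow> measure (explicit_law t \<omega>) E = (\<Sum>j\<le>n. weights t \<omega> j * indicat_real E (x j))"
  unfolding explicit_law_def by (rule atom_law; use weights_prob weights_sum in simp)+

lemma explicit_law_good:
  assumes "good \<omega>" "0 \<le> t" "E \<in> sets borel"
  shows "measure (explicit_law t \<omega>) E = mass E t \<omega>"
  using explicit_law(4)[OF assms(3)] state_good(1)[OF assms(1,2)] by (simp add: weights_def mass_def)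

lemma state_measurable: "0 \<le> t \<Longrightarrow> (\<lambda>\<omega>. state (path \<omega>) t j) \<in> borel_measurable (F t)"
proof -
  assume t: "0 \<le> t"
  have "(\<lambda>\<omega>. W (stop_at (path_gap (path \<omega>) i) t) \<omega>) \<in> borel_measurable (F t)" for i
    using continuous_adaptedD(1)[OF continuous_adapted_stopped[OF continuous_adapted_W continuous_adapted_gap[of i]] t order_refl]
    by (simp add: gap_process_path)
  then show ?thesis unfolding state_def by (intro borel_measurable_add borel_measurable_sum
    borel_measurable_times borel_measurable_diff) auto
qed

lemma explicit_law_measurable:
  assumes t: "0 \<le> t" shows "explicit_law t \<in> F t \<rightarrow>\<^sub>M prob_algebra borel"
proof (rule measurable_prob_algebraI)
  show "prob_space (explicit_law t \<omega>)" for \<omega> by (rule explicit_law)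
  show "explicit_law t \<in> F t \<rightarrow>\<^sub>M subprob_algebra borel"
  proof (rule measurable_subprob_algebra)
    fix E :: "real set" assume E: "E \<in> sets borel"
    have [measurable]: "(\<lambda>\<omega>. state (path \<omega>) t j) \<in> borel_measurable (F t)" for j
      by (rule state_measurable[OF t])
    have [measurable]: "(\<lambda>\<omega>. weights t \<omega> j) \<in> borel_measurable (F t)" for j
      unfolding weights_def by measurable
    show "(\<lambda>\<omega>. emeasure (explicit_law t \<omega>) E) \<in> borel_measurable (F t)"
      unfolding explicit_law(3)[OF E] by measurable
  qed (use explicit_law in \<open>auto intro: prob_space_imp_subprob_space\<close>)
qed

lemma explicit_conditional_law: "conditional_law_process M F X explicit_law"
  unfolding conditional_law_process_def
proof (intro conjI allI impI ballI)
  fix t :: real assume "0 \<le> t"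
  then show "explicit_law t \<in> F t \<rightarrow>\<^sub>M prob_algebra borel" by (rule explicit_law_measurable)
next
  fix t :: real and E :: "real set" assume t: "0 \<le> t" and E: "E \<in> sets borel"
  show "AE \<omega> in M. measure (explicit_law t \<omega>) E = real_cond_exp M (F t) (\<lambda>\<omega>'. indicat_real E (X \<omega>')) \<omega>"
    using AE_good mass_cond_exp[OF E t]
    by eventually_elim (use explicit_law_good t E in auto)
next
  show "AE \<omega> in M. \<forall>E\<in>sets borel. \<forall>t\<ge>0. continuous (at_right t) (\<lambda>s. measure (explicit_law s \<omega>) E)"
    using AE_good
  proof eventually_elim
    case (elim \<omega>)
    show ?case
    proof (intro ballI allI impI)
      fix E :: "real set" and t :: real assume E: "E \<in> sets borel" and t: "0 \<le> t"
      have "continuous_on {0..} (\<lambda>s. mass E s \<omega>)"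
        using elim E by (intro mass_continuous) (auto simp: good_def)
      then have "continuous_on {0..} (\<lambda>s. measure (explicit_law s \<omega>) E)"
        by (rule continuous_on_eq) (use explicit_law_good[OF elim _ E] in auto)
      then show "continuous (at_right t) (\<lambda>s. measure (explicit_law s \<omega>) E)"
        using t by (rule continuous_on_imp_at_right)
    qed
  qed
qed

section \<open>Uniqueness of versions and the kernel along a path\<close>

lemma x_inj: "inj_on x {..n}"
  by (rule inj_onI) (metis atMost_iff less_irrefl linorder_neqE_nat x_less)

text \<open>The exceptional set must not depend on E or t. Only countably many almost sure
  identities are combined, one per atom and rational time; right continuity extends them to all
  times, and since the atoms carry total mass 1 they determine the measure of every Borel
  set.\<close>

lemma conditional_law_unique:
  assumes Mu: "conditional_law_process M F X Mu"
  shows "AE \<omega> in M. good \<omega> \<and> (\<forall>t\<ge>0. prob_space (Mu t \<omega>) \<and> sets (Mu t \<omega>) = sets borel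
    \<and> (\<forall>E\<in>sets borel. measure (Mu t \<omega>) E = mass E t \<omega>))"
proof -
  have "AE \<omega> in M. measure (Mu q \<omega>) {x j} = mass {x j} q \<omega>" if "0 \<le> q" for q j
  proof -
    have "AE \<omega> in M. measure (Mu q \<omega>) {x j} = real_cond_exp M (F q) (\<lambda>\<omega>'. indicat_real {x j} (X \<omega>')) \<omega>"
      using Mu that unfolding conditional_law_process_def by simp
    moreover have "AE \<omega> in M. real_cond_exp M (F q) (\<lambda>\<omega>. indicat_real {x j} (X \<omega>)) \<omega> = mass {x j} q \<omega>"
      using that by (intro mass_cond_exp) auto
    ultimately show ?thesis by eventually_elim simp
  qed
  then have "AE \<omega> in M. \<forall>j. \<forall>q\<in>\<rat> \<inter> {0..}. measure (Mu q \<omega>) {x j} = mass {x j} q \<omega>"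
    unfolding AE_all_countable
    by (intro allI AE_ball_countable[THEN iffD2]) (auto simp: countable_rat)
  moreover have "AE \<omega> in M. \<forall>E\<in>sets borel. \<forall>t\<ge>0. continuous (at_right t) (\<lambda>s. measure (Mu s \<omega>) E)"
    using Mu by (simp add: conditional_law_process_def)
  ultimately show ?thesis
    using AE_good
  proof eventually_elim
    case (elim \<omega>)
    have \<omega>: "\<omega> \<in> space M" using elim(3) by (simp add: good_def)
    have Mu_prob: "prob_space (Mu t \<omega>)" "sets (Mu t \<omega>) = sets borel" if "0 \<le> t" for t
    proof -
      have "Mu t \<in> F t \<rightarrow>\<^sub>M prob_algebra borel" using Mu that by (simp add: conditional_law_process_def)
      then have "Mu t \<omega> \<in> space (prob_algebra borel)" using \<omega> by (intro measurable_space[of "Mu t" "F t"]) auto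
      then show "prob_space (Mu t \<omega>)" "sets (Mu t \<omega>) = sets borel" by (auto simp: space_prob_algebra)
    qed
    have mass_atom: "mass {x j} t \<omega> = state (path \<omega>) t j" if "j \<le> n" for j t
    proof -
      have "mass {x j} t \<omega> = (\<Sum>i\<le>n. if i = j then state (path \<omega>) t i else 0)"
        unfolding mass_def by (rule sum.cong) (use that x_inj in \<open>auto simp: inj_on_def indicator_def\<close>)
      then show ?thesis using that by simp
    qed
    have atom: "measure (Mu t \<omega>) {x j} = state (path \<omega>) t j" if "0 \<le> t" "j \<le> n" for t j
    proof -
      have "measure (Mu t \<omega>) {x j} = mass {x j} t \<omega>"
        by (rule eq_of_right_continuous[of "\<lambda>t. measure (Mu t \<omega>) {x j}" "\<lambda>t. mass {x j} t \<omega>"])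
          (use elim \<omega> that in \<open>auto intro!: mass_continuous\<close>)
      then show ?thesis using mass_atom that by simp
    qed
    have "measure (Mu t \<omega>) E = mass E t \<omega>" if t: "0 \<le> t" and E: "E \<in> sets borel" for t E
    proof -
      have "measure (Mu t \<omega>) E = (\<Sum>j\<le>n. measure (Mu t \<omega>) {x j} * indicat_real E (x j))"
        using atom[OF t] state_sum by (intro finite_law_from_atoms Mu_prob t E x_inj) auto
      then show ?thesis using atom[OF t] by (simp add: mass_def)
    qed
    then show ?case using elim(3) Mu_prob by blast
  qed
qed

text \<open>In a stage, numerator and denominator of \<open>K_fun_set_integral\<close> share the
  factor \<open>1 - q\<close>, which is positive; it cancels and leaves the slope of the stage.
  After stopping the law is Dirac and both sides vanish.\<close>

lemma K_fun_state:
  assumes good: "good \<omega>" and s: "0 \<le> s" and E: "E \<in> sets borel"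
    and \<nu>: "prob_space \<nu>" "sets \<nu> = sets borel" "\<And>E. E \<in> sets borel \<Longrightarrow> measure \<nu> E = mass E s \<omega>"
  shows "(LINT y:E|\<nu>. K_fun \<nu> y) = step.H E s \<omega>"
proof -
  have pre: "continuous_on {0..} (path \<omega>)" "W 0 \<omega> = 0" "\<exists>t\<ge>0. 0 \<le> path_gap (path \<omega>) n t"
    using good W_cont by (auto simp: good_def)
  show ?thesis
  proof (cases "s < hit_time (path_gap (path \<omega>) n)")
    case True
    show ?thesis
    proof (rule state_before[OF pre s True])
      fix i q assume i: "i < n" and less: "x i < bary (Suc i)" and q: "0 < q" "q < 1"
        and st: "\<And>j. state (path \<omega>) s j = q * of_bool (i = j) + (1 - q) * cond_weight (Suc i) j"
        and bh: "\<And>k. k \<le> n \<Longrightarrow> before_hit (path_gap (path \<omega>) k) s \<longleftrightarrow> i < k"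
      \<comment> \<open>\<open>cond_weight (Suc i)\<close> vanishes up to \<open>x i\<close>, so no
        mass lies below \<open>x i\<close>; the mass at \<open>x i\<close> is \<open>q\<close>,
        hence it is the least atom.\<close>
      interpret law: finite_law \<nu> "{i..n}" x "state (path \<omega>) s"
      proof (rule finite_law.intro)
        show "0 < state (path \<omega>) s j" if "j \<in> {i..n}" for j
          unfolding st using that q m_pos[of j] tail_pos[of "Suc i"] i
          by (cases "i = j") (auto simp: cond_weight_def intro!: add_nonneg_pos)
        show "inj_on x {i..n}" by (rule inj_on_subset[OF x_inj]) auto
        show "measure \<nu> E = (\<Sum>j\<in>{i..n}. state (path \<omega>) s j * indicat_real E (x j))" if "E \<in> sets borel" for E
          unfolding \<nu>(3)[OF that] mass_def
          by (rule sum.mono_neutral_right) (auto simp: st cond_weight_def)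
      qed (fact \<nu>(1,2) finite_atLeastAtMost)+
      have R: "{i..n} - {i} = {Suc i..n}" using i by auto
      have stR: "state (path \<omega>) s j = (1 - q) * cond_weight (Suc i) j" if "j \<in> {Suc i..n}" for j
        using that by (simp add: st)
      have sumR: "(\<Sum>j\<in>{Suc i..n}. cond_weight (Suc i) j * f j) = (\<Sum>j\<le>n. cond_weight (Suc i) j * f j)" for f
        by (rule sum.mono_neutral_left) (auto simp: cond_weight_def)
      have r1: "(\<Sum>j\<in>{Suc i..n}. state (path \<omega>) s j * f j) = (1 - q) * (\<Sum>j\<le>n. cond_weight (Suc i) j * f j)" for f
        unfolding sumR[symmetric] sum_distrib_left by (rule sum.cong) (simp_all add: stR mult.assoc)
      have r2: "(\<Sum>j\<in>{Suc i..n}. state (path \<omega>) s j) = 1 - q"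
        using r1[of "\<lambda>_. 1"] cond_weight_sum[of "Suc i"] i by simp
      have r3: "(\<Sum>j\<in>{Suc i..n}. state (path \<omega>) s j * (x j - x i)) = (1 - q) * (bary (Suc i) - x i)"
        using r1[of x] r2 cond_weight_mean[of "Suc i"] i
        by (simp add: right_diff_distrib sum_subtractf flip: sum_distrib_right)
      have "(LINT y:E|\<nu>. K_fun \<nu> y) =
        ((1 - q) * (\<Sum>j\<le>n. cond_weight (Suc i) j * indicat_real E (x j)) - (1 - q) * indicat_real E (x i))
          / ((1 - q) * (bary (Suc i) - x i))"
      proof -
        have "x i < x j" if "j \<in> {i..n}" "j \<noteq> i" for j using that by (intro x_less) auto
        moreover have "i \<in> {i..n}" "{i..n} \<noteq> {i}" using i by auto
        ultimately show ?thesis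
          using law.K_fun_set_integral[of i E] E
          unfolding R r1[of "\<lambda>j. indicat_real E (x j)"] r2 r3 by blast
      qed
      also have "\<dots> = ((\<Sum>j\<le>n. cond_weight (Suc i) j * indicat_real E (x j)) - indicat_real E (x i)) / (bary (Suc i) - x i)"
        using q by (simp flip: right_diff_distrib)
      also have "\<dots> = set_slope E i"
      proof -
        have "(\<Sum>j\<le>n. of_bool (i = j) * indicat_real E (x j)) = (\<Sum>j\<le>n. if j = i then indicat_real E (x j) else 0)"
          by (rule sum.cong) auto
        then have "(\<Sum>j\<le>n. of_bool (i = j) * indicat_real E (x j)) = indicat_real E (x i)" using i by simp
        then show ?thesis
          by (simp add: set_slope_def slope_def left_diff_distrib sum_subtractf flip: sum_divide_distrib)
      qed
      also have "\<dots> = step.H E s \<omega>"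
      proof -
        \<comment> \<open>The predicates hold for \<open>k > i\<close> only, so the difference for
          \<open>Suc k\<close> and \<open>k\<close> is 1 at \<open>k = i\<close> and 0
          elsewhere.\<close>
        have "step.H E s \<omega> = (\<Sum>k<n. if k = i then set_slope E k else 0)"
          unfolding H_eq by (rule sum.cong) (auto simp: bh)
        then show ?thesis using i by simp
      qed
      finally show ?thesis .
    qed
  next
    case False
    then have "hit_time (path_gap (path \<omega>) n) \<le> s" by simp
    then show ?thesis
    proof (rule state_after[OF pre])
      fix i assume i: "i \<le> n" and st: "\<And>j. j \<le> n \<Longrightarrow> state (path \<omega>) s j = of_bool (i = j)"
        and bh: "\<And>k. k \<le> n \<Longrightarrow> \<not> before_hit (path_gap (path \<omega>) k) s"
      interpret law: finite_law \<nu> "{i}" x "\<lambda>_. 1"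
      proof (rule finite_law.intro)
        show "measure \<nu> E = (\<Sum>j\<in>{i}. 1 * indicat_real E (x j))" if "E \<in> sets borel" for E
          unfolding \<nu>(3)[OF that] mass_def
          by (rule sum.mono_neutral_cong_right) (use i st in auto)
      qed (use \<nu>(1,2) in auto)
      have "step.H E s \<omega> = 0" unfolding H_eq by (rule sum.neutral) (simp add: bh)
      then show ?thesis using law.K_fun_dirac[of i] by simp
    qed
  qed
qed

end

theorem mainTheorem7:
  fixes M :: "'a measure" and W :: "real \<Rightarrow> 'a \<Rightarrow> real" and \<mu> :: "real measure"
    and F :: "real \<Rightarrow> 'a measure" and T :: "'a \<Rightarrow> ennreal"
  assumes "finitely_supported \<mu>" and "(\<integral>x. x \<partial>\<mu>) = 0"
    and "wiener_process M W"
    and "F = natural_filtration M W"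
    and "T = azema_yor_time \<mu> W"
  shows "(\<exists>Mu. conditional_law_process M F (stopped_value W T) Mu)
    \<and> (\<forall>Mu. conditional_law_process M F (stopped_value W T) Mu \<longrightarrow>
        (\<exists>I. (\<forall>E\<in>sets borel.
                is_ito_integral M F W (\<lambda>s \<omega>. LINT x:E|Mu s \<omega>. K_fun (Mu s \<omega>) x) (I E))
           \<and> (AE \<omega> in M. \<forall>E\<in>sets borel. \<forall>t>0.
                measure (Mu t \<omega>) E = measure \<mu> E + I E t \<omega>)))"
proof -
  obtain n x m where atoms: "atom_seq n x m" and law: "finite_law \<mu> {..n} x m"
    using finitely_supported_atom_seq[OF assms(1,2)] .
  interpret azema_yor M W F n x m \<mu>
    using assms atoms law by (simp add: azema_yor_def wiener_def azema_yor_axioms_def)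
  have "\<exists>I. (\<forall>E\<in>sets borel.
                is_ito_integral M F W (\<lambda>s \<omega>. LINT x:E|Mu s \<omega>. K_fun (Mu s \<omega>) x) (I E))
           \<and> (AE \<omega> in M. \<forall>E\<in>sets borel. \<forall>t>0.
                measure (Mu t \<omega>) E = measure \<mu> E + I E t \<omega>)"
    if "conditional_law_process M F X Mu" for Mu
  \<comment> \<open>The same integral process serves every version \<open>Mu\<close>. The subtracted
    initial term, in the form required by \<open>is_ito_integral_J\<close>, is 0 by
    \<open>J_0\<close>.\<close>
  proof (intro exI[of _ "\<lambda>E t \<omega>. step.J E t \<omega> - step.J E 0 \<omega>"] conjI ballI)
    fix E :: "real set" assume E: "E \<in> sets borel"
    show "is_ito_integral M F W (\<lambda>s \<omega>. LINT x:E|Mu s \<omega>. K_fun (Mu s \<omega>) x) (\<lambda>t \<omega>. step.J E t \<omega> - step.J E 0 \<omega>)"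
    proof (rule step.is_ito_integral_J)
      show "AE \<omega> in M. \<forall>s\<ge>0. (LINT x:E|Mu s \<omega>. K_fun (Mu s \<omega>) x) = step.H E s \<omega>"
        using conditional_law_unique[OF that]
        by eventually_elim (auto intro!: K_fun_state E)
    qed
  next
    show "AE \<omega> in M. \<forall>E\<in>sets borel. \<forall>t>0. measure (Mu t \<omega>) E = measure \<mu> E + (step.J E t \<omega> - step.J E 0 \<omega>)"
      using conditional_law_unique[OF that]
      by eventually_elim (auto simp: mass_eq J_0 good_def)
  qed
  then show ?thesis using explicit_conditional_law unfolding assms(5) by blast
qed

end
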